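(* Let $d\ge2$ and $f(u)=bu^2$ with $b\in\mathbb{R}^d\setminus\{0\}$. There exists $\alpha>0$ (independent of $u_0$) such that the following holds. Let $u_0\in\dot B^{\frac d2-1}_{2,1}(\mathbb{R}^d)\cap\dot B^{\frac d2+1}_{2,1}(\mathbb{R}^d)\cap\dot B^{-d/2}_{2,\infty}(\mathbb{R}^d)$ satisfy $$\|u_0\|_{\dot B^{\frac d2-1,L}_{2,1}}+\|u_0\|_{\dot B^{\frac d2+1,H}_{2,1}}\le\alpha,$$ and let $u\in C([0,\infty);\dot B^{\frac d2-1}_{2,1}\cap\dot B^{\frac d2+1}_{2,1})\cap L^1((0,\infty);\dot B^{\frac d2+1}_{2,1})$ be the global solution of $$u_t-\Delta Pu+\nabla\cdot f(u)=0\quad(x\in\mathbb{R}^d,\ t>0),\qquad u(x,0)=u_0(x),$$ satisfying $\|u(t)\|_{L^2}\le C(1+t)^{-\frac d4}$ for all $t\ge 0$, with $C$ independent of $t$. Assume that there exist $\eta,\Lambda_2>0$ such that $$|\widehat u_0(\xi)|\ge\eta\qquad\text{for }|\xi|\le\Lambda_2 .$$ Then there exist $c_\eta>0$ and $T_\eta>0$ such that $$\|u(t)\|_{L^2}\ge c_\eta(1+t)^{-\frac d4},\qquad t\ge T_\eta .$$ Consequently, the decay rate $(1+t)^{-d/4}$ of $\|u(t)\|_{L^2}$ is optimal.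
   Context: The unknown $u=u(x,t)$ is real valued. Fourier transform: $\hat f(\xi)=\int_{\mathbb{R}^d}e^{-ix\cdot\xi}f(x)\,dx$. The operator $P$ is the Fourier multiplier $\widehat{Pu}(\xi)=\frac{1}{1+|\xi|^2}\hat u(\xi)$, so $-\Delta P$ has symbol $\frac{|\xi|^2}{1+|\xi|^2}$. Littlewood--Paley decomposition: let $\chi$ be a smooth function with values in $[0,1]$, supported in the ball $B(0,4/3)$ and equal to $1$ on $B(0,3/4)$; set $\varphi(\xi)=\chi(\xi/2)-\chi(\xi)$ and $\dot\Delta_k=\varphi(2^{-k}D)$ for $k\in\mathbb{Z}$. $\mathcal{S}_h'$ denotes the space of tempered distributions modulo polynomials, i.e. those for which $u=\sum_{k\in\mathbb{Z}}\dot\Delta_k u$. Homogeneous Besov spaces are the sets of $f\in\mathcal{S}_h'$ with finite norm, where $\|f\|_{\dot B^s_{2,1}}=\sum_{k\in\mathbb{Z}}2^{ks}\|\dot\Delta_kf\|_{L^2}$ and $\|f\|_{\dot B^s_{2,\infty}}=\sup_{k\in\mathbb{Z}}2^{ks}\|\dot\Delta_kf\|_{L^2}$. Low- and high-frequency semi-norms: $\|f\|_{\dot B^{s,L}_{2,1}}=\sum_{k\le0}2^{ks}\|\dot\Delta_kf\|_{L^2}$ and $\|f\|_{\dot B^{s,H}_{2,1}}=\sum_{k>0}2^{ks}\|\dot\Delta_kf\|_{L^2}$. The constant $\alpha$ is the smallness constant of the small-data global existence theorem for this problem: it is such that the smallness condition above guarantees the existence and uniqueness of the global solution in the stated class. 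*)

theory Defs
  imports "HOL-Analysis.Analysis" "HOL-Library.Landau_Symbols"
begin

section \<open>Smooth and Schwartz functions on Euclidean space\<close>

definition partial_deriv :: "'n::finite \<Rightarrow> (real^'n \<Rightarrow> 'b::real_normed_vector) \<Rightarrow> real^'n \<Rightarrow> 'b" where
  "partial_deriv j f x = vector_derivative (\<lambda>h. f (x + h *\<^sub>R axis j 1)) (at 0)"

text \<open>Multi-indices are represented by lists of coordinates: the list \<open>[j1, ..., jm]\<close> stands
  for the iterated partial derivative in the directions \<open>j1, ..., jm\<close>.\<close>

primrec partial_derivs ::
  "'n::finite list \<Rightarrow> (real^'n \<Rightarrow> 'b::real_normed_vector) \<Rightarrow> real^'n \<Rightarrow> 'b" where
  "partial_derivs [] f = f"
| "partial_derivs (j # js) f = partial_deriv j (partial_derivs js f)"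

definition smooth :: "(real^'n \<Rightarrow> 'b::real_normed_vector) \<Rightarrow> bool" where
  "smooth f \<longleftrightarrow> (\<forall>js x. partial_derivs js f differentiable (at x))"

definition schwartz :: "(real^'n \<Rightarrow> complex) set" where
  "schwartz = {\<phi>. smooth \<phi> \<and>
     (\<forall>N js. bounded (range (\<lambda>x. (1 + norm x) ^ N *\<^sub>R partial_derivs js \<phi> x)))}"

definition schwartz_seminorm :: "nat \<Rightarrow> (real^'n \<Rightarrow> complex) \<Rightarrow> real" where
  "schwartz_seminorm N \<phi> =
     (SUP (js, x) \<in> {js. length js \<le> N} \<times> UNIV. (1 + norm x) ^ N * norm (partial_derivs js \<phi> x))"


section \<open>Tempered distributions\<close>

text \<open>A distribution is a functional of which only the values on \<^const>\<open>schwartz\<close> are relevant;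
  equality of distributions is always expressed on \<^const>\<open>schwartz\<close>. The pairing is
  complex bilinear, without conjugation.\<close>

type_synonym 'n distr = "(real^'n \<Rightarrow> complex) \<Rightarrow> complex"

definition tempered_distribution :: "'n::finite distr \<Rightarrow> bool" where
  "tempered_distribution T \<longleftrightarrow>
     (\<forall>\<phi>\<in>schwartz. \<forall>\<psi>\<in>schwartz. T (\<lambda>x. \<phi> x + \<psi> x) = T \<phi> + T \<psi>) \<and>
     (\<forall>c. \<forall>\<phi>\<in>schwartz. T (\<lambda>x. c * \<phi> x) = c * T \<phi>) \<and>
     (\<exists>N C. \<forall>\<phi>\<in>schwartz. norm (T \<phi>) \<le> C * schwartz_seminorm N \<phi>)"

definition distr_of :: "(real^'n \<Rightarrow> complex) \<Rightarrow> 'n::finite distr" where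
  "distr_of f \<phi> = (\<integral>x. f x * \<phi> x \<partial>lborel)"

definition tempered_function :: "(real^'n \<Rightarrow> complex) \<Rightarrow> bool" where
  "tempered_function f \<longleftrightarrow> f \<in> borel_measurable borel \<and>
     (\<forall>\<phi>\<in>schwartz. integrable lborel (\<lambda>x. f x * \<phi> x)) \<and> tempered_distribution (distr_of f)"

definition represents :: "(real^'n \<Rightarrow> complex) \<Rightarrow> 'n::finite distr \<Rightarrow> bool" where
  "represents f T \<longleftrightarrow> tempered_function f \<and> (\<forall>\<phi>\<in>schwartz. T \<phi> = distr_of f \<phi>)"

abbreviation cfun :: "(real^'n \<Rightarrow> real) \<Rightarrow> real^'n \<Rightarrow> complex" where
  "cfun v \<equiv> (\<lambda>x. complex_of_real (v x))"

definition square_integrable :: "(real^'n \<Rightarrow> 'b::real_normed_vector) \<Rightarrow> bool" where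
  "square_integrable f \<longleftrightarrow> f \<in> borel_measurable borel \<and> integrable lborel (\<lambda>x. (norm (f x))\<^sup>2)"

definition L2_norm :: "(real^'n \<Rightarrow> 'b::real_normed_vector) \<Rightarrow> real" where
  "L2_norm f = sqrt (\<integral>x. (norm (f x))\<^sup>2 \<partial>lborel)"

text \<open>The norm in \<open>L\<^sup>2\<close> of a distribution; it is infinite (the infimum over the empty set)
  if the distribution is not given by a square integrable function. If it is, then all such
  functions agree almost everywhere and the infimum is over one value.\<close>

definition distr_L2_norm :: "'n::finite distr \<Rightarrow> ennreal" where
  "distr_L2_norm T =
     (INF g \<in> {g. square_integrable g \<and> (\<forall>\<phi>\<in>schwartz. T \<phi> = distr_of g \<phi>)}. ennreal (L2_norm g))"


section \<open>Fourier transform, multipliers and differential operators\<close>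

definition fourier :: "(real^'n \<Rightarrow> complex) \<Rightarrow> real^'n \<Rightarrow> complex" where
  "fourier \<phi> \<xi> = (\<integral>x. cis (- (x \<bullet> \<xi>)) * \<phi> x \<partial>lborel)"

definition inv_fourier :: "(real^'n \<Rightarrow> complex) \<Rightarrow> real^'n \<Rightarrow> complex" where
  "inv_fourier \<phi> x =
     complex_of_real (1 / (2 * pi) ^ CARD('n)) * (\<integral>\<xi>. cis (x \<bullet> \<xi>) * \<phi> \<xi> \<partial>lborel)"

definition fourier_distr :: "'n::finite distr \<Rightarrow> 'n distr" where
  "fourier_distr T \<phi> = T (fourier \<phi>)"

definition inv_fourier_distr :: "'n::finite distr \<Rightarrow> 'n distr" where
  "inv_fourier_distr T \<phi> = T (inv_fourier \<phi>)"

definition mult_distr :: "(real^'n \<Rightarrow> real) \<Rightarrow> 'n::finite distr \<Rightarrow> 'n distr" where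
  "mult_distr m T \<phi> = T (\<lambda>\<xi>. complex_of_real (m \<xi>) * \<phi> \<xi>)"

definition fourier_multiplier :: "(real^'n \<Rightarrow> real) \<Rightarrow> 'n::finite distr \<Rightarrow> 'n distr" where
  "fourier_multiplier m T = inv_fourier_distr (mult_distr m (fourier_distr T))"

definition P_op :: "'n::finite distr \<Rightarrow> 'n distr" where
  "P_op = fourier_multiplier (\<lambda>\<xi>. 1 / (1 + (norm \<xi>)\<^sup>2))"

definition partial_distr :: "'n::finite \<Rightarrow> 'n distr \<Rightarrow> 'n distr" where
  "partial_distr j T \<phi> = - T (partial_deriv j \<phi>)"

definition laplacian_distr :: "'n::finite distr \<Rightarrow> 'n distr" where
  "laplacian_distr T \<phi> = (\<Sum>j\<in>UNIV. partial_distr j (partial_distr j T) \<phi>)"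

definition div_distr :: "(real^'n \<Rightarrow> real^'n) \<Rightarrow> 'n::finite distr" where
  "div_distr F \<phi> = (\<Sum>j\<in>UNIV. partial_distr j (distr_of (cfun (\<lambda>x. F x $ j))) \<phi>)"


section \<open>Littlewood--Paley decomposition and homogeneous Besov spaces\<close>

definition lp_cutoff :: "(real^'n \<Rightarrow> real) \<Rightarrow> bool" where
  "lp_cutoff chi \<longleftrightarrow> smooth chi \<and> range chi \<subseteq> {0..1} \<and>
     (\<forall>\<xi>. \<xi> \<notin> ball 0 (4/3) \<longrightarrow> chi \<xi> = 0) \<and> (\<forall>\<xi>\<in>ball 0 (3/4). chi \<xi> = 1)"

definition lp_phi :: "(real^'n \<Rightarrow> real) \<Rightarrow> real^'n \<Rightarrow> real" where
  "lp_phi chi \<xi> = chi ((1/2) *\<^sub>R \<xi>) - chi \<xi>"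

definition lp_block :: "(real^'n \<Rightarrow> real) \<Rightarrow> int \<Rightarrow> 'n::finite distr \<Rightarrow> 'n distr" where
  "lp_block chi k = fourier_multiplier (\<lambda>\<xi>. lp_phi chi ((2 powi (- k)) *\<^sub>R \<xi>))"

text \<open>The space \<open>S'\<^sub>h\<close>: the Littlewood--Paley series of \<open>T\<close> converges to \<open>T\<close>
  in the weak-* sense.\<close>

definition S_h :: "(real^'n \<Rightarrow> real) \<Rightarrow> 'n::finite distr set" where
  "S_h chi = {T. tempered_distribution T \<and>
     (\<forall>\<phi>\<in>schwartz. (\<lambda>N. \<Sum>k\<in>{- int N..int N}. lp_block chi k T \<phi>) \<longlonglongrightarrow> T \<phi>)}"

definition besov_term :: "(real^'n \<Rightarrow> real) \<Rightarrow> real \<Rightarrow> 'n::finite distr \<Rightarrow> int \<Rightarrow> ennreal" where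
  "besov_term chi s T k = ennreal (2 powr (real_of_int k * s)) * distr_L2_norm (lp_block chi k T)"

definition besov21_norm :: "(real^'n \<Rightarrow> real) \<Rightarrow> real \<Rightarrow> 'n::finite distr \<Rightarrow> ennreal" where
  "besov21_norm chi s T = (\<Sum>\<^sub>\<infinity>k. besov_term chi s T k)"

definition besov21_norm_low :: "(real^'n \<Rightarrow> real) \<Rightarrow> real \<Rightarrow> 'n::finite distr \<Rightarrow> ennreal" where
  "besov21_norm_low chi s T = (\<Sum>\<^sub>\<infinity>k\<in>{..0}. besov_term chi s T k)"

definition besov21_norm_high :: "(real^'n \<Rightarrow> real) \<Rightarrow> real \<Rightarrow> 'n::finite distr \<Rightarrow> ennreal" where
  "besov21_norm_high chi s T = (\<Sum>\<^sub>\<infinity>k\<in>{0<..}. besov_term chi s T k)"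

definition besov2inf_norm :: "(real^'n \<Rightarrow> real) \<Rightarrow> real \<Rightarrow> 'n::finite distr \<Rightarrow> ennreal" where
  "besov2inf_norm chi s T = (SUP k. besov_term chi s T k)"

definition besov21 :: "(real^'n \<Rightarrow> real) \<Rightarrow> real \<Rightarrow> 'n::finite distr set" where
  "besov21 chi s = {T \<in> S_h chi. besov21_norm chi s T < \<infinity>}"

definition besov2inf :: "(real^'n \<Rightarrow> real) \<Rightarrow> real \<Rightarrow> 'n::finite distr set" where
  "besov2inf chi s = {T \<in> S_h chi. besov2inf_norm chi s T < \<infinity>}"


section \<open>Global solutions\<close>

definition continuous_in_besov21 ::
  "(real^'n \<Rightarrow> real) \<Rightarrow> real \<Rightarrow> (real \<Rightarrow> real^'n \<Rightarrow> real) \<Rightarrow> bool" where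
  "continuous_in_besov21 chi s u \<longleftrightarrow>
     (\<forall>t\<ge>0. distr_of (cfun (u t)) \<in> besov21 chi s \<and>
        ((\<lambda>\<tau>. besov21_norm chi s (distr_of (cfun (\<lambda>x. u \<tau> x - u t x)))) \<longlongrightarrow> 0) (at t within {0..}))"

definition integrable_in_besov21 ::
  "(real^'n \<Rightarrow> real) \<Rightarrow> real \<Rightarrow> (real \<Rightarrow> real^'n \<Rightarrow> real) \<Rightarrow> bool" where
  "integrable_in_besov21 chi s u \<longleftrightarrow>
     (\<integral>\<^sup>+t\<in>{0<..}. besov21_norm chi s (distr_of (cfun (u t))) \<partial>lborel) < \<infinity>"

text \<open>The equation \<open>u\<^sub>t - \<Delta>Pu + \<nabla>\<cdot>f(u) = 0\<close> is understood in the sense of tempered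
  distributions in \<open>x\<close> at every time \<open>t > 0\<close>, and the initial value as an equality of
  tempered distributions. Elements of the class below are bounded functions of \<open>x\<close>
  at each time (the homogeneous Besov space with indices \<open>d/2\<close>, 2, 1 embeds into the bounded
  functions), so that \<open>f(u(t))\<close> is a tempered distribution for continuous \<open>f\<close>, and the
  right-hand side is continuous in time. Measurability in \<open>t\<close> of the Besov norm follows from
  the continuity in time.\<close>

definition global_solution ::
  "(real^'n \<Rightarrow> real) \<Rightarrow> (real \<Rightarrow> real^'n) \<Rightarrow> 'n::finite distr \<Rightarrow> (real \<Rightarrow> real^'n \<Rightarrow> real) \<Rightarrow> bool" where
  "global_solution chi f u0 u \<longleftrightarrow>
     (\<forall>t\<ge>0. tempered_function (cfun (u t))) \<and>
     continuous_in_besov21 chi (CARD('n) / 2 - 1) u \<and>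
     continuous_in_besov21 chi (CARD('n) / 2 + 1) u \<and>
     integrable_in_besov21 chi (CARD('n) / 2 + 1) u \<and>
     (\<forall>t>0. \<forall>\<phi>\<in>schwartz.
        ((\<lambda>\<tau>. distr_of (cfun (u \<tau>)) \<phi>) has_vector_derivative
           (laplacian_distr (P_op (distr_of (cfun (u t)))) \<phi> - div_distr (\<lambda>x. f (u t x)) \<phi>)) (at t)) \<and>
     represents (cfun (u 0)) u0"

definition small_data :: "(real^'n \<Rightarrow> real) \<Rightarrow> real \<Rightarrow> 'n::finite distr \<Rightarrow> bool" where
  "small_data chi \<alpha> u0 \<longleftrightarrow>
     besov21_norm_low chi (CARD('n) / 2 - 1) u0 + besov21_norm_high chi (CARD('n) / 2 + 1) u0 \<le> ennreal \<alpha>"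

definition real_distr :: "'n::finite distr \<Rightarrow> bool" where
  "real_distr T \<longleftrightarrow> (\<forall>\<phi>\<in>schwartz. T (\<lambda>x. cnj (\<phi> x)) = cnj (T \<phi>))"

text \<open>\<open>\<alpha>\<close> is a smallness constant for the small-data global existence theorem.\<close>

definition smallness_constant ::
  "(real^'n \<Rightarrow> real) \<Rightarrow> (real \<Rightarrow> real^'n) \<Rightarrow> real \<Rightarrow> bool" where
  "smallness_constant chi f \<alpha> \<longleftrightarrow> \<alpha> > 0 \<and>
     (\<forall>u0 \<in> besov21 chi (CARD('n::finite) / 2 - 1) \<inter> besov21 chi (CARD('n) / 2 + 1).
        real_distr u0 \<longrightarrow> small_data chi \<alpha> u0 \<longrightarrow>
          (\<exists>u. global_solution chi f u0 u) \<and>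
          (\<forall>u v. global_solution chi f u0 u \<longrightarrow> global_solution chi f u0 v \<longrightarrow>
             (\<forall>t\<ge>0. AE x in lborel. u t x = v t x)))"

end

theory Submission
  imports Defs "HOL-Probability.Characteristic_Functions" "HOL-Probability.Sinc_Integral"
    "HOL-Real_Asymp.Real_Asymp"
begin

text \<open>
At low frequencies the nonlinear term is weaker than the linear one. Write \<open>m(\<xi>) = |\<xi>|\<^sup>2 / (1 + |\<xi>|\<^sup>2)\<close>
for the symbol of \<open>-\<Delta>P\<close> and \<open>v\<close> for the Fourier transform of the solution. Duhamel's formula reads
\<open>v(t) = exp(-t m) v(0) - \<integral>\<^sub>0\<^sup>t exp(-(t - s) m) i (b \<bullet> \<xi>) w(s) ds\<close>, where \<open>w(s)\<close> is the transform of \<open>u(s)\<^sup>2\<close>.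
The assumed decay bounds \<open>w(s)\<close> uniformly in \<open>\<xi>\<close> by \<open>\<parallel>u(s)\<parallel>\<^sup>2\<close>, hence by \<open>C\<^sup>2 (1 + s)^(-d/2)\<close>
and by \<open>C\<^sup>2 / (1 + s)\<close>, as \<open>d \<ge> 2\<close>. The integral is therefore at most \<open>C\<^sup>2 |b| |\<xi>| ln (1 + t)\<close>.
For large \<open>t\<close>, on the ball \<open>|\<xi>| \<le> 1 / \<surd>t\<close> the first term has modulus at least \<open>\<eta> / e\<close>, whereas the second one is
\<open>O(ln (1 + t) / \<surd>t)\<close>, which tends to zero. So \<open>|v(t)|\<close> is bounded below on a ball of volume
proportional to \<open>t^(-d/2)\<close>, and Plancherel's identity gives the lower bound for \<open>\<parallel>u(t)\<parallel>\<close>.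

The solution satisfies its equation only when it is tested against Schwartz functions, and the
proof follows this form: \<open>v(t)\<close> is never constructed, only its pairings with smooth compactly
supported functions \<open>\<phi>\<close> of the frequency occur (\<open>fourier_pairing\<close>). For such \<open>\<phi>\<close>
the transform is a Schwartz function, inversion holds, and Plancherel's identity bounds the pairing
by \<open>\<parallel>u(t)\<parallel> \<parallel>\<phi>\<parallel>\<close>. Duhamel's formula becomes an estimate for \<open>\<integral> g exp(-t m) \<phi>\<close>, where \<open>g\<close> is the
transform of the initial value (\<open>Duhamel_estimate\<close>). It starts from time zero, where only
convergence in Besov norms is known; \<open>weakly_continuous_at_0\<close> turns it into convergence of the
pairings. Finally \<open>\<phi>\<close> runs through an approximation of \<open>cnj (sgn g)\<close> cut off at \<open>|\<xi>| \<approx> 1 / \<surd>t\<close>, so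
that the phase of \<open>g\<close> cancels and the integral becomes \<open>\<integral> |g| exp(-t m)\<close> over that ball
(\<open>low_frequency_lower_bound\<close>).
\<close>

section \<open>Calculus of smooth functions\<close>

text \<open>A partial derivative is the derivative along a coordinate line; through this lemma the rules for
Frechet derivatives become rules for partial derivatives.\<close>

lemma partial_deriv_eqI:
  fixes f :: "real^'n \<Rightarrow> 'b::real_normed_vector"
  assumes "(f has_derivative D) (at x)"
  shows "partial_deriv j f x = D (axis j 1)"
proof -
  have 1: "((\<lambda>h::real. x + h *\<^sub>R axis j 1) has_derivative (\<lambda>h. h *\<^sub>R axis j 1)) (at 0)"
    by (auto intro!: derivative_eq_intros)
  have "((\<lambda>h. f (x + h *\<^sub>R axis j 1)) has_derivative (\<lambda>h. D (h *\<^sub>R axis j 1))) (at 0)"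
    by (rule has_derivative_compose[OF 1]) (use assms in simp)
  moreover have "D (h *\<^sub>R axis j 1) = h *\<^sub>R D (axis j 1)" for h
    using assms by (metis has_derivative_linear linear_scale)
  ultimately show ?thesis
    unfolding partial_deriv_def
    by (intro vector_derivative_at) (simp add: has_vector_derivative_def)
qed

lemma partial_derivs_snoc:
  "partial_derivs (js @ [j]) f = partial_derivs js (partial_deriv j f)"
  by (induction js) auto

text \<open>The recursion peels off the derivative that is applied first, whereas \<^const>\<open>partial_derivs\<close>
peels off the one that is applied last. With this order the product and chain rules pass
through an induction on the number of derivatives.\<close>

primrec times_differentiable :: "nat \<Rightarrow> (real^'n \<Rightarrow> 'b::real_normed_vector) \<Rightarrow> bool" where
  "times_differentiable 0 f \<longleftrightarrow> (\<forall>x. f differentiable (at x))"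
| "times_differentiable (Suc n) f \<longleftrightarrow>
     (\<forall>x. f differentiable (at x)) \<and> (\<forall>j. times_differentiable n (partial_deriv j f))"

lemma times_differentiable_iff:
  "times_differentiable n f \<longleftrightarrow>
     (\<forall>js x. length js \<le> n \<longrightarrow> partial_derivs js f differentiable (at x))"
proof (induction n arbitrary: f)
  case 0
  then show ?case by auto
next
  case (Suc n)
  show ?case (is "?l \<longleftrightarrow> ?r")
  proof
    assume l: ?l
    show ?r
    proof (intro allI impI)
      fix js :: "'a list" and x assume "length js \<le> Suc n"
      then show "partial_derivs js f differentiable (at x)"
        using l Suc by (cases js rule: rev_cases) (auto simp: partial_derivs_snoc)
    qed
  next
    assume r: ?r
    have "f differentiable (at x)" for x
      using r[rule_format, of "[]"] by simp
    moreover have "partial_derivs js (partial_deriv j f) differentiable (at x)"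
      if "length js \<le> n" for js j x
      using r[rule_format, of "js @ [j]"] that by (simp add: partial_derivs_snoc)
    ultimately show ?l
      using Suc by simp
  qed
qed

lemma smooth_iff_times_differentiable: "smooth f \<longleftrightarrow> (\<forall>n. times_differentiable n f)"
  unfolding smooth_def times_differentiable_iff by auto

lemma times_differentiable_imp_differentiable:
  "times_differentiable n f \<Longrightarrow> f differentiable (at x)"
  by (cases n) auto

lemma times_differentiable_SucD: "times_differentiable (Suc n) f \<Longrightarrow> times_differentiable n f"
  unfolding times_differentiable_iff by auto

lemma smooth_imp_differentiable: "smooth f \<Longrightarrow> f differentiable (at x)"
  using smooth_iff_times_differentiable times_differentiable_imp_differentiable by blast

lemma smooth_imp_continuous: "smooth f \<Longrightarrow> continuous_on UNIV f"
  by (meson continuous_at_imp_continuous_on differentiable_imp_continuous_within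
      smooth_imp_differentiable)

lemma smooth_imp_measurable [measurable_dest]: "smooth f \<Longrightarrow> f \<in> borel_measurable borel"
  by (simp add: borel_measurable_continuous_onI smooth_imp_continuous)

lemma smooth_partial_deriv: "smooth f \<Longrightarrow> smooth (partial_deriv j f)"
  unfolding smooth_def by (metis partial_derivs_snoc)

lemma partial_deriv_add:
  assumes "f differentiable (at x)" "g differentiable (at x)"
  shows "partial_deriv j (\<lambda>x. f x + g x) x = partial_deriv j f x + partial_deriv j g x"
proof -
  obtain F G where "(f has_derivative F) (at x)" "(g has_derivative G) (at x)"
    using assms by (auto simp: differentiable_def)
  then show ?thesis
    using partial_deriv_eqI[OF has_derivative_add, of f F x g G j]
    by (simp add: partial_deriv_eqI)
qed

lemma partial_deriv_mult:
  fixes f g :: "real^'n \<Rightarrow> 'b::real_normed_field"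
  assumes "f differentiable (at x)" "g differentiable (at x)"
  shows "partial_deriv j (\<lambda>x. f x * g x) x = f x * partial_deriv j g x + partial_deriv j f x * g x"
proof -
  obtain F G where "(f has_derivative F) (at x)" "(g has_derivative G) (at x)"
    using assms by (auto simp: differentiable_def)
  then show ?thesis
    using partial_deriv_eqI[OF has_derivative_mult, of f F x g G j]
    by (simp add: partial_deriv_eqI)
qed

lemma partial_deriv_bounded_linear:
  assumes "bounded_linear L" "f differentiable (at x)"
  shows "partial_deriv j (\<lambda>x. L (f x)) x = L (partial_deriv j f x)"
proof -
  obtain F where F: "(f has_derivative F) (at x)"
    using assms by (auto simp: differentiable_def)
  show ?thesis
    using partial_deriv_eqI[OF bounded_linear.has_derivative[OF assms(1) F], of j]
      partial_deriv_eqI[OF F] by simp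
qed

lemma partial_deriv_scaled_argument:
  assumes "f differentiable (at (c *\<^sub>R x))"
  shows "partial_deriv j (\<lambda>x. f (c *\<^sub>R x)) x = c *\<^sub>R partial_deriv j f (c *\<^sub>R x)"
proof -
  obtain F where F: "(f has_derivative F) (at (c *\<^sub>R x))"
    using assms by (auto simp: differentiable_def)
  have "((\<lambda>x. f (c *\<^sub>R x)) has_derivative (\<lambda>h. F (c *\<^sub>R h))) (at x)"
    by (rule has_derivative_compose[where g = f]) (auto intro!: derivative_eq_intros F)
  then show ?thesis
    using partial_deriv_eqI F has_derivative_linear[OF F]
    by (metis linear_scale)
qed

lemma partial_deriv_field_compose:
  fixes f :: "real^'n \<Rightarrow> real"
  assumes "f differentiable (at x)" "(H has_real_derivative d) (at (f x))"
  shows "(\<lambda>x. H (f x)) differentiable (at x)"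
    and "partial_deriv j (\<lambda>x. H (f x)) x = d * partial_deriv j f x"
proof -
  obtain F where F: "(f has_derivative F) (at x)"
    using assms by (auto simp: differentiable_def)
  have H: "((\<lambda>x. H (f x)) has_derivative (\<lambda>h. d * F h)) (at x)"
    using has_derivative_compose[OF F assms(2)[unfolded has_field_derivative_def]] by simp
  then show "(\<lambda>x. H (f x)) differentiable (at x)"
    by (auto simp: differentiable_def)
  show "partial_deriv j (\<lambda>x. H (f x)) x = d * partial_deriv j f x"
    using partial_deriv_eqI[OF H] partial_deriv_eqI[OF F] by simp
qed

lemma smooth_const:
  fixes c :: "'b::real_normed_vector" shows "smooth (\<lambda>x::real^'n. c)"
proof -
  have "times_differentiable n (\<lambda>x::real^'n. c)" for n and c :: 'b
  proof (induction n arbitrary: c)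
    case (Suc n)
    have "partial_deriv j (\<lambda>x::real^'n. c) = (\<lambda>x. 0)" for j
      by (rule ext, rule partial_deriv_eqI[OF has_derivative_const])
    then show ?case using Suc by simp
  qed auto
  then show ?thesis by (auto simp: smooth_iff_times_differentiable)
qed

lemma times_differentiable_add:
  "times_differentiable n f \<Longrightarrow> times_differentiable n g \<Longrightarrow> times_differentiable n (\<lambda>x. f x + g x)"
proof (induction n arbitrary: f g)
  case (Suc n)
  have "partial_deriv j (\<lambda>x. f x + g x) = (\<lambda>x. partial_deriv j f x + partial_deriv j g x)" for j
    using Suc.prems by (auto intro!: partial_deriv_add)
  then show ?case
    using Suc by auto
qed auto

lemma smooth_add: "smooth f \<Longrightarrow> smooth g \<Longrightarrow> smooth (\<lambda>x. f x + g x)"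
  by (simp add: smooth_iff_times_differentiable times_differentiable_add)

lemma times_differentiable_mult:
  fixes f g :: "real^'n \<Rightarrow> 'b::real_normed_field"
  shows "times_differentiable n f \<Longrightarrow> times_differentiable n g \<Longrightarrow> times_differentiable n (\<lambda>x. f x * g x)"
proof (induction n arbitrary: f g)
  case (Suc n)
  have "partial_deriv j (\<lambda>x. f x * g x) = (\<lambda>x. f x * partial_deriv j g x + partial_deriv j f x * g x)" for j
    using Suc.prems by (auto intro!: partial_deriv_mult)
  moreover have "times_differentiable n f" "times_differentiable n g"
    using Suc.prems times_differentiable_SucD by blast+
  ultimately show ?case
    using Suc by (auto intro!: times_differentiable_add)
qed auto

lemma smooth_mult:
  fixes f g :: "real^'n \<Rightarrow> 'b::real_normed_field"
  shows "smooth f \<Longrightarrow> smooth g \<Longrightarrow> smooth (\<lambda>x. f x * g x)"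
  by (simp add: smooth_iff_times_differentiable times_differentiable_mult)

lemma smooth_bounded_linear:
  fixes f :: "real^'n \<Rightarrow> 'a::real_normed_vector" and L :: "'a \<Rightarrow> 'b::real_normed_vector"
  assumes "bounded_linear L" "smooth f" shows "smooth (\<lambda>x. L (f x))"
proof -
  have d: "(\<lambda>x. L (f x)) differentiable (at x)" if "f differentiable (at x)" for f :: "real^'n \<Rightarrow> 'a" and x
    using that bounded_linear.has_derivative[OF assms(1)] unfolding differentiable_def by blast
  have "times_differentiable n f \<Longrightarrow> times_differentiable n (\<lambda>x. L (f x))" for n and f :: "real^'n \<Rightarrow> 'a"
  proof (induction n arbitrary: f)
    case 0
    then show ?case
      using d by auto
  next
    case (Suc n)
    have "partial_deriv j (\<lambda>x. L (f x)) = (\<lambda>x. L (partial_deriv j f x))" for j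
      using Suc.prems by (auto intro!: partial_deriv_bounded_linear assms)
    then show ?case
      using Suc d by auto
  qed
  then show ?thesis
    using assms(2) by (simp add: smooth_iff_times_differentiable)
qed

lemma smooth_scaled_argument:
  fixes f :: "real^'n \<Rightarrow> 'b::real_normed_vector"
  assumes "smooth f" shows "smooth (\<lambda>x. f (c *\<^sub>R x))"
proof -
  have d: "(\<lambda>x. f (c *\<^sub>R x)) differentiable (at x)" if "\<And>x. f differentiable (at x)" for f :: "real^'n \<Rightarrow> 'b" and x
    by (rule differentiable_compose[where f = f]) (auto intro: that)
  have "times_differentiable n f \<Longrightarrow> times_differentiable n (\<lambda>x. f (c *\<^sub>R x))" for n and f :: "real^'n \<Rightarrow> 'b"
  proof (induction n arbitrary: f)
    case 0
    then show ?case using d by auto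
  next
    case (Suc n)
    have "partial_deriv j (\<lambda>x. f (c *\<^sub>R x)) = (\<lambda>x. c *\<^sub>R partial_deriv j f (c *\<^sub>R x))" for j
      using Suc.prems by (auto intro!: partial_deriv_scaled_argument)
    moreover have "times_differentiable n (\<lambda>x. c *\<^sub>R partial_deriv j f (c *\<^sub>R x))" for j
    proof -
      have "times_differentiable n g \<Longrightarrow> times_differentiable n (\<lambda>x. c *\<^sub>R g x)" for g :: "real^'n \<Rightarrow> 'b"
      proof (induction n arbitrary: g)
        case (Suc n)
        have "partial_deriv j (\<lambda>x. c *\<^sub>R g x) = (\<lambda>x. c *\<^sub>R partial_deriv j g x)" for j
          using Suc.prems by (auto intro!: partial_deriv_bounded_linear bounded_linear_scaleR_right)
        then show ?case using Suc by auto
      qed auto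
      then show ?thesis
        using Suc by auto
    qed
    ultimately show ?case
      using Suc d by auto
  qed
  then show ?thesis
    using assms by (simp add: smooth_iff_times_differentiable)
qed

lemma smooth_exp:
  fixes f :: "real^'n \<Rightarrow> real"
  assumes "smooth f" shows "smooth (\<lambda>x. exp (f x))"
proof -
  have d: "(\<lambda>x. exp (f x)) differentiable (at x)"
    "partial_deriv j (\<lambda>x. exp (f x)) x = exp (f x) * partial_deriv j f x"
    if "\<And>x. f differentiable (at x)" for x j
    using partial_deriv_field_compose[OF that DERIV_exp] by auto
  have "times_differentiable n f \<Longrightarrow> times_differentiable n (\<lambda>x. exp (f x))" for n
  proof (induction n)
    case (Suc n)
    have "partial_deriv j (\<lambda>x. exp (f x)) = (\<lambda>x. exp (f x) * partial_deriv j f x)" for j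
      using Suc.prems by (intro ext d) auto
    moreover have "times_differentiable n (\<lambda>x. exp (f x))"
      using Suc.IH Suc.prems by (auto dest: times_differentiable_SucD simp del: times_differentiable.simps)
    ultimately show ?case
      using Suc.prems d(1) by (auto intro!: times_differentiable_mult)
  qed (use d in auto)
  then show ?thesis
    using assms by (simp add: smooth_iff_times_differentiable)
qed

lemma smooth_inverse:
  fixes f :: "real^'n \<Rightarrow> real"
  assumes "smooth f" "\<And>x. f x \<noteq> 0" shows "smooth (\<lambda>x. inverse (f x))"
proof -
  have d: "(\<lambda>x. inverse (f x)) differentiable (at x)"
    "partial_deriv j (\<lambda>x. inverse (f x)) x =
       - 1 * (inverse (f x) * inverse (f x) * partial_deriv j f x)"
    if "\<And>x. f differentiable (at x)" for x j
    using partial_deriv_field_compose[OF that DERIV_inverse[OF assms(2)]]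
    by (auto simp: power2_eq_square)
  have "times_differentiable n f \<Longrightarrow> times_differentiable n (\<lambda>x. inverse (f x))" for n
  proof (induction n)
    case (Suc n)
    have "partial_deriv j (\<lambda>x. inverse (f x)) =
        (\<lambda>x. - 1 * (inverse (f x) * inverse (f x) * partial_deriv j f x))" for j
      using Suc.prems by (intro ext d) auto
    moreover have "times_differentiable n (\<lambda>x. inverse (f x))"
      using Suc.IH Suc.prems by (auto dest: times_differentiable_SucD simp del: times_differentiable.simps)
    moreover have "times_differentiable n (\<lambda>x. - 1 :: real)"
      using smooth_const smooth_iff_times_differentiable by blast
    ultimately show ?case
      using Suc.prems d(1) by (auto intro!: times_differentiable_mult simp only: times_differentiable.simps)
  qed (use d in auto)
  then show ?thesis
    using assms by (simp add: smooth_iff_times_differentiable)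
qed

lemma bounded_linear_imp_smooth: "bounded_linear L \<Longrightarrow> smooth (L :: real^'n \<Rightarrow> 'b::real_normed_vector)"
proof -
  assume L: "bounded_linear L"
  have "partial_deriv j L = (\<lambda>x. L (axis j 1))" for j
    using partial_deriv_eqI[OF bounded_linear_imp_has_derivative[OF L]] by auto
  then have "times_differentiable n L" for n
    using smooth_const bounded_linear_imp_differentiable[OF L]
    by (cases n) (auto simp: smooth_iff_times_differentiable)
  then show ?thesis by (auto simp: smooth_iff_times_differentiable)
qed

lemma smooth_real_polynomial_function: "real_polynomial_function p \<Longrightarrow> smooth (p :: real^'n \<Rightarrow> real)"
  by (induction p rule: real_polynomial_function.induct)
    (auto intro: bounded_linear_imp_smooth smooth_const smooth_add smooth_mult)

lemma smooth_of_real: "smooth f \<Longrightarrow> smooth (\<lambda>x. complex_of_real (f x))"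
  by (rule smooth_bounded_linear[OF bounded_linear_of_real])

lemma smooth_minus: "smooth f \<Longrightarrow> smooth (\<lambda>x. - f x)"
  by (rule smooth_bounded_linear[OF bounded_linear_minus[OF bounded_linear_ident]])

lemma smooth_diff: "smooth f \<Longrightarrow> smooth g \<Longrightarrow> smooth (\<lambda>x. f x - g x)"
  using smooth_add[OF _ smooth_minus] by fastforce

lemma smooth_nth: "smooth (\<lambda>x::real^'n. x $ j)"
  by (rule bounded_linear_imp_smooth) (rule bounded_linear_vec_nth)

lemma smooth_norm_power2: "smooth (\<lambda>x::real^'n. (norm x)\<^sup>2)"
proof -
  have "(\<lambda>x::real^'n. (norm x)\<^sup>2) = (\<lambda>x. \<Sum>j\<in>UNIV. x $ j * x $ j)"
    by (auto simp: power2_norm_eq_inner inner_vec_def)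
  moreover have "smooth (\<lambda>x::real^'n. \<Sum>j\<in>A. x $ j * x $ j)" if "finite A" for A
    using that by induction (auto intro!: smooth_const smooth_add smooth_mult smooth_nth)
  ultimately show ?thesis by simp
qed

section \<open>Test functions\<close>

text \<open>These are the functions of the frequency variable against which the Fourier transform of the
solution is tested. Compact support makes the class stable under multiplication by every smooth symbol, without
growth conditions.\<close>

definition test_functions :: "(real^'n \<Rightarrow> complex) set" where
  "test_functions = {\<phi>. smooth \<phi> \<and> (\<exists>R. \<forall>x. R \<le> norm x \<longrightarrow> \<phi> x = 0)}"

lemma test_functionsE:
  assumes "\<phi> \<in> test_functions"
  obtains R where "smooth \<phi>" "\<And>x. R \<le> norm x \<Longrightarrow> \<phi> x = 0"
  using assms unfolding test_functions_def by blast

lemma test_functions_smooth [dest]: "\<phi> \<in> test_functions \<Longrightarrow> smooth \<phi>"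
  by (simp add: test_functions_def)

lemma test_functions_mult_smooth:
  assumes "smooth f" "\<phi> \<in> test_functions" shows "(\<lambda>x. f x * \<phi> x) \<in> test_functions"
  using assms unfolding test_functions_def by (auto intro: smooth_mult)

lemma test_functions_add:
  assumes "\<psi> \<in> test_functions" "\<phi> \<in> test_functions" shows "(\<lambda>x. \<psi> x + \<phi> x) \<in> test_functions"
proof -
  from assms obtain R S where "\<forall>x. R \<le> norm x \<longrightarrow> \<phi> x = 0" "\<forall>x. S \<le> norm x \<longrightarrow> \<psi> x = 0"
    unfolding test_functions_def by auto
  then have "\<forall>x. max R S \<le> norm x \<longrightarrow> \<psi> x + \<phi> x = 0" by auto
  then show ?thesis
    using assms unfolding test_functions_def by (blast intro: smooth_add)
qed

lemma test_functions_partial_deriv: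
  assumes "\<phi> \<in> test_functions" shows "partial_deriv j \<phi> \<in> test_functions"
proof -
  from assms obtain R where R: "\<And>x. R \<le> norm x \<Longrightarrow> \<phi> x = 0"
    unfolding test_functions_def by auto
  have "partial_deriv j \<phi> x = 0" if "R + 1 \<le> norm x" for x
  proof -
    have "open {y::real^'n. R < norm y}"
      by (rule open_Collect_less) (auto intro: continuous_intros)
    then have "(\<phi> has_derivative (\<lambda>h. 0)) (at x)"
      by (rule has_derivative_transform_within_open[OF has_derivative_const[of 0]])
        (use that R in auto)
    then show ?thesis
      using partial_deriv_eqI by fastforce
  qed
  then show ?thesis
    using assms smooth_partial_deriv unfolding test_functions_def by blast
qed

lemma test_functions_partial_derivs:
  "\<phi> \<in> test_functions \<Longrightarrow> partial_derivs js \<phi> \<in> test_functions"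
  by (induction js) (auto intro: test_functions_partial_deriv)

lemma continuous_compact_support_bounded:
  fixes f :: "real^'n \<Rightarrow> 'b::real_normed_vector"
  assumes "continuous_on UNIV f" "\<And>x. R \<le> norm x \<Longrightarrow> f x = 0"
  shows "bounded (range f)"
proof -
  have "compact (f ` cball 0 R)"
    by (meson assms(1) compact_cball compact_continuous_image continuous_on_subset subset_UNIV)
  moreover have "range f \<subseteq> insert 0 (f ` cball 0 R)"
    using assms(2) by (auto simp: image_iff) (metis linorder_le_cases mem_cball_0)
  ultimately show ?thesis
    by (meson bounded_insert bounded_subset compact_imp_bounded)
qed

lemma test_functions_weighted_bounded:
  assumes "\<phi> \<in> test_functions"
  shows "bounded (range (\<lambda>x. (1 + norm x) ^ N *\<^sub>R \<phi> x))"
proof -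
  obtain R where R: "smooth \<phi>" "\<And>x. R \<le> norm x \<Longrightarrow> \<phi> x = 0"
    using assms by (rule test_functionsE) blast
  show ?thesis
    by (rule continuous_compact_support_bounded[where R = R])
      (auto intro!: continuous_intros R smooth_imp_continuous[OF R(1)])
qed

lemma test_functions_schwartz: "\<phi> \<in> test_functions \<Longrightarrow> \<phi> \<in> schwartz"
  unfolding schwartz_def
  by (auto intro: test_functions_weighted_bounded test_functions_partial_derivs)

lemma test_functions_bounded:
  assumes "\<phi> \<in> test_functions" obtains B where "B > 0" "\<And>x. norm (\<phi> x) \<le> B"
  using test_functions_weighted_bounded[OF assms, of 0] by (auto simp: bounded_pos)

lemma integrable_bounded_support:
  fixes f :: "real^'n \<Rightarrow> 'b::{banach,second_countable_topology}"
  assumes "f \<in> borel_measurable borel" "\<And>x. norm (f x) \<le> B" "\<And>x. R \<le> norm x \<Longrightarrow> f x = 0"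
  shows "integrable lborel f"
proof (rule Bochner_Integration.integrable_bound)
  show "integrable lborel (\<lambda>x::real^'n. indicator (cball 0 R) x *\<^sub>R B)"
    using emeasure_bounded_finite[of "cball (0::real^'n) R"] by (intro integrable_indicator) auto
  have "norm (f x) \<le> norm (indicator (cball 0 R) x *\<^sub>R B)" for x
    using assms(2)[of x] assms(3)[of x] by (auto simp: indicator_def)
  then show "AE x in lborel. norm (f x) \<le> norm (indicator (cball 0 R) x *\<^sub>R B)"
    by simp
qed (use assms in auto)

lemma continuous_compact_support_integrable:
  fixes f :: "real^'n \<Rightarrow> 'b::{banach,second_countable_topology}"
  assumes "continuous_on UNIV f" "\<And>x. R \<le> norm x \<Longrightarrow> f x = 0"
  shows "integrable lborel f"
proof -
  obtain B where "\<And>x. norm (f x) \<le> B"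
    using continuous_compact_support_bounded[OF assms] by (auto simp: bounded_pos)
  then show ?thesis
    using assms by (intro integrable_bounded_support) (auto intro: borel_measurable_continuous_onI)
qed

lemma test_functions_integrable:
  assumes "\<phi> \<in> test_functions" shows "integrable lborel \<phi>"
proof -
  obtain R where R: "smooth \<phi>" "\<And>x. R \<le> norm x \<Longrightarrow> \<phi> x = 0"
    using assms by (rule test_functionsE) blast
  then show ?thesis
    by (intro continuous_compact_support_integrable) (auto intro: smooth_imp_continuous)
qed

lemma test_functions_weighted_integrable:
  fixes g :: "real^'n \<Rightarrow> real"
  assumes "\<phi> \<in> test_functions" "continuous_on UNIV g" "M > 0"
  shows "integrable lborel (\<lambda>x. g x * norm (\<phi> x) ^ M)"
proof -
  obtain R where R: "smooth \<phi>" "\<And>x. R \<le> norm x \<Longrightarrow> \<phi> x = 0"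
    using assms(1) by (rule test_functionsE) blast
  show ?thesis
    by (rule continuous_compact_support_integrable[where R = R])
      (use assms R in \<open>auto intro!: continuous_intros smooth_imp_continuous[OF R(1)]\<close>)
qed

section \<open>Integration on Euclidean space\<close>

text \<open>The quadratic polynomial \<open>l \<mapsto> \<integral> (|f| - l |g|)\<^sup>2\<close> is nonnegative, so its discriminant is not positive.\<close>

lemma integral_Cauchy_Schwarz:
  fixes f g :: "'a \<Rightarrow> complex"
  assumes [measurable]: "f \<in> borel_measurable M" "g \<in> borel_measurable M"
    and f: "integrable M (\<lambda>x. (norm (f x))\<^sup>2)" and g: "integrable M (\<lambda>x. (norm (g x))\<^sup>2)"
  shows "integrable M (\<lambda>x. f x * g x)"
    and "norm (\<integral>x. f x * g x \<partial>M)
      \<le> sqrt (\<integral>x. (norm (f x))\<^sup>2 \<partial>M) * sqrt (\<integral>x. (norm (g x))\<^sup>2 \<partial>M)"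
proof -
  define a b c where "a = (\<integral>x. (norm (f x))\<^sup>2 \<partial>M)" and "b = (\<integral>x. (norm (g x))\<^sup>2 \<partial>M)"
    and "c = (\<integral>x. norm (f x * g x) \<partial>M)"
  show int: "integrable M (\<lambda>x. f x * g x)"
  proof (rule Bochner_Integration.integrable_bound)
    show "integrable M (\<lambda>x. (norm (f x))\<^sup>2 + (norm (g x))\<^sup>2)"
      using f g by auto
    have "norm (f x) * norm (g x) \<le> (norm (f x))\<^sup>2 + (norm (g x))\<^sup>2" for x
      using sum_squares_bound[of "norm (f x)" "norm (g x)"]
        mult_nonneg_nonneg[OF norm_ge_zero[of "f x"] norm_ge_zero[of "g x"]] by linarith
    then show "AE x in M. norm (f x * g x) \<le> norm ((norm (f x))\<^sup>2 + (norm (g x))\<^sup>2)"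
      by (auto simp: norm_mult)
  qed auto
  have quad: "0 \<le> a - 2 * l * c + l\<^sup>2 * b" for l
  proof -
    have "0 \<le> (\<integral>x. (norm (f x) - l * norm (g x))\<^sup>2 \<partial>M)"
      by (rule integral_nonneg_AE) auto
    also have "\<dots> = (\<integral>x. (norm (f x))\<^sup>2 - 2 * l * norm (f x * g x) + l\<^sup>2 * (norm (g x))\<^sup>2 \<partial>M)"
      by (rule Bochner_Integration.integral_cong) (auto simp: power2_diff norm_mult power_mult_distrib)
    also have "\<dots> = a - 2 * l * c + l\<^sup>2 * b"
      unfolding a_def b_def c_def using f g integrable_norm[OF int]
      by (simp add: Bochner_Integration.integral_diff Bochner_Integration.integral_add del: norm_mult)
    finally show ?thesis .
  qed
  have nn: "0 \<le> a" "0 \<le> b" "0 \<le> c"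
    unfolding a_def b_def c_def by auto
  \<comment> \<open>With \<open>b = 0\<close> the polynomial is affine, otherwise its minimum is at \<open>l = c / b\<close>.\<close>
  have "c\<^sup>2 \<le> a * b"
  proof (cases "b = 0")
    case True
    have "c = 0"
    proof (rule ccontr)
      assume "c \<noteq> 0"
      then show False
        using quad[of "(a + 1) / (2 * c)"] True by (simp add: field_simps)
    qed
    then show ?thesis using True by simp
  next
    case False
    have "0 \<le> a - c\<^sup>2 / b"
      using quad[of "c / b"] False by (simp add: field_simps power2_eq_square)
    then show ?thesis
      using False nn by (simp add: field_simps)
  qed
  then have "c \<le> sqrt a * sqrt b"
    by (metis real_le_rsqrt real_sqrt_mult)
  moreover have "norm (\<integral>x. f x * g x \<partial>M) \<le> c"
    unfolding c_def by (rule integral_norm_bound)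
  ultimately show "norm (\<integral>x. f x * g x \<partial>M)
      \<le> sqrt (\<integral>x. (norm (f x))\<^sup>2 \<partial>M) * sqrt (\<integral>x. (norm (g x))\<^sup>2 \<partial>M)"
    unfolding a_def b_def by linarith
qed

text \<open>Lebesgue measure on \<open>real^'n\<close> is the image of a product measure indexed by the standard basis;
\<^const>\<open>axis_index\<close> translates between basis vectors and coordinates.\<close>

lemma
  fixes f :: "'n::finite \<Rightarrow> real \<Rightarrow> 'b::{real_normed_field,banach,second_countable_topology}"
  assumes f: "\<And>j. integrable lborel (f j)"
  shows integrable_prod_coordinates: "integrable lborel (\<lambda>x::real^'n. \<Prod>j\<in>UNIV. f j (x $ j))" (is ?i)
    and integral_prod_coordinates:
      "(\<integral>x. (\<Prod>j\<in>UNIV. f j ((x::real^'n) $ j)) \<partial>lborel) = (\<Prod>j\<in>UNIV. \<integral>t. f j t \<partial>lborel)" (is ?e)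
proof -
  interpret product_sigma_finite "\<lambda>b::real^'n. lborel :: real measure"
    by (rule product_sigma_finite.intro) (rule sigma_finite_lborel)
  have Basis: "(Basis :: (real^'n) set) = range (\<lambda>j. axis j 1)"
    by (auto simp: Basis_vec_def)
  have inj: "inj (\<lambda>j::'n. axis j (1::real))"
    by (auto simp: inj_def axis_eq_axis)
  have m [measurable]: "f j \<in> borel_measurable borel" for j
    using f[of j] by auto
  have coord: "(\<Sum>b\<in>Basis. g b *\<^sub>R b) $ j = g (axis j 1)" for g and j :: 'n
  proof -
    have "(\<Sum>b\<in>Basis. g b *\<^sub>R b) $ j = (\<Sum>b\<in>Basis. g b *\<^sub>R b) \<bullet> axis j 1"
      by (simp add: inner_axis)
    also have "\<dots> = g (axis j 1)"
      by (rule inner_sum_left_Basis) (auto simp: Basis)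
    finally show ?thesis .
  qed
  have prod: "(\<Prod>j\<in>UNIV. h j) = (\<Prod>b\<in>(Basis :: (real^'n) set). h (axis_index b))" for h :: "'n \<Rightarrow> 'b"
    unfolding Basis by (subst prod.reindex[OF inj]) simp
  have eq: "(\<Prod>j\<in>UNIV. f j ((\<Sum>b\<in>Basis. g b *\<^sub>R b) $ j)) = (\<Prod>b\<in>(Basis :: (real^'n) set). f (axis_index b) (g b))" for g
    unfolding coord prod by (rule prod.cong) (auto simp: Basis)
  have meas: "(\<lambda>x::real^'n. \<Prod>j\<in>UNIV. f j (x $ j)) \<in> borel_measurable borel"
    by measurable
  have T: "(\<lambda>g. \<Sum>b\<in>(Basis::(real^'n) set). g b *\<^sub>R b) \<in> measurable (\<Pi>\<^sub>M b\<in>Basis. lborel) borel"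
    by measurable
  show ?i
    by (subst lborel_eq, subst integrable_distr_eq[OF T meas], unfold eq)
      (auto intro!: product_integrable_prod f)
  show ?e
    by (subst lborel_eq, subst integral_distr[OF T meas], unfold eq, subst product_integral_prod)
      (auto intro!: f simp: prod)
qed

lemma cis_measurable [measurable]:
  "f \<in> borel_measurable M \<Longrightarrow> (\<lambda>x. cis (f x)) \<in> borel_measurable M"
  by (rule measurable_compose[where g = cis])
    (auto intro!: borel_measurable_continuous_onI continuous_intros)

lemma gaussian_integrable:
  assumes "e > 0" shows "integrable lborel (\<lambda>t::real. exp (- (e * t)\<^sup>2 / 2))"
proof -
  have "integrable lborel (\<lambda>t. sqrt (2 * pi) * std_normal_density (0 + e * t))"
    using assms by (intro integrable_mult_right lborel_integrable_real_affine) auto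
  then show ?thesis
    by (simp add: std_normal_density_def)
qed

text \<open>The case \<open>e = 1\<close> is the characteristic function of the standard normal distribution.\<close>

lemma fourier_gaussian_1:
  assumes "e > 0"
  shows "(\<integral>t. cis (y * t) * complex_of_real (exp (- (e * t)\<^sup>2 / 2)) \<partial>lborel)
    = complex_of_real (sqrt (2 * pi) / e * exp (- (y / e)\<^sup>2 / 2))"
proof -
  have 1: "(\<integral>x. cis (s * x) * complex_of_real (exp (- x\<^sup>2 / 2)) \<partial>lborel)
      = complex_of_real (sqrt (2 * pi) * exp (- s\<^sup>2 / 2))" for s
  proof -
    have "complex_of_real (exp (- (s\<^sup>2) / 2)) = char std_normal_distribution s"
      by (simp add: char_std_normal_distribution)
    also have "\<dots> = (\<integral>x. std_normal_density x *\<^sub>R cis (s * x) \<partial>lborel)"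
      unfolding char_def
      by (subst integral_density) (auto simp: normal_density_nonneg cis_conv_exp)
    also have "\<dots> = (\<integral>x. complex_of_real (1 / sqrt (2 * pi)) *
        (cis (s * x) * complex_of_real (exp (- x\<^sup>2 / 2))) \<partial>lborel)"
      by (rule Bochner_Integration.integral_cong)
        (auto simp: std_normal_density_def scaleR_conv_of_real mult_ac)
    finally show ?thesis
      by (simp add: field_simps)
  qed
  have "complex_of_real (sqrt (2 * pi) * exp (- (y / e)\<^sup>2 / 2))
      = (\<integral>x. cis (y / e * x) * complex_of_real (exp (- x\<^sup>2 / 2)) \<partial>lborel)"
    using 1[of "y / e"] by simp
  also have "\<dots> = \<bar>e\<bar> *\<^sub>R (\<integral>t. cis (y / e * (0 + e * t)) * complex_of_real (exp (- (0 + e * t)\<^sup>2 / 2)) \<partial>lborel)"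
    using assms by (intro lborel_integral_real_affine) auto
  also have "\<dots> = e * (\<integral>t. cis (y * t) * complex_of_real (exp (- (e * t)\<^sup>2 / 2)) \<partial>lborel)"
    using assms by (simp add: scaleR_conv_of_real)
  finally show ?thesis
    using assms by (simp add: field_simps)
qed

text \<open>This is \<open>exp (-e\<^sup>2 |x|\<^sup>2 / 2)\<close>, written as a product so that its integrals factor into
one-dimensional ones.\<close>

definition gaussian :: "real \<Rightarrow> real^'n \<Rightarrow> real" where
  "gaussian e x = (\<Prod>j\<in>UNIV. exp (- (e * x $ j)\<^sup>2 / 2))"

lemma gaussian_measurable [measurable]: "gaussian e \<in> borel_measurable borel"
  unfolding gaussian_def[abs_def] by measurable

lemma gaussian_bounds: "0 < gaussian e x" "gaussian e x \<le> 1"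
  unfolding gaussian_def by (auto intro!: prod_pos prod_le_1)

lemma gaussian_lborel_integrable: "e > 0 \<Longrightarrow> integrable lborel (gaussian e :: real^'n \<Rightarrow> real)"
  unfolding gaussian_def[abs_def] by (rule integrable_prod_coordinates) (rule gaussian_integrable)

lemma fourier_gaussian:
  assumes "e > 0"
  shows "(\<integral>x. cis (y \<bullet> x) * complex_of_real (gaussian e x) \<partial>lborel)
    = complex_of_real ((sqrt (2 * pi) / e) ^ CARD('n) * gaussian (1 / e) (y :: real^'n))"
proof -
  have eq: "cis (y \<bullet> x) * complex_of_real (gaussian e x)
      = (\<Prod>j\<in>UNIV. cis (y $ j * x $ j) * complex_of_real (exp (- (e * x $ j)\<^sup>2 / 2)))" for x
  proof -
    have "cis (\<Sum>j\<in>A. h j) = (\<Prod>j\<in>A. cis (h j))" if "finite A" for A and h :: "'n \<Rightarrow> real"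
      using that by induction (auto simp: cis_mult[symmetric])
    then show ?thesis
      by (simp add: gaussian_def prod.distrib inner_vec_def)
  qed
  have int: "integrable lborel (\<lambda>t. cis (y $ j * t) * complex_of_real (exp (- (e * t)\<^sup>2 / 2)))" for j
    by (rule Bochner_Integration.integrable_bound[OF gaussian_integrable[OF assms]])
      (auto simp: norm_mult)
  show ?thesis
    unfolding eq integral_prod_coordinates[OF int] fourier_gaussian_1[OF assms]
    by (simp only: gaussian_def of_real_prod[symmetric] prod.distrib prod_constant) simp
qed

lemma gaussian_integral:
  assumes "e > 0"
  shows "(\<integral>x. gaussian e (x::real^'n) \<partial>lborel) = (sqrt (2 * pi) / e) ^ CARD('n)"
proof -
  have "complex_of_real (\<integral>x. gaussian e (x::real^'n) \<partial>lborel) = (\<integral>x. complex_of_real (gaussian e (x::real^'n)) \<partial>lborel)"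
    by simp
  also have "\<dots> = complex_of_real ((sqrt (2 * pi) / e) ^ CARD('n))"
    using fourier_gaussian[OF assms, of "0::real^'n"] by (simp add: gaussian_def)
  finally show ?thesis
    using of_real_eq_iff by blast
qed

text \<open>Products of this function over the coordinates serve as integrable majorants for functions
of rapid decay.\<close>

lemma integrable_inverse_1_plus_square: "integrable lborel (\<lambda>t::real. 1 / (1 + t\<^sup>2))"
proof -
  have "einterval 0 \<infinity> = {0<..}"
    by (auto simp: einterval_def)
  then have 1: "integrable lborel (\<lambda>t::real. indicator {0<..} t *\<^sub>R (1 / (1 + t\<^sup>2)))"
    using integrable_I0i_1_div_plus_square
    by (simp add: interval_lebesgue_integrable_def set_integrable_def)
  have 2: "integrable lborel (\<lambda>t::real. indicator {..<0} t *\<^sub>R (1 / (1 + t\<^sup>2)))"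
    using lborel_integrable_real_affine[OF 1, of "- 1" 0]
    by (simp add: indicator_def)
  have "AE t in lborel. t \<noteq> (0::real)"
    by (rule AE_lborel_singleton)
  then have "AE t in lborel. 1 / (1 + t\<^sup>2) = indicator {0<..} t *\<^sub>R (1 / (1 + t\<^sup>2))
       + indicator {..<0} t *\<^sub>R (1 / (1 + (t::real)\<^sup>2))"
    by eventually_elim (auto simp: indicator_def)
  with Bochner_Integration.integrable_add[OF 1 2] show ?thesis
    by (subst integrable_cong_AE) auto
qed

lemma lborel_affine_substitution:
  fixes f :: "real^'n \<Rightarrow> 'b::{banach,second_countable_topology}"
  assumes "c > 0" and [measurable]: "f \<in> borel_measurable borel"
  shows "(\<integral>y. f y \<partial>lborel) = c ^ CARD('n) *\<^sub>R (\<integral>z. f (x + c *\<^sub>R z) \<partial>lborel)"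
proof -
  have "(\<integral>y. f y \<partial>lborel) = (\<integral>y. f y \<partial>density (distr lborel borel (\<lambda>z. x + c *\<^sub>R z)) (\<lambda>_. \<bar>c\<bar>^DIM(real^'n)))"
    using assms by (subst lborel_affine[of c x]) auto
  also have "\<dots> = (\<integral>y. \<bar>c\<bar>^DIM(real^'n) *\<^sub>R f y \<partial>distr lborel borel (\<lambda>z. x + c *\<^sub>R z))"
    by (rule integral_density) (use assms in auto)
  also have "\<dots> = (\<integral>z. \<bar>c\<bar>^DIM(real^'n) *\<^sub>R f (x + c *\<^sub>R z) \<partial>lborel)"
    by (rule integral_distr) auto
  finally show ?thesis using assms by simp
qed

lemma lborel_translation:
  fixes f :: "real^'n \<Rightarrow> 'b::{banach,second_countable_topology}"
  assumes [measurable]: "f \<in> borel_measurable borel"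
  shows "(\<integral>y. f (x + y) \<partial>lborel) = (\<integral>y. f y \<partial>lborel)"
  using lborel_affine_substitution[of 1 f x] by simp

text \<open>Fourier inversion and Plancherel's identity both exchange two integrations against a character.
Integrability on the product space is then inherited from the two factors.\<close>

lemma Fubini_bounded_kernel:
  fixes a b :: "real^'n \<Rightarrow> complex" and k :: "real^'n \<Rightarrow> real^'n \<Rightarrow> complex"
  assumes a: "integrable lborel a" and b: "integrable lborel b"
    and k [measurable]: "case_prod k \<in> borel_measurable (borel \<Otimes>\<^sub>M borel)" and k1: "\<And>x y. norm (k x y) \<le> 1"
  shows "(\<integral>x. a x * (\<integral>y. k x y * b y \<partial>lborel) \<partial>lborel) = (\<integral>y. b y * (\<integral>x. k x y * a x \<partial>lborel) \<partial>lborel)"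
proof -
  have [measurable]: "a \<in> borel_measurable borel" "b \<in> borel_measurable borel"
    using a b by auto
  have m: "(\<lambda>(x, y). a x * (k x y * b y)) \<in> borel_measurable (lborel \<Otimes>\<^sub>M lborel)"
    by measurable
  have int: "integrable lborel (\<lambda>y. k x y * b y)" for x
    by (rule Bochner_Integration.integrable_bound[OF b]) (auto simp: norm_mult mult_left_le_one_le k1)
  have "integrable (lborel \<Otimes>\<^sub>M lborel) (\<lambda>(x, y). a x * (k x y * b y))"
  proof (rule lborel_pair.Fubini_integrable[OF m])
    have "norm (\<integral>y. norm (a x * (k x y * b y)) \<partial>lborel) \<le> norm (norm (a x) * (\<integral>y. norm (b y) \<partial>lborel))" for x
    proof -
      have "(\<integral>y. norm (k x y * b y) \<partial>lborel) \<le> (\<integral>y. norm (b y) \<partial>lborel)"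
        by (rule integral_mono[OF integrable_norm[OF int] integrable_norm[OF b]])
          (auto simp: norm_mult mult_left_le_one_le k1)
      then show ?thesis
        by (simp add: norm_mult mult_left_mono abs_mult)
    qed
    then have "AE x in lborel. norm (\<integral>y. norm (a x * (k x y * b y)) \<partial>lborel)
        \<le> norm (norm (a x) * (\<integral>y. norm (b y) \<partial>lborel))"
      by simp
    moreover have "integrable lborel (\<lambda>x. norm (a x) * (\<integral>y. norm (b y) \<partial>lborel))"
      using a by simp
    moreover have "(\<lambda>x. \<integral>y. norm (a x * (k x y * b y)) \<partial>lborel) \<in> borel_measurable lborel"
      by measurable
    ultimately show "integrable lborel (\<lambda>x. \<integral>y. norm (case (x, y) of (x, y) \<Rightarrow> a x * (k x y * b y)) \<partial>lborel)"
      unfolding prod.case by (rule Bochner_Integration.integrable_bound[rotated 2])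
    show "AE x in lborel. integrable lborel (\<lambda>y. case (x, y) of (x, y) \<Rightarrow> a x * (k x y * b y))"
      using int by auto
  qed
  from lborel_pair.Fubini_integral[OF this]
  have "(\<integral>y. (\<integral>x. a x * (k x y * b y) \<partial>lborel) \<partial>lborel) = (\<integral>x. (\<integral>y. a x * (k x y * b y) \<partial>lborel) \<partial>lborel)"
    by simp
  moreover have "(\<integral>x. a x * (k x y * b y) \<partial>lborel) = b y * (\<integral>x. k x y * a x \<partial>lborel)" for y
    by (subst integral_mult_right_zero[symmetric]) (simp add: mult_ac)
  ultimately show ?thesis
    by simp
qed

section \<open>The Fourier transform of test functions\<close>

lemma integrable_cis_mult:
  assumes "integrable lborel \<phi>" and [measurable]: "g \<in> borel_measurable borel"
  shows "integrable lborel (\<lambda>x::real^'n. cis (g x) * \<phi> x)"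
proof (rule Bochner_Integration.integrable_bound[OF assms(1)])
  have [measurable]: "\<phi> \<in> borel_measurable borel"
    using assms(1) by auto
  show "(\<lambda>x. cis (g x) * \<phi> x) \<in> borel_measurable lborel"
    by measurable
qed (auto simp: norm_mult)

lemma norm_fourier_le: "norm (fourier \<phi> \<xi>) \<le> (\<integral>x. norm (\<phi> x) \<partial>lborel)"
proof -
  have "norm (fourier \<phi> \<xi>) \<le> (\<integral>x. norm (cis (- (x \<bullet> \<xi>)) * \<phi> x) \<partial>lborel)"
    unfolding fourier_def by (rule integral_norm_bound)
  then show ?thesis by (simp add: norm_mult)
qed

lemma fourier_add:
  assumes "integrable lborel \<phi>" "integrable lborel \<psi>"
  shows "fourier (\<lambda>x. \<phi> x + \<psi> x) \<xi> = fourier \<phi> \<xi> + fourier \<psi> \<xi>"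
  unfolding fourier_def
  using integrable_cis_mult[OF assms(1)] integrable_cis_mult[OF assms(2)]
  by (simp add: distrib_left)

lemma fourier_cmult: "fourier (\<lambda>x. c * \<phi> x) \<xi> = c * fourier \<phi> \<xi>"
  unfolding fourier_def by (subst integral_mult_right_zero[symmetric]) (simp add: mult_ac)

lemma norm_cis_minus_linear_le: "norm (cis x - 1 - \<i> * complex_of_real x) \<le> x\<^sup>2 / 2"
  using iexp_approx1[of x 1] by (simp add: cis_conv_exp numeral_2_eq_2 diff_diff_eq power2_abs)

lemma smooth_complex_coordinate: "smooth (\<lambda>x::real^'n. complex_of_real (x $ j))"
  by (intro smooth_of_real smooth_nth)

text \<open>Because \<open>|cis s - 1 - i s| \<le> s\<^sup>2 / 2\<close>, replacing \<open>\<xi>\<close> by \<open>\<xi> + h\<close> leaves a remainder of at most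
\<open>|h|\<^sup>2 \<integral> |x|\<^sup>2 |\<phi>(x)|\<close>.\<close>

lemma fourier_has_derivative:
  fixes \<phi> :: "real^'n \<Rightarrow> complex"
  assumes "\<phi> \<in> test_functions"
  shows "(fourier \<phi> has_derivative
      (\<lambda>h. \<integral>x. cis (- (x \<bullet> \<xi>)) * (- \<i> * complex_of_real (x \<bullet> h) * \<phi> x) \<partial>lborel)) (at \<xi>)"
proof (rule has_derivativeI_sandwich[where e = 1])
  let ?L = "\<lambda>h. \<integral>x. cis (- (x \<bullet> \<xi>)) * (- \<i> * complex_of_real (x \<bullet> h) * \<phi> x) \<partial>lborel"
  have [measurable]: "\<phi> \<in> borel_measurable borel"
    using assms smooth_imp_measurable by blast
  have int: "integrable lborel \<phi>"
    by (rule test_functions_integrable[OF assms])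
  have w: "integrable lborel (\<lambda>x. norm x ^ k * norm (\<phi> x))" for k
    using test_functions_weighted_integrable[OF assms, of "\<lambda>x. norm x ^ k" 1]
    by (simp add: continuous_intros)
  have i1: "integrable lborel (\<lambda>x. - \<i> * complex_of_real (x \<bullet> h) * \<phi> x)" for h
  proof (rule Bochner_Integration.integrable_bound)
    show "integrable lborel (\<lambda>x. norm h * (norm x ^ 1 * norm (\<phi> x)))"
      by (intro integrable_mult_right w)
    have "\<bar>x \<bullet> h\<bar> * norm (\<phi> x) \<le> norm x * norm h * norm (\<phi> x)" for x
      by (intro mult_right_mono Cauchy_Schwarz_ineq2) auto
    then show "AE x in lborel. norm (- \<i> * complex_of_real (x \<bullet> h) * \<phi> x)
        \<le> norm (norm h * (norm x ^ 1 * norm (\<phi> x)))"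
      by (auto simp: norm_mult abs_mult mult_ac)
  qed measurable
  have i2: "integrable lborel (\<lambda>x. cis (- (x \<bullet> \<xi>)) * (- \<i> * complex_of_real (x \<bullet> h) * \<phi> x))" for h
    by (rule integrable_cis_mult[OF i1]) measurable
  show "bounded_linear ?L"
  proof (rule bounded_linear_intro)
    show "?L (a + b) = ?L a + ?L b" for a b
      by (subst Bochner_Integration.integral_add[OF i2 i2, symmetric])
        (rule Bochner_Integration.integral_cong, auto simp: inner_add_right algebra_simps)
    show "?L (r *\<^sub>R a) = r *\<^sub>R ?L a" for r a
      by (subst integral_scaleR_right[symmetric])
        (rule Bochner_Integration.integral_cong, auto simp: scaleR_conv_of_real[where 'a = complex])
    show "norm (?L h) \<le> norm h * (\<integral>x. norm x ^ 1 * norm (\<phi> x) \<partial>lborel)" for h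
    proof -
      have "norm (?L h) \<le> (\<integral>x. norm (cis (- (x \<bullet> \<xi>)) * (- \<i> * complex_of_real (x \<bullet> h) * \<phi> x)) \<partial>lborel)"
        by (rule integral_norm_bound)
      also have "\<dots> \<le> (\<integral>x. norm h * (norm x ^ 1 * norm (\<phi> x)) \<partial>lborel)"
      proof (rule integral_mono)
        fix x :: "real^'n"
        have "\<bar>x \<bullet> h\<bar> * norm (\<phi> x) \<le> norm x * norm h * norm (\<phi> x)"
          by (intro mult_right_mono Cauchy_Schwarz_ineq2) auto
        then show "norm (cis (- (x \<bullet> \<xi>)) * (- \<i> * complex_of_real (x \<bullet> h) * \<phi> x)) \<le> norm h * (norm x ^ 1 * norm (\<phi> x))"
          by (simp add: norm_mult mult_ac)
      qed (rule integrable_norm[OF i2] integrable_mult_right[OF w])+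
      finally show ?thesis by simp
    qed
  qed
  show "norm (fourier \<phi> \<zeta> - fourier \<phi> \<xi> - ?L (\<zeta> - \<xi>)) / norm (\<zeta> - \<xi>)
      \<le> norm (\<zeta> - \<xi>) * (\<integral>x. norm x ^ 2 * norm (\<phi> x) \<partial>lborel)"
    if "\<zeta> \<noteq> \<xi>" for \<zeta>
  proof -
    define h where "h = \<zeta> - \<xi>"
    have pt: "cis (- (x \<bullet> \<zeta>)) * \<phi> x - cis (- (x \<bullet> \<xi>)) * \<phi> x - cis (- (x \<bullet> \<xi>)) * (- \<i> * complex_of_real (x \<bullet> h) * \<phi> x)
      = cis (- (x \<bullet> \<xi>)) * (cis (- (x \<bullet> h)) - 1 - \<i> * complex_of_real (- (x \<bullet> h))) * \<phi> x" (is "?l x = ?r x") for x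
    proof -
      have "cis (- (x \<bullet> \<zeta>)) = cis (- (x \<bullet> \<xi>)) * cis (- (x \<bullet> h))"
        by (simp add: cis_mult h_def inner_diff_right)
      then show ?thesis by (simp add: algebra_simps)
    qed
    have diff: "fourier \<phi> \<zeta> - fourier \<phi> \<xi> - ?L h = (\<integral>x. ?l x \<partial>lborel)"
      unfolding fourier_def using i2 integrable_cis_mult[OF int]
      by (simp add: Bochner_Integration.integral_diff)
    have "norm (fourier \<phi> \<zeta> - fourier \<phi> \<xi> - ?L h) \<le> (\<integral>x. norm (?l x) \<partial>lborel)"
      unfolding diff by (rule integral_norm_bound)
    also have "\<dots> \<le> (\<integral>x. (norm h)\<^sup>2 * (norm x ^ 2 * norm (\<phi> x)) \<partial>lborel)"
    proof (rule integral_mono)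
      show "integrable lborel (\<lambda>x. norm (?l x))"
        using i2[of h] integrable_cis_mult[OF int]
        by (intro integrable_norm Bochner_Integration.integrable_diff) auto
      show "integrable lborel (\<lambda>x. (norm h)\<^sup>2 * (norm x ^ 2 * norm (\<phi> x)))"
        by (intro integrable_mult_right w)
      fix x :: "real^'n"
      have "norm (cis (- (x \<bullet> h)) - 1 - \<i> * complex_of_real (- (x \<bullet> h))) \<le> (- (x \<bullet> h))\<^sup>2 / 2"
        by (rule norm_cis_minus_linear_le)
      also have "\<dots> \<le> (x \<bullet> h)\<^sup>2"
        by simp
      also have "\<dots> \<le> (norm x * norm h)\<^sup>2"
        using Cauchy_Schwarz_ineq2[of x h] by (metis abs_ge_zero power2_abs power_mono)
      finally have "norm (cis (- (x \<bullet> h)) - 1 - \<i> * complex_of_real (- (x \<bullet> h))) \<le> (norm x * norm h)\<^sup>2" .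
      then have "norm (?r x) \<le> (norm x * norm h)\<^sup>2 * norm (\<phi> x)"
        unfolding norm_mult by (intro mult_right_mono) auto
      then show "norm (?l x) \<le> (norm h)\<^sup>2 * (norm x ^ 2 * norm (\<phi> x))"
        unfolding pt by (simp add: power_mult_distrib mult_ac)
    qed
    finally have "norm (fourier \<phi> \<zeta> - fourier \<phi> \<xi> - ?L h) \<le> (norm h)\<^sup>2 * (\<integral>x. norm x ^ 2 * norm (\<phi> x) \<partial>lborel)"
      by simp
    then show ?thesis
      using that unfolding h_def[symmetric] by (simp add: h_def power2_eq_square divide_le_eq mult_ac)
  qed
  have "((\<lambda>\<zeta>. norm (\<zeta> - \<xi>) * (\<integral>x. norm x ^ 2 * norm (\<phi> x) \<partial>lborel)) \<longlongrightarrow> norm (\<xi> - \<xi>) * (\<integral>x. norm x ^ 2 * norm (\<phi> x) \<partial>lborel)) (at \<xi>)"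
    by (intro tendsto_intros)
  then show "((\<lambda>\<zeta>. norm (\<zeta> - \<xi>) * (\<integral>x. norm x ^ 2 * norm (\<phi> x) \<partial>lborel)) \<longlongrightarrow> 0) (at \<xi>)"
    by simp
qed simp

lemma test_functions_coordinate:
  "\<phi> \<in> test_functions \<Longrightarrow> (\<lambda>x. - \<i> * complex_of_real (x $ j) * \<phi> x) \<in> test_functions"
  by (intro test_functions_mult_smooth smooth_mult smooth_const smooth_complex_coordinate)

lemma partial_deriv_fourier:
  assumes "\<phi> \<in> test_functions"
  shows "partial_deriv j (fourier \<phi>) = fourier (\<lambda>x. - \<i> * complex_of_real (x $ j) * \<phi> x)"
  by (rule ext, subst partial_deriv_eqI[OF fourier_has_derivative[OF assms]])
    (simp add: fourier_def inner_axis)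

lemma partial_derivs_fourier:
  assumes "\<phi> \<in> test_functions"
  obtains \<psi> where "\<psi> \<in> test_functions" "partial_derivs js (fourier \<phi>) = fourier \<psi>"
proof -
  have "\<exists>\<psi>\<in>test_functions. partial_derivs js (fourier \<phi>) = fourier \<psi>"
  proof (induction js)
    case (Cons j js)
    then show ?case
      using partial_deriv_fourier test_functions_coordinate by fastforce
  qed (use assms in auto)
  then show ?thesis using that by blast
qed

text \<open>Instead of integrating by parts, translate: moving \<open>\<phi>\<close> by \<open>h\<close> along the coordinate \<open>j\<close> multiplies
its transform by \<open>cis (h \<xi>\<^sub>j)\<close>. Dividing the change by \<open>h\<close> and letting \<open>h\<close> tend to zero gives the two
sides; for the left one the difference quotients are bounded and have a common compact support.\<close>

lemma fourier_partial_deriv: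
  fixes \<phi> :: "real^'n \<Rightarrow> complex"
  assumes "\<phi> \<in> test_functions"
  shows "fourier (partial_deriv j \<phi>) \<xi> = \<i> * complex_of_real (\<xi> $ j) * fourier \<phi> \<xi>"
proof -
  let ?e = "axis j (1::real) :: real^'n"
  define h where "h = (\<lambda>n. inverse (real (Suc n)))"
  have h0: "h n \<noteq> 0" "0 < h n" "h n \<le> 1" for n
    by (auto simp: h_def inverse_le_1_iff)
  have hlim: "h \<longlonglongrightarrow> 0"
    unfolding h_def by (rule LIMSEQ_inverse_real_of_nat)
  obtain R where R: "smooth \<phi>" "\<And>x. R \<le> norm x \<Longrightarrow> \<phi> x = 0"
    using assms by (rule test_functionsE) blast
  have [measurable]: "\<phi> \<in> borel_measurable borel" "partial_deriv j \<phi> \<in> borel_measurable borel"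
    using R(1) smooth_imp_measurable smooth_partial_deriv by blast+
  obtain B where B: "B > 0" "\<And>x. norm (partial_deriv j \<phi> x) \<le> B"
    using test_functions_bounded[OF test_functions_partial_deriv[OF assms]] by blast
  have der: "((\<lambda>t. \<phi> (x + t *\<^sub>R ?e)) has_derivative (\<lambda>t. t *\<^sub>R partial_deriv j \<phi> (x + s *\<^sub>R ?e))) (at s)" for x s
  proof -
    obtain D where D: "(\<phi> has_derivative D) (at (x + s *\<^sub>R ?e))"
      using smooth_imp_differentiable[OF R(1)] by (auto simp: differentiable_def)
    have "((\<lambda>t. \<phi> (x + t *\<^sub>R ?e)) has_derivative (\<lambda>t. D (t *\<^sub>R ?e))) (at s)"
      by (rule has_derivative_compose[where g = \<phi>]) (auto intro!: derivative_eq_intros D)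
    moreover have "D (t *\<^sub>R ?e) = t *\<^sub>R partial_deriv j \<phi> (x + s *\<^sub>R ?e)" for t
      using partial_deriv_eqI[OF D] has_derivative_linear[OF D] by (simp add: linear_scale)
    ultimately show ?thesis by simp
  qed
  define q where "q = (\<lambda>n x. (\<phi> (x + h n *\<^sub>R ?e) - \<phi> x) / complex_of_real (h n))"
  have q_lim: "(\<lambda>n. q n x) \<longlonglongrightarrow> partial_deriv j \<phi> x" for x
  proof -
    have "((\<lambda>t. norm (\<phi> (x + t *\<^sub>R ?e) - \<phi> x - t *\<^sub>R partial_deriv j \<phi> x) / norm t) \<longlongrightarrow> 0) (at 0)"
      using der[of x 0] by (simp add: has_derivative_at)
    moreover have "filterlim h (at 0) sequentially"
      using hlim h0 by (auto simp: filterlim_at)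
    ultimately have "(\<lambda>n. norm (\<phi> (x + h n *\<^sub>R ?e) - \<phi> x - h n *\<^sub>R partial_deriv j \<phi> x) / norm (h n)) \<longlonglongrightarrow> 0"
      by (rule filterlim_compose)
    moreover have "norm (\<phi> (x + h n *\<^sub>R ?e) - \<phi> x - h n *\<^sub>R partial_deriv j \<phi> x) / norm (h n)
        = norm (q n x - partial_deriv j \<phi> x)" for n
    proof -
      have "q n x - partial_deriv j \<phi> x
          = (\<phi> (x + h n *\<^sub>R ?e) - \<phi> x - h n *\<^sub>R partial_deriv j \<phi> x) / complex_of_real (h n)"
        using h0[of n] by (simp add: q_def scaleR_conv_of_real field_simps)
      then show ?thesis by (simp add: norm_divide)
    qed
    ultimately show ?thesis
      by (simp add: tendsto_norm_zero_iff LIM_zero_iff)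
  qed
  have q_bound: "norm (q n x) \<le> B" for n x
  proof -
    have "norm (\<phi> (x + h n *\<^sub>R ?e) - \<phi> (x + 0 *\<^sub>R ?e)) \<le> B * norm (h n - 0)"
    proof (rule differentiable_bound[OF convex_UNIV, where f = "\<lambda>t. \<phi> (x + t *\<^sub>R ?e)"])
      show "onorm (\<lambda>t. t *\<^sub>R partial_deriv j \<phi> (x + s *\<^sub>R ?e)) \<le> B" for s
        using B(2)[of "x + s *\<^sub>R ?e"]
        by (intro onorm_le) (simp add: mult.commute[of B] mult_left_mono)
    qed (use der in auto)
    then show ?thesis
      using h0[of n] by (simp add: q_def norm_divide divide_le_eq)
  qed
  \<comment> \<open>The increments \<open>h n\<close> are at most one, which enlarges the support by at most one.\<close>
  have q_supp: "q n x = 0" if "R + 1 \<le> norm x" for n x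
  proof -
    have "norm x - norm (h n *\<^sub>R ?e) \<le> norm (x + h n *\<^sub>R ?e)"
      using norm_triangle_ineq2[of x "- (h n *\<^sub>R ?e)"] by simp
    moreover have "norm (h n *\<^sub>R ?e) \<le> 1"
      using h0[of n] by simp
    ultimately have "R \<le> norm (x + h n *\<^sub>R ?e)" "R \<le> norm x"
      using that by linarith+
    then show ?thesis
      using R(2) by (simp add: q_def)
  qed
  have [measurable]: "q n \<in> borel_measurable borel" for n
    unfolding q_def by measurable
  have "(\<lambda>n. \<integral>x. cis (- (x \<bullet> \<xi>)) * q n x \<partial>lborel) \<longlonglongrightarrow> (\<integral>x. cis (- (x \<bullet> \<xi>)) * partial_deriv j \<phi> x \<partial>lborel)"
  proof (rule integral_dominated_convergence[where w = "\<lambda>x. B * indicator (cball 0 (R + 1)) x"])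
    show "integrable lborel (\<lambda>x. B * indicator (cball 0 (R + 1)) (x::real^'n))"
      using emeasure_bounded_finite[of "cball (0::real^'n) (R + 1)"]
      by (intro integrable_mult_right) auto
    show "AE x in lborel. norm (cis (- (x \<bullet> \<xi>)) * q n x) \<le> B * indicator (cball 0 (R + 1)) x" for n
      using q_bound[of n] q_supp[of _ n] B(1) by (auto simp: norm_mult indicator_def not_le)
    show "AE x in lborel. (\<lambda>n. cis (- (x \<bullet> \<xi>)) * q n x) \<longlonglongrightarrow> cis (- (x \<bullet> \<xi>)) * partial_deriv j \<phi> x"
      by (intro AE_I2 tendsto_intros q_lim)
  qed measurable
  moreover have "(\<integral>x. cis (- (x \<bullet> \<xi>)) * q n x \<partial>lborel)
      = (cis (h n * \<xi> $ j) - 1) / complex_of_real (h n) * fourier \<phi> \<xi>" for n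
  proof -
    have int: "integrable lborel (\<lambda>x. cis (- (x \<bullet> \<xi>)) * \<phi> x)"
      by (intro integrable_cis_mult test_functions_integrable assms) measurable
    have shift: "(\<integral>x. cis (- (x \<bullet> \<xi>)) * \<phi> (x + h n *\<^sub>R ?e) \<partial>lborel) = cis (h n * \<xi> $ j) * fourier \<phi> \<xi>"
    proof -
      have "(\<integral>x. cis (- (x \<bullet> \<xi>)) * \<phi> (x + h n *\<^sub>R ?e) \<partial>lborel)
        = (\<integral>x. cis (h n * \<xi> $ j) * (cis (- ((h n *\<^sub>R ?e + x) \<bullet> \<xi>)) * \<phi> (h n *\<^sub>R ?e + x)) \<partial>lborel)"
        by (rule Bochner_Integration.integral_cong)
          (auto simp: mult.assoc[symmetric] cis_mult inner_add_left inner_axis' add_ac)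
      also have "\<dots> = cis (h n * \<xi> $ j) * (\<integral>x. cis (- ((h n *\<^sub>R ?e + x) \<bullet> \<xi>)) * \<phi> (h n *\<^sub>R ?e + x) \<partial>lborel)"
        by (rule integral_mult_right_zero)
      also have "(\<integral>x. cis (- ((h n *\<^sub>R ?e + x) \<bullet> \<xi>)) * \<phi> (h n *\<^sub>R ?e + x) \<partial>lborel) = fourier \<phi> \<xi>"
        unfolding fourier_def
        by (rule lborel_translation[where f = "\<lambda>x. cis (- (x \<bullet> \<xi>)) * \<phi> x"]) measurable
      finally show ?thesis .
    qed
    have "integrable lborel (q n)"
      using q_bound[of n] q_supp[of _ n] by (intro integrable_bounded_support) auto
    then have "integrable lborel (\<lambda>x. complex_of_real (h n) * q n x + \<phi> x)"
      using test_functions_integrable[OF assms] by simp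
    then have "integrable lborel (\<lambda>x. \<phi> (x + h n *\<^sub>R ?e))"
      using h0[of n] by (simp add: q_def)
    then have int2: "integrable lborel (\<lambda>x. cis (- (x \<bullet> \<xi>)) * \<phi> (x + h n *\<^sub>R ?e))"
      by (intro integrable_cis_mult) measurable
    have "(\<integral>x. cis (- (x \<bullet> \<xi>)) * q n x \<partial>lborel)
      = (\<integral>x. (cis (- (x \<bullet> \<xi>)) * \<phi> (x + h n *\<^sub>R ?e) - cis (- (x \<bullet> \<xi>)) * \<phi> x) / complex_of_real (h n) \<partial>lborel)"
      by (rule Bochner_Integration.integral_cong) (auto simp: q_def algebra_simps)
    also have "\<dots> = (cis (h n * \<xi> $ j) * fourier \<phi> \<xi> - fourier \<phi> \<xi>) / complex_of_real (h n)"
      using int int2 by (simp add: shift) (simp add: fourier_def)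
    finally show ?thesis by (simp add: algebra_simps)
  qed
  ultimately have "(\<lambda>n. (cis (h n * \<xi> $ j) - 1) / complex_of_real (h n) * fourier \<phi> \<xi>) \<longlonglongrightarrow> fourier (partial_deriv j \<phi>) \<xi>"
    by (simp add: fourier_def)
  moreover have "(\<lambda>n. (cis (h n * \<xi> $ j) - 1) / complex_of_real (h n) * fourier \<phi> \<xi>) \<longlonglongrightarrow> \<i> * complex_of_real (\<xi> $ j) * fourier \<phi> \<xi>"
  proof (rule tendsto_mult_right)
    have bound: "norm ((cis (h n * \<xi> $ j) - 1) / complex_of_real (h n) - \<i> * complex_of_real (\<xi> $ j)) \<le> h n * (\<xi> $ j)\<^sup>2" for n
    proof -
      have eq: "(cis (h n * \<xi> $ j) - 1) / complex_of_real (h n) - \<i> * complex_of_real (\<xi> $ j)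
        = (cis (h n * \<xi> $ j) - 1 - \<i> * complex_of_real (h n * \<xi> $ j)) / complex_of_real (h n)"
        using h0[of n] by (simp add: field_simps)
      have le: "norm (cis (h n * \<xi> $ j) - 1 - \<i> * complex_of_real (h n * \<xi> $ j)) \<le> (h n * \<xi> $ j)\<^sup>2"
        by (rule order_trans[OF norm_cis_minus_linear_le]) simp
      have bound: "norm ((cis (h n * \<xi> $ j) - 1) / complex_of_real (h n) - \<i> * complex_of_real (\<xi> $ j))
          \<le> (h n * \<xi> $ j)\<^sup>2 / h n"
        unfolding eq norm_divide using divide_right_mono[OF le, of "h n"] h0[of n] by simp
      also have "\<dots> = h n * (\<xi> $ j)\<^sup>2"
        using h0[of n] by (simp add: power2_eq_square)
      finally show ?thesis .
    qed
    have "(\<lambda>n. h n * (\<xi> $ j)\<^sup>2) \<longlonglongrightarrow> 0"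
      using tendsto_mult_right[OF hlim, of "(\<xi> $ j)\<^sup>2"] by simp
    then have "(\<lambda>n. (cis (h n * \<xi> $ j) - 1) / complex_of_real (h n) - \<i> * complex_of_real (\<xi> $ j)) \<longlonglongrightarrow> 0"
      by (rule Lim_null_comparison[rotated]) (intro always_eventually allI bound)
    then show "(\<lambda>n. (cis (h n * \<xi> $ j) - 1) / complex_of_real (h n)) \<longlonglongrightarrow> \<i> * complex_of_real (\<xi> $ j)"
      by (simp add: LIM_zero_iff)
  qed
  ultimately show ?thesis
    by (rule LIMSEQ_unique)
qed

text \<open>Each factor \<open>|\<xi>|\<close> is dominated by the sum of the \<open>|\<xi>\<^sub>j|\<close>, and a factor \<open>\<xi>\<^sub>j\<close> is absorbed by
differentiating \<open>\<phi>\<close>.\<close>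

lemma fourier_weighted_bounded:
  fixes \<phi> :: "real^'n \<Rightarrow> complex"
  assumes "\<phi> \<in> test_functions"
  shows "\<exists>B. \<forall>\<xi>. (1 + norm \<xi>) ^ N * norm (fourier \<phi> \<xi>) \<le> B"
  using assms
proof (induction N arbitrary: \<phi>)
  case 0
  then show ?case using norm_fourier_le by auto
next
  case (Suc N)
  obtain B where B: "\<And>\<xi>. (1 + norm \<xi>) ^ N * norm (fourier \<phi> \<xi>) \<le> B"
    using Suc by blast
  have "\<forall>j. \<exists>B. \<forall>\<xi>. (1 + norm \<xi>) ^ N * norm (fourier (partial_deriv j \<phi>) \<xi>) \<le> B"
    using Suc test_functions_partial_deriv by blast
  then obtain C where C: "\<And>j \<xi>. (1 + norm \<xi>) ^ N * norm (fourier (partial_deriv j \<phi>) \<xi>) \<le> C j"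
    by metis
  have "(1 + norm \<xi>) ^ Suc N * norm (fourier \<phi> \<xi>) \<le> B + (\<Sum>j\<in>UNIV. C j)" for \<xi>
  proof -
    have "norm \<xi> * norm (fourier \<phi> \<xi>) \<le> (\<Sum>j\<in>UNIV. \<bar>\<xi> $ j\<bar>) * norm (fourier \<phi> \<xi>)"
      by (intro mult_right_mono norm_le_l1_cart) auto
    also have "\<dots> = (\<Sum>j\<in>UNIV. norm (fourier (partial_deriv j \<phi>) \<xi>))"
      by (simp add: fourier_partial_deriv[OF Suc.prems] norm_mult sum_distrib_right)
    finally have "(1 + norm \<xi>) ^ N * (norm (fourier \<phi> \<xi>) + norm \<xi> * norm (fourier \<phi> \<xi>))
        \<le> (1 + norm \<xi>) ^ N * (norm (fourier \<phi> \<xi>) + (\<Sum>j\<in>UNIV. norm (fourier (partial_deriv j \<phi>) \<xi>)))"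
      by (intro mult_left_mono) auto
    also have "\<dots> \<le> B + (\<Sum>j\<in>UNIV. C j)"
      unfolding distrib_left sum_distrib_left by (intro add_mono sum_mono B C)
    finally show ?thesis by (simp add: algebra_simps)
  qed
  then show ?case by blast
qed

lemma fourier_smooth: "\<phi> \<in> test_functions \<Longrightarrow> smooth (fourier \<phi>)"
  unfolding smooth_def
proof (intro allI)
  fix js and x :: "real^'a" assume "\<phi> \<in> test_functions"
  then obtain \<psi> where "\<psi> \<in> test_functions" "partial_derivs js (fourier \<phi>) = fourier \<psi>"
    by (rule partial_derivs_fourier)
  then show "partial_derivs js (fourier \<phi>) differentiable (at x)"
    using fourier_has_derivative[of \<psi> x] by (auto simp: differentiable_def)
qed

lemma fourier_schwartz:
  assumes "\<phi> \<in> test_functions" shows "fourier \<phi> \<in> schwartz"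
proof -
  have "bounded (range (\<lambda>x. (1 + norm x) ^ N *\<^sub>R partial_derivs js (fourier \<phi>) x))" for N js
  proof -
    obtain \<psi> where \<psi>: "\<psi> \<in> test_functions" "partial_derivs js (fourier \<phi>) = fourier \<psi>"
      using assms by (rule partial_derivs_fourier)
    obtain B where "\<And>\<xi>. (1 + norm \<xi>) ^ N * norm (fourier \<psi> \<xi>) \<le> B"
      using fourier_weighted_bounded[OF \<psi>(1)] by blast
    then show ?thesis
      unfolding \<psi>(2) by (intro boundedI[of _ B]) auto
  qed
  then show ?thesis
    using fourier_smooth[OF assms] unfolding schwartz_def by blast
qed

section \<open>Fourier inversion and Plancherel's identity\<close>

lemma fourier_integrable:
  fixes \<phi> :: "real^'n \<Rightarrow> complex"
  assumes "\<phi> \<in> test_functions"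
  shows "integrable lborel (fourier \<phi>)"
proof -
  obtain B where B: "\<And>\<xi>. (1 + norm \<xi>) ^ (2 * CARD('n)) * norm (fourier \<phi> \<xi>) \<le> B"
    using fourier_weighted_bounded[OF assms] by blast
  have B0: "0 \<le> B"
    using order_trans[OF _ B[of 0]] by simp
  show ?thesis
  proof (rule Bochner_Integration.integrable_bound)
    show "integrable lborel (\<lambda>\<xi>::real^'n. B * (\<Prod>j\<in>UNIV. 1 / (1 + (\<xi> $ j)\<^sup>2)))"
      by (intro integrable_mult_right integrable_prod_coordinates integrable_inverse_1_plus_square)
    show "fourier \<phi> \<in> borel_measurable lborel"
      using smooth_imp_measurable[OF fourier_smooth[OF assms]] by simp
    have "norm (fourier \<phi> \<xi>) \<le> B * (\<Prod>j\<in>UNIV. 1 / (1 + (\<xi> $ j)\<^sup>2))" for \<xi>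
    proof -
      have pos: "0 < (\<Prod>j\<in>UNIV. 1 + (\<xi> $ j)\<^sup>2)"
        by (intro prod_pos) (auto simp: add_pos_nonneg)
      have "(\<Prod>j\<in>UNIV. 1 + (\<xi> $ j)\<^sup>2) \<le> (\<Prod>j\<in>(UNIV::'n set). (1 + norm \<xi>)\<^sup>2)"
      proof (intro prod_mono conjI)
        fix j :: 'n
        have "(\<xi> $ j)\<^sup>2 \<le> (norm \<xi>)\<^sup>2"
          using component_le_norm_cart[of \<xi> j] by (metis abs_ge_zero power2_abs power_mono)
        then show "1 + (\<xi> $ j)\<^sup>2 \<le> (1 + norm \<xi>)\<^sup>2"
          using norm_ge_zero[of \<xi>] unfolding power2_sum by (simp only: one_power2)
      qed auto
      also have "\<dots> = (1 + norm \<xi>) ^ (2 * CARD('n))"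
        by (simp add: power_mult)
      finally have "(\<Prod>j\<in>UNIV. 1 + (\<xi> $ j)\<^sup>2) * norm (fourier \<phi> \<xi>) \<le> (1 + norm \<xi>) ^ (2 * CARD('n)) * norm (fourier \<phi> \<xi>)"
        by (intro mult_right_mono) auto
      also have "\<dots> \<le> B"
        by (rule B)
      finally show ?thesis
        using pos by (simp add: prod_dividef field_simps)
    qed
    then show "AE \<xi> in lborel. norm (fourier \<phi> \<xi>) \<le> norm (B * (\<Prod>j\<in>UNIV. 1 / (1 + (\<xi> $ j)\<^sup>2)))"
      by (intro AE_I2) (auto intro: order_trans[OF _ abs_ge_self])
  qed
qed

lemma gaussian_tendsto_1:
  "e \<longlonglongrightarrow> 0 \<Longrightarrow> (\<lambda>n. gaussian (e n) x) \<longlonglongrightarrow> 1"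
proof -
  assume "e \<longlonglongrightarrow> 0"
  then have "(\<lambda>n. \<Prod>j\<in>UNIV. exp (- (e n * x $ j)\<^sup>2 / 2)) \<longlonglongrightarrow> (\<Prod>j\<in>UNIV. exp (- (0 * x $ j)\<^sup>2 / 2))"
    by (intro tendsto_intros) auto
  then show ?thesis
    by (simp add: gaussian_def)
qed

text \<open>Insert a Gaussian factor that tends to one. Fubini's theorem then turns the integral into an
average of \<open>\<phi>\<close> around \<open>x\<close> with Gaussian weights, and the substitution \<open>y = x + e z\<close> fixes the weight
and shrinks the displacement. Dominated convergence applies to both forms.\<close>

lemma fourier_inversion:
  fixes \<phi> :: "real^'n \<Rightarrow> complex"
  assumes "\<phi> \<in> test_functions"
  shows "(\<integral>\<xi>. cis (x \<bullet> \<xi>) * fourier \<phi> \<xi> \<partial>lborel) = (2 * pi) ^ CARD('n) * \<phi> x"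
proof -
  define e where "e = (\<lambda>n. inverse (real (Suc n)))"
  have e: "0 < e n" for n
    by (simp add: e_def)
  have elim: "e \<longlonglongrightarrow> 0"
    unfolding e_def by (rule LIMSEQ_inverse_real_of_nat)
  have int\<phi>: "integrable lborel \<phi>"
    by (rule test_functions_integrable[OF assms])
  have intF: "integrable lborel (fourier \<phi>)"
    by (rule fourier_integrable[OF assms])
  have [measurable]: "\<phi> \<in> borel_measurable borel" "fourier \<phi> \<in> borel_measurable borel"
    using int\<phi> intF by auto
  obtain B where B: "\<And>x. norm (\<phi> x) \<le> B"
    using assms by (rule test_functions_bounded) blast
  define c where "c = sqrt (2 * pi) ^ CARD('n)"
  have "(\<lambda>n. \<integral>\<xi>. cis (x \<bullet> \<xi>) * complex_of_real (gaussian (e n) \<xi>) * fourier \<phi> \<xi> \<partial>lborel)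
      \<longlonglongrightarrow> (\<integral>\<xi>. cis (x \<bullet> \<xi>) * fourier \<phi> \<xi> \<partial>lborel)"
  proof (rule integral_dominated_convergence[where w = "\<lambda>\<xi>. norm (fourier \<phi> \<xi>)"])
    have "norm (cis (x \<bullet> \<xi>) * complex_of_real (gaussian (e n) \<xi>) * fourier \<phi> \<xi>) \<le> norm (fourier \<phi> \<xi>)" for n \<xi>
      using gaussian_bounds[of "e n" \<xi>] by (simp add: norm_mult mult_left_le_one_le)
    then show "AE \<xi> in lborel. norm (cis (x \<bullet> \<xi>) * complex_of_real (gaussian (e n) \<xi>) * fourier \<phi> \<xi>) \<le> norm (fourier \<phi> \<xi>)" for n
      by simp
    have "(\<lambda>n. cis (x \<bullet> \<xi>) * complex_of_real (gaussian (e n) \<xi>) * fourier \<phi> \<xi>) \<longlonglongrightarrow> cis (x \<bullet> \<xi>) * complex_of_real 1 * fourier \<phi> \<xi>" for \<xi>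
      by (intro tendsto_intros gaussian_tendsto_1 elim)
    then show "AE \<xi> in lborel. (\<lambda>n. cis (x \<bullet> \<xi>) * complex_of_real (gaussian (e n) \<xi>) * fourier \<phi> \<xi>) \<longlonglongrightarrow> cis (x \<bullet> \<xi>) * fourier \<phi> \<xi>"
      by simp
  qed (use intF in \<open>measurable, auto\<close>)
  moreover have "(\<integral>\<xi>. cis (x \<bullet> \<xi>) * complex_of_real (gaussian (e n) \<xi>) * fourier \<phi> \<xi> \<partial>lborel)
      = (\<integral>z. complex_of_real (c * gaussian 1 z) * \<phi> (x + e n *\<^sub>R z) \<partial>lborel)" for n
  proof -
    have intg: "integrable lborel (\<lambda>\<xi>. cis (x \<bullet> \<xi>) * complex_of_real (gaussian (e n) \<xi>))"
      by (intro integrable_cis_mult) (use gaussian_lborel_integrable[OF e] in auto)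
    have "(\<integral>\<xi>. cis (x \<bullet> \<xi>) * complex_of_real (gaussian (e n) \<xi>) * fourier \<phi> \<xi> \<partial>lborel)
        = (\<integral>y. \<phi> y * (\<integral>\<xi>. cis (- (y \<bullet> \<xi>)) * (cis (x \<bullet> \<xi>) * complex_of_real (gaussian (e n) \<xi>)) \<partial>lborel) \<partial>lborel)"
      unfolding fourier_def
    proof (rule Fubini_bounded_kernel[OF intg int\<phi>])
      show "(\<lambda>(\<xi>, y). cis (- (y \<bullet> \<xi>))) \<in> borel_measurable (borel \<Otimes>\<^sub>M (borel :: (real^'n) measure))"
        by measurable
    qed simp
    also have "\<dots> = (\<integral>y. \<phi> y * complex_of_real ((sqrt (2 * pi) / e n) ^ CARD('n) * gaussian (1 / e n) (x - y)) \<partial>lborel)"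
    proof (rule Bochner_Integration.integral_cong)
      fix y
      have "cis (- (y \<bullet> \<xi>)) * (cis (x \<bullet> \<xi>) * complex_of_real (gaussian (e n) \<xi>)) = cis ((x - y) \<bullet> \<xi>) * complex_of_real (gaussian (e n) \<xi>)" for \<xi>
        by (simp add: mult.assoc[symmetric] cis_mult inner_diff_left)
      then show "\<phi> y * (\<integral>\<xi>. cis (- (y \<bullet> \<xi>)) * (cis (x \<bullet> \<xi>) * complex_of_real (gaussian (e n) \<xi>)) \<partial>lborel)
          = \<phi> y * complex_of_real ((sqrt (2 * pi) / e n) ^ CARD('n) * gaussian (1 / e n) (x - y))"
        by (simp only: fourier_gaussian[OF e])
    qed simp
    also have "\<dots> = e n ^ CARD('n) *\<^sub>R (\<integral>z. \<phi> (x + e n *\<^sub>R z) *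
        complex_of_real ((sqrt (2 * pi) / e n) ^ CARD('n) * gaussian (1 / e n) (x - (x + e n *\<^sub>R z))) \<partial>lborel)"
      by (rule lborel_affine_substitution[OF e]) measurable
    also have "\<dots> = (\<integral>z. complex_of_real (c * gaussian 1 z) * \<phi> (x + e n *\<^sub>R z) \<partial>lborel)"
    proof (subst integral_scaleR_right[symmetric], rule Bochner_Integration.integral_cong)
      fix z
      have "gaussian (1 / e n) (x - (x + e n *\<^sub>R z)) = gaussian 1 z"
        using e[of n] by (simp add: gaussian_def)
      moreover have "complex_of_real (e n) ^ CARD('n) * complex_of_real ((sqrt (2 * pi) / e n) ^ CARD('n)) = complex_of_real c"
        using e[of n] by (simp add: c_def power_divide)
      ultimately show "e n ^ CARD('n) *\<^sub>R (\<phi> (x + e n *\<^sub>R z) *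
            complex_of_real ((sqrt (2 * pi) / e n) ^ CARD('n) * gaussian (1 / e n) (x - (x + e n *\<^sub>R z))))
          = complex_of_real (c * gaussian 1 z) * \<phi> (x + e n *\<^sub>R z)"
        by (simp add: scaleR_conv_of_real)
    qed simp
    finally show ?thesis .
  qed
  moreover have "(\<lambda>n. \<integral>z. complex_of_real (c * gaussian 1 z) * \<phi> (x + e n *\<^sub>R z) \<partial>lborel)
      \<longlonglongrightarrow> (\<integral>z. complex_of_real (c * gaussian 1 (z::real^'n)) * \<phi> x \<partial>lborel)"
  proof (rule integral_dominated_convergence[where w = "\<lambda>z. B * (c * gaussian 1 z)"])
    show "integrable lborel (\<lambda>z::real^'n. B * (c * gaussian 1 z))"
      by (intro integrable_mult_right gaussian_lborel_integrable) simp
    have "norm (complex_of_real (c * gaussian 1 z) * \<phi> (x + e n *\<^sub>R z)) \<le> B * (c * gaussian 1 z)" for n z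
    proof -
      have "0 \<le> c * gaussian 1 z"
        using gaussian_bounds(1)[of 1 z] by (simp add: c_def)
      then have "norm (complex_of_real (c * gaussian 1 z) * \<phi> (x + e n *\<^sub>R z)) = (c * gaussian 1 z) * norm (\<phi> (x + e n *\<^sub>R z))"
        by (simp only: norm_mult norm_of_real abs_of_nonneg)
      also have "\<dots> \<le> (c * gaussian 1 z) * B"
        by (intro mult_left_mono B) fact
      finally show ?thesis by (simp add: mult_ac)
    qed
    then show "AE z in lborel. norm (complex_of_real (c * gaussian 1 z) * \<phi> (x + e n *\<^sub>R z)) \<le> B * (c * gaussian 1 z)" for n
      by simp
    have "(\<lambda>n. \<phi> (x + e n *\<^sub>R z)) \<longlonglongrightarrow> \<phi> x" for z
    proof -
      have "(\<lambda>n. x + e n *\<^sub>R z) \<longlonglongrightarrow> x + 0 *\<^sub>R z"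
        by (intro tendsto_intros elim)
      then have lim: "(\<lambda>n. x + e n *\<^sub>R z) \<longlonglongrightarrow> x"
        by simp
      have cont: "isCont \<phi> x"
        using smooth_imp_continuous[OF test_functions_smooth[OF assms]]
        by (simp add: continuous_on_eq_continuous_at)
      show ?thesis
        by (rule isCont_tendsto_compose[OF cont lim])
    qed
    then show "AE z in lborel. (\<lambda>n. complex_of_real (c * gaussian 1 z) * \<phi> (x + e n *\<^sub>R z)) \<longlonglongrightarrow> complex_of_real (c * gaussian 1 z) * \<phi> x"
      by (intro AE_I2 tendsto_intros)
  qed measurable
  ultimately have "(\<integral>\<xi>. cis (x \<bullet> \<xi>) * fourier \<phi> \<xi> \<partial>lborel) = (\<integral>z. complex_of_real (c * gaussian 1 (z::real^'n)) * \<phi> x \<partial>lborel)"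
    by (simp add: LIMSEQ_unique)
  also have "\<dots> = (\<integral>z. complex_of_real (c * gaussian 1 (z::real^'n)) \<partial>lborel) * \<phi> x"
    by (rule integral_mult_left_zero)
  also have "(\<integral>z. complex_of_real (c * gaussian 1 (z::real^'n)) \<partial>lborel) = complex_of_real (c * c)"
    using gaussian_integral[where 'n = 'n, of 1] by (subst integral_complex_of_real) (simp add: c_def)
  also have "c * c = (2 * pi) ^ CARD('n)"
    unfolding c_def power_mult_distrib[symmetric] by simp
  finally show ?thesis
    by simp
qed

lemma inv_fourier_fourier:
  "\<phi> \<in> test_functions \<Longrightarrow> inv_fourier (fourier \<phi>) = \<phi>"
  by (rule ext) (simp add: inv_fourier_def fourier_inversion)

lemma
  fixes \<phi> :: "real^'n \<Rightarrow> complex"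
  assumes "\<phi> \<in> test_functions"
  shows fourier_square_integrable: "integrable lborel (\<lambda>x. (norm (fourier \<phi> x))\<^sup>2)"
    and Plancherel: "(\<integral>x. (norm (fourier \<phi> x))\<^sup>2 \<partial>lborel) = (2 * pi) ^ CARD('n) * (\<integral>x. (norm (\<phi> x))\<^sup>2 \<partial>lborel)"
proof -
  let ?F = "fourier \<phi>"
  have int\<phi>: "integrable lborel \<phi>"
    by (rule test_functions_integrable[OF assms])
  have intF: "integrable lborel ?F"
    by (rule fourier_integrable[OF assms])
  have [measurable]: "\<phi> \<in> borel_measurable borel" "?F \<in> borel_measurable borel"
    using int\<phi> intF by auto
  show "integrable lborel (\<lambda>x. (norm (?F x))\<^sup>2)"
  proof (rule Bochner_Integration.integrable_bound)
    show "integrable lborel (\<lambda>x. (\<integral>y. norm (\<phi> y) \<partial>lborel) * norm (?F x))"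
      using intF by simp
    show "AE x in lborel. norm ((norm (?F x))\<^sup>2) \<le> norm ((\<integral>y. norm (\<phi> y) \<partial>lborel) * norm (?F x))"
      by (auto simp: power2_eq_square abs_mult intro!: mult_right_mono order_trans[OF norm_fourier_le])
  qed measurable
  have cnjF: "cnj (?F x) = (\<integral>y. cis (x \<bullet> y) * cnj (\<phi> y) \<partial>lborel)" for x
  proof -
    have "cnj (?F x) = (\<integral>y. cnj (cis (- (y \<bullet> x)) * \<phi> y) \<partial>lborel)"
      unfolding fourier_def by (rule Bochner_Integration.integral_cnj[symmetric])
    then show ?thesis
      by (simp add: cis_cnj inner_commute)
  qed
  have "complex_of_real (\<integral>x. (norm (?F x))\<^sup>2 \<partial>lborel) = (\<integral>x. ?F x * cnj (?F x) \<partial>lborel)"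
    by (subst integral_complex_of_real[symmetric]) (simp only: complex_norm_square)
  also have "\<dots> = (\<integral>y. cnj (\<phi> y) * (\<integral>x. cis (x \<bullet> y) * ?F x \<partial>lborel) \<partial>lborel)"
    unfolding cnjF
  proof (rule Fubini_bounded_kernel[OF intF])
    show "(\<lambda>(x, y). cis (x \<bullet> y)) \<in> borel_measurable (borel \<Otimes>\<^sub>M (borel :: (real^'n) measure))"
      by measurable
  qed (use int\<phi> in auto)
  also have "\<dots> = (\<integral>y. complex_of_real ((2 * pi) ^ CARD('n) * (norm (\<phi> y))\<^sup>2) \<partial>lborel)"
  proof (rule Bochner_Integration.integral_cong)
    fix y
    have "(\<integral>x. cis (x \<bullet> y) * ?F x \<partial>lborel) = (2 * pi) ^ CARD('n) * \<phi> y"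
      using fourier_inversion[OF assms, of y] by (simp add: inner_commute)
    then show "cnj (\<phi> y) * (\<integral>x. cis (x \<bullet> y) * ?F x \<partial>lborel) = complex_of_real ((2 * pi) ^ CARD('n) * (norm (\<phi> y))\<^sup>2)"
      by (simp only: of_real_mult complex_norm_square) (simp add: mult_ac)
  qed simp
  also have "\<dots> = complex_of_real ((2 * pi) ^ CARD('n) * (\<integral>x. (norm (\<phi> x))\<^sup>2 \<partial>lborel))"
    by (subst integral_complex_of_real) simp
  finally show "(\<integral>x. (norm (?F x))\<^sup>2 \<partial>lborel) = (2 * pi) ^ CARD('n) * (\<integral>x. (norm (\<phi> x))\<^sup>2 \<partial>lborel)"
    using of_real_eq_iff by blast
qed

text \<open>Through this bound, which combines the Cauchy--Schwarz inequality with Plancherel's identity, lower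
bounds for pairings become lower bounds for the norm of \<open>v\<close>.\<close>

lemma square_integrable_pairing:
  fixes v :: "real^'n \<Rightarrow> real"
  assumes v: "square_integrable v" and \<phi>: "\<phi> \<in> test_functions"
  shows "integrable lborel (\<lambda>x. cfun v x * fourier \<phi> x)"
    and "norm (distr_of (cfun v) (fourier \<phi>)) \<le> L2_norm v * (sqrt ((2 * pi) ^ CARD('n)) * L2_norm \<phi>)"
proof -
  have [measurable]: "v \<in> borel_measurable borel" and v2: "integrable lborel (\<lambda>x. (norm (v x))\<^sup>2)"
    using v by (auto simp: square_integrable_def)
  have F: "fourier \<phi> \<in> borel_measurable lborel"
    using smooth_imp_measurable[OF fourier_smooth[OF \<phi>]] by simp
  note CS = integral_Cauchy_Schwarz[where f = "cfun v" and g = "fourier \<phi>" and M = lborel,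
      OF _ F _ fourier_square_integrable[OF \<phi>]]
  show "integrable lborel (\<lambda>x. cfun v x * fourier \<phi> x)"
    using v2 by (intro CS(1)) auto
  show "norm (distr_of (cfun v) (fourier \<phi>)) \<le> L2_norm v * (sqrt ((2 * pi) ^ CARD('n)) * L2_norm \<phi>)"
    using CS(2) v2 by (simp add: distr_of_def L2_norm_def Plancherel[OF \<phi>] real_sqrt_mult)
qed

section \<open>Approximation by smooth functions\<close>

lemma smooth_polynomial_function:
  fixes p :: "real^'n \<Rightarrow> complex"
  assumes "polynomial_function p" shows "smooth p"
proof -
  have "smooth (\<lambda>x. complex_of_real (Re (p x)) + \<i> * complex_of_real (Im (p x)))"
    using assms bounded_linear_Re bounded_linear_Im unfolding polynomial_function_def
    by (intro smooth_add smooth_mult smooth_const smooth_of_real smooth_real_polynomial_function)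
      (auto simp: o_def)
  then show ?thesis
    by (simp add: complex_eq[symmetric])
qed

text \<open>A measurable function is the almost everywhere limit of continuous functions \<open>g\<^sub>n\<close>. Radial
truncation makes them bounded by one without changing the limit, and the Stone--Weierstrass theorem
replaces them on the ball by polynomials with an error of at most one, whence the bound 2.\<close>

lemma smooth_approximation:
  fixes w :: "real^'n \<Rightarrow> complex"
  assumes w: "w \<in> borel_measurable borel" "\<And>x. norm (w x) \<le> 1"
  obtains p where "\<And>n::nat. smooth (p n)" "\<And>n x. norm x \<le> R \<Longrightarrow> norm (p n x) \<le> 2"
    "AE x in lborel. norm x \<le> R \<longrightarrow> (\<lambda>n. p n x) \<longlonglongrightarrow> w x"
proof -
  have "w measurable_on UNIV"
    using w by (intro lebesgue_measurable_imp_measurable_on) (auto intro: measurable_completion)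
  then obtain N g where N: "negligible N" and g: "\<And>n. continuous_on UNIV (g n)"
    and lim: "\<And>x. x \<notin> N \<Longrightarrow> (\<lambda>n::nat. g n x) \<longlonglongrightarrow> w x"
    unfolding measurable_on_def by auto
  define g' where "g' = (\<lambda>n x. g n x /\<^sub>R max 1 (norm (g n x)))"
  have g'1: "norm (g' n x) \<le> 1" for n x
    by (simp add: g'_def divide_simps)
  have g'_cont: "continuous_on S (g' n)" for S n
    unfolding g'_def
    by (intro continuous_intros continuous_on_subset[OF g]) auto
  have g'_lim: "(\<lambda>n. g' n x) \<longlonglongrightarrow> w x" if "x \<notin> N" for x
  proof -
    have "(\<lambda>n. g' n x) \<longlonglongrightarrow> w x /\<^sub>R max 1 (norm (w x))"
      unfolding g'_def by (intro tendsto_intros lim that) auto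
    then show ?thesis
      using w(2)[of x] by (simp add: max_def split: if_splits)
  qed
  have "\<exists>p. polynomial_function p \<and> (\<forall>x\<in>cball 0 R. norm (g' n x - p x) < inverse (real (Suc n)))" for n
    using Stone_Weierstrass_polynomial_function[OF compact_cball g'_cont, of "inverse (real (Suc n))"]
    by auto
  then obtain p where p: "\<And>n. polynomial_function (p n)"
    "\<And>n x. norm x \<le> R \<Longrightarrow> norm (g' n x - p n x) < inverse (real (Suc n))"
    by (metis mem_cball_0)
  show ?thesis
  proof (rule that)
    show "smooth (p n)" for n
      by (rule smooth_polynomial_function[OF p(1)])
    show "norm (p n x) \<le> 2" if "norm x \<le> R" for n x
    proof -
      have "inverse (real (Suc n)) \<le> 1"
        by (simp add: inverse_le_1_iff)
      then show ?thesis
        using p(2)[OF that, of n] g'1[of n x] norm_triangle_ineq2[of "p n x" "g' n x"]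
        by (simp add: norm_minus_commute)
    qed
    have "AE x in lebesgue. x \<notin> N"
      using N by (simp add: negligible_iff_null_sets AE_not_in)
    then have "AE x in lborel. x \<notin> N"
      by (simp add: AE_completion_iff)
    then show "AE x in lborel. norm x \<le> R \<longrightarrow> (\<lambda>n. p n x) \<longlonglongrightarrow> w x"
    proof eventually_elim
      case (elim x)
      show ?case
      proof
        assume x: "norm x \<le> R"
        have "(\<lambda>n. g' n x - p n x) \<longlonglongrightarrow> 0"
          by (rule Lim_null_comparison[OF _ LIMSEQ_inverse_real_of_nat])
            (intro always_eventually allI less_imp_le p(2) x)
        from tendsto_diff[OF g'_lim[OF elim] this] show "(\<lambda>n. p n x) \<longlonglongrightarrow> w x"
          by simp
      qed
    qed
  qed
qed

section \<open>Pairings with the Fourier transform of a square integrable function\<close>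

text \<open>By duality this is the integral of \<open>\<phi>\<close> against the Fourier transform of \<open>v\<close>.\<close>

definition fourier_pairing :: "(real^'n::finite \<Rightarrow> real) \<Rightarrow> (real^'n \<Rightarrow> complex) \<Rightarrow> complex" where
  "fourier_pairing v \<phi> = distr_of (cfun v) (fourier \<phi>)"

definition plancherel_const :: "'n::finite itself \<Rightarrow> real" where
  "plancherel_const _ = sqrt ((2 * pi) ^ CARD('n))"

lemma plancherel_const_pos: "0 < plancherel_const TYPE('n::finite)"
  by (simp add: plancherel_const_def)

lemma fourier_pairing_bound:
  fixes v :: "real^'n \<Rightarrow> real"
  assumes "square_integrable v" "\<phi> \<in> test_functions"
  shows "norm (fourier_pairing v \<phi>) \<le> L2_norm v * (plancherel_const TYPE('n) * L2_norm \<phi>)"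
  using square_integrable_pairing(2)[OF assms] by (simp add: fourier_pairing_def plancherel_const_def)

lemma L2_norm_nonneg: "0 \<le> L2_norm f"
  by (simp add: L2_norm_def)

lemma L2_norm_le:
  fixes f g :: "real^'n \<Rightarrow> complex"
  assumes "f \<in> test_functions" "g \<in> test_functions" "0 \<le> c" "\<And>x. norm (f x) \<le> c * norm (g x)"
  shows "L2_norm f \<le> c * L2_norm g"
proof -
  have i: "integrable lborel (\<lambda>x. (norm (h x))\<^sup>2)" if "h \<in> test_functions" for h :: "real^'n \<Rightarrow> complex"
    using test_functions_weighted_integrable[OF that, of "\<lambda>x. 1" 2] by simp
  have "(\<integral>x. (norm (f x))\<^sup>2 \<partial>lborel) \<le> (\<integral>x. c\<^sup>2 * (norm (g x))\<^sup>2 \<partial>lborel)"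
  proof (rule integral_mono)
    show "(norm (f x))\<^sup>2 \<le> c\<^sup>2 * (norm (g x))\<^sup>2" for x
      using power_mono[OF assms(4)[of x], of 2] by (simp add: power_mult_distrib)
  qed (intro i assms integrable_mult_right)+
  then have "sqrt (\<integral>x. (norm (f x))\<^sup>2 \<partial>lborel) \<le> sqrt (c\<^sup>2 * (\<integral>x. (norm (g x))\<^sup>2 \<partial>lborel))"
    by simp
  also have "\<dots> = c * sqrt (\<integral>x. (norm (g x))\<^sup>2 \<partial>lborel)"
    using assms(3) by (simp add: real_sqrt_mult)
  finally show ?thesis
    by (simp add: L2_norm_def)
qed

lemma test_functions_cmult: "\<phi> \<in> test_functions \<Longrightarrow> (\<lambda>x. c * \<phi> x) \<in> test_functions"
  by (rule test_functions_mult_smooth[OF smooth_const])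

lemma fourier_pairing_cmult: "fourier_pairing v (\<lambda>x. c * \<phi> x) = c * fourier_pairing v \<phi>"
proof -
  have "fourier_pairing v (\<lambda>x. c * \<phi> x) = (\<integral>x. c * (cfun v x * fourier \<phi> x) \<partial>lborel)"
    unfolding fourier_pairing_def distr_of_def
    by (rule Bochner_Integration.integral_cong) (auto simp: fourier_cmult)
  then show ?thesis
    unfolding fourier_pairing_def distr_of_def by (simp only: integral_mult_right_zero)
qed

lemma fourier_pairing_add:
  assumes "square_integrable v" "\<phi> \<in> test_functions" "\<psi> \<in> test_functions"
  shows "fourier_pairing v (\<lambda>x. \<phi> x + \<psi> x) = fourier_pairing v \<phi> + fourier_pairing v \<psi>"
  using square_integrable_pairing(1)[OF assms(1,2)] square_integrable_pairing(1)[OF assms(1,3)] assms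
  by (simp add: fourier_pairing_def distr_of_def fourier_add test_functions_integrable distrib_left)

lemma test_functions_zero: "(\<lambda>x. 0) \<in> test_functions"
  by (auto simp: test_functions_def smooth_const)

lemma test_functions_sum:
  assumes "finite A" "\<And>j. j \<in> A \<Longrightarrow> \<phi> j \<in> test_functions"
  shows "(\<lambda>x. \<Sum>j\<in>A. \<phi> j x) \<in> test_functions"
  using assms by induction (auto intro: test_functions_zero test_functions_add)

lemma fourier_pairing_sum:
  assumes "square_integrable v" "finite A" "\<And>j. j \<in> A \<Longrightarrow> \<phi> j \<in> test_functions"
  shows "fourier_pairing v (\<lambda>x. \<Sum>j\<in>A. \<phi> j x) = (\<Sum>j\<in>A. fourier_pairing v (\<phi> j))"
  using assms(2,3)
proof induction
  case empty
  then show ?case using fourier_pairing_cmult[of v 0 "\<lambda>x. 0"] by simp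
next
  case (insert j A)
  then show ?case
    by (simp add: fourier_pairing_add[OF assms(1)] test_functions_sum)
qed

lemma fourier_pairing_diff:
  assumes "square_integrable v" "square_integrable w" "\<phi> \<in> test_functions"
  shows "fourier_pairing (\<lambda>x. v x - w x) \<phi> = fourier_pairing v \<phi> - fourier_pairing w \<phi>"
  using square_integrable_pairing(1)[OF assms(1,3)] square_integrable_pairing(1)[OF assms(2,3)]
  by (simp add: fourier_pairing_def distr_of_def left_diff_distrib)

section \<open>The linear part\<close>

text \<open>A multiplier is defined through the inverse transform of its argument, which inversion
removes.\<close>

lemma fourier_multiplier_fourier:
  "\<phi> \<in> test_functions \<Longrightarrow>
    fourier_multiplier m T (fourier \<phi>) = T (fourier (\<lambda>\<xi>. complex_of_real (m \<xi>) * \<phi> \<xi>))"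
  by (simp add: fourier_multiplier_def inv_fourier_distr_def mult_distr_def fourier_distr_def inv_fourier_fourier)

text \<open>The symbol of \<open>-\<Delta>P\<close>.\<close>

definition dissipation :: "real^'n::finite \<Rightarrow> real" where
  "dissipation \<xi> = (norm \<xi>)\<^sup>2 / (1 + (norm \<xi>)\<^sup>2)"

lemma smooth_bessel_symbol: "smooth (\<lambda>\<xi>::real^'n. 1 / (1 + (norm \<xi>)\<^sup>2))"
proof -
  have "smooth (\<lambda>\<xi>::real^'n. inverse (1 + (norm \<xi>)\<^sup>2))"
    by (intro smooth_inverse smooth_add smooth_const smooth_norm_power2)
      (metis add_pos_nonneg less_irrefl zero_le_power2 zero_less_one)
  then show ?thesis by (simp add: inverse_eq_divide)
qed

lemma smooth_dissipation: "smooth (dissipation :: real^'n \<Rightarrow> real)"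
proof -
  have "smooth (\<lambda>\<xi>::real^'n. (norm \<xi>)\<^sup>2 * (1 / (1 + (norm \<xi>)\<^sup>2)))"
    by (intro smooth_mult smooth_norm_power2 smooth_bessel_symbol)
  then show ?thesis
    by (simp add: dissipation_def[abs_def])
qed

lemma dissipation_bounds: "0 \<le> dissipation \<xi>" "dissipation \<xi> \<le> 1" "dissipation \<xi> \<le> (norm \<xi>)\<^sup>2"
proof -
  have "0 < 1 + (norm \<xi>)\<^sup>2"
    by (simp add: add_pos_nonneg)
  then show "0 \<le> dissipation \<xi>" "dissipation \<xi> \<le> 1" "dissipation \<xi> \<le> (norm \<xi>)\<^sup>2"
    by (auto simp: dissipation_def field_simps)
qed

text \<open>Two derivatives in the coordinate \<open>j\<close> multiply \<open>\<phi>\<close> by \<open>-\<xi>\<^sub>j\<^sup>2\<close>, and \<open>P\<close> multiplies it by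
\<open>1 / (1 + |\<xi>|\<^sup>2)\<close>; the sum over the coordinates is the dissipation up to its sign.\<close>

lemma laplacian_P_op_pairing:
  fixes v :: "real^'n \<Rightarrow> real"
  assumes v: "square_integrable v" and \<phi>: "\<phi> \<in> test_functions"
  shows "laplacian_distr (P_op (distr_of (cfun v))) (fourier \<phi>)
    = - fourier_pairing v (\<lambda>\<xi>. complex_of_real (dissipation \<xi>) * \<phi> \<xi>)"
proof -
  let ?q = "\<lambda>\<xi>::real^'n. complex_of_real (1 / (1 + (norm \<xi>)\<^sup>2))"
  define \<psi> where "\<psi> = (\<lambda>j (\<xi>::real^'n). - \<i> * complex_of_real (\<xi> $ j) * (- \<i> * complex_of_real (\<xi> $ j) * \<phi> \<xi>))"
  have \<psi>: "\<psi> j \<in> test_functions" for j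
    unfolding \<psi>_def by (intro test_functions_coordinate \<phi>)
  have q\<psi>: "(\<lambda>\<xi>. ?q \<xi> * \<psi> j \<xi>) \<in> test_functions" for j
    by (rule test_functions_mult_smooth[OF smooth_of_real[OF smooth_bessel_symbol] \<psi>])
  have second: "partial_deriv j (partial_deriv j (fourier \<phi>)) = fourier (\<psi> j)" for j
    unfolding \<psi>_def by (simp only: partial_deriv_fourier test_functions_coordinate \<phi>)
  have "laplacian_distr (P_op (distr_of (cfun v))) (fourier \<phi>)
      = (\<Sum>j\<in>UNIV. P_op (distr_of (cfun v)) (fourier (\<psi> j)))"
    by (simp add: laplacian_distr_def partial_distr_def second)
  also have "\<dots> = (\<Sum>j\<in>UNIV. fourier_pairing v (\<lambda>\<xi>. ?q \<xi> * \<psi> j \<xi>))"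
    unfolding P_op_def fourier_pairing_def by (simp only: fourier_multiplier_fourier[OF \<psi>])
  also have "\<dots> = fourier_pairing v (\<lambda>\<xi>. \<Sum>j\<in>UNIV. ?q \<xi> * \<psi> j \<xi>)"
    by (rule fourier_pairing_sum[OF v finite q\<psi>, symmetric])
  also have "(\<lambda>\<xi>. \<Sum>j\<in>UNIV. ?q \<xi> * \<psi> j \<xi>) = (\<lambda>\<xi>. - 1 * (complex_of_real (dissipation \<xi>) * \<phi> \<xi>))"
  proof
    fix \<xi> :: "real^'n"
    have n: "(norm \<xi>)\<^sup>2 = (\<Sum>j\<in>UNIV. \<xi> $ j * \<xi> $ j)"
      by (simp add: power2_norm_eq_inner inner_vec_def)
    have "(\<Sum>j\<in>UNIV. ?q \<xi> * \<psi> j \<xi>) = (\<Sum>j\<in>UNIV. - (?q \<xi> * \<phi> \<xi>) * complex_of_real (\<xi> $ j * \<xi> $ j))"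
      by (rule sum.cong) (auto simp: \<psi>_def algebra_simps)
    also have "\<dots> = - (?q \<xi> * \<phi> \<xi>) * complex_of_real ((norm \<xi>)\<^sup>2)"
      unfolding n by (simp add: sum_distrib_left)
    finally show "(\<Sum>j\<in>UNIV. ?q \<xi> * \<psi> j \<xi>) = - 1 * (complex_of_real (dissipation \<xi>) * \<phi> \<xi>)"
      by (simp add: dissipation_def)
  qed
  finally show ?thesis
    unfolding fourier_pairing_cmult by simp
qed

section \<open>The nonlinear part\<close>

text \<open>The divergence contributes the factor \<open>b \<bullet> \<xi>\<close>, which is small at low frequencies, and the transform
of \<open>v\<^sup>2\<close> is bounded by the integral of \<open>v\<^sup>2\<close>.\<close>

lemma div_distr_quadratic_bound:
  fixes v :: "real^'n \<Rightarrow> real"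
  assumes v: "square_integrable v" and \<phi>: "\<phi> \<in> test_functions"
  shows "norm (div_distr (\<lambda>x. (v x)\<^sup>2 *\<^sub>R b) (fourier \<phi>))
    \<le> (L2_norm v)\<^sup>2 * (norm b * (\<integral>\<xi>. norm \<xi> * norm (\<phi> \<xi>) \<partial>lborel))"
proof -
  have [measurable]: "v \<in> borel_measurable borel" and v2: "integrable lborel (\<lambda>x. (v x)\<^sup>2)"
    using v by (auto simp: square_integrable_def)
  define \<psi> where "\<psi> = (\<lambda>j (\<xi>::real^'n). - \<i> * complex_of_real (\<xi> $ j) * \<phi> \<xi>)"
  have \<psi>: "\<psi> j \<in> test_functions" for j
    unfolding \<psi>_def by (intro test_functions_coordinate \<phi>)
  define I where "I = (\<integral>\<xi>. norm \<xi> * norm (\<phi> \<xi>) \<partial>lborel)"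
  have intI: "integrable lborel (\<lambda>\<xi>. norm \<xi> * norm (\<phi> \<xi>))"
    using test_functions_weighted_integrable[OF \<phi>, of norm 1] by (simp add: continuous_intros)
  have I0: "0 \<le> I"
    by (simp add: I_def)
  define G where "G = (\<lambda>x. \<Sum>j\<in>UNIV. complex_of_real (b $ j) * fourier (\<psi> j) x)"
  have [measurable]: "fourier (\<psi> j) \<in> borel_measurable borel" for j
    using smooth_imp_measurable[OF fourier_smooth[OF \<psi>]] .
  have int: "integrable lborel (\<lambda>x. complex_of_real ((v x)\<^sup>2) * (complex_of_real (b $ j) * fourier (\<psi> j) x))" for j
  proof (rule Bochner_Integration.integrable_bound)
    show "integrable lborel (\<lambda>x. (v x)\<^sup>2 * (\<bar>b $ j\<bar> * (\<integral>\<xi>. norm (\<psi> j \<xi>) \<partial>lborel)))"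
      using v2 by simp
    have "norm (complex_of_real ((v x)\<^sup>2) * (complex_of_real (b $ j) * fourier (\<psi> j) x))
        \<le> (v x)\<^sup>2 * (\<bar>b $ j\<bar> * (\<integral>\<xi>. norm (\<psi> j \<xi>) \<partial>lborel))" for x
      unfolding norm_mult norm_of_real by (intro mult_mono mult_left_mono norm_fourier_le) auto
    then show "AE x in lborel. norm (complex_of_real ((v x)\<^sup>2) * (complex_of_real (b $ j) * fourier (\<psi> j) x))
        \<le> norm ((v x)\<^sup>2 * (\<bar>b $ j\<bar> * (\<integral>\<xi>. norm (\<psi> j \<xi>) \<partial>lborel)))"
      by (intro AE_I2) (auto intro: order_trans[OF _ abs_ge_self])
  qed measurable
  have "div_distr (\<lambda>x. (v x)\<^sup>2 *\<^sub>R b) (fourier \<phi>)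
      = - (\<Sum>j\<in>UNIV. \<integral>x. complex_of_real ((v x)\<^sup>2) * (complex_of_real (b $ j) * fourier (\<psi> j) x) \<partial>lborel)"
    by (simp add: div_distr_def partial_distr_def distr_of_def partial_deriv_fourier[OF \<phi>] \<psi>_def sum_negf mult.assoc)
  also have "\<dots> = - (\<integral>x. complex_of_real ((v x)\<^sup>2) * G x \<partial>lborel)"
    unfolding G_def sum_distrib_left using int by (subst Bochner_Integration.integral_sum) auto
  finally have eq: "norm (div_distr (\<lambda>x. (v x)\<^sup>2 *\<^sub>R b) (fourier \<phi>)) = norm (\<integral>x. complex_of_real ((v x)\<^sup>2) * G x \<partial>lborel)"
    by simp
  have G: "norm (G x) \<le> norm b * I" for x
  proof -
    have Gx: "G x = fourier (\<lambda>\<xi>. - \<i> * complex_of_real (\<xi> \<bullet> b) * \<phi> \<xi>) x"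
    proof -
      have "G x = (\<Sum>j\<in>UNIV. \<integral>\<xi>. complex_of_real (b $ j) * (cis (- (\<xi> \<bullet> x)) * \<psi> j \<xi>) \<partial>lborel)"
        by (simp add: G_def fourier_def)
      also have "\<dots> = (\<integral>\<xi>. (\<Sum>j\<in>UNIV. complex_of_real (b $ j) * (cis (- (\<xi> \<bullet> x)) * \<psi> j \<xi>)) \<partial>lborel)"
        by (rule Bochner_Integration.integral_sum[symmetric])
          (intro integrable_mult_right integrable_cis_mult test_functions_integrable \<psi>, simp)
      also have "\<dots> = (\<integral>\<xi>. cis (- (\<xi> \<bullet> x)) * (- \<i> * complex_of_real (\<xi> \<bullet> b) * \<phi> \<xi>) \<partial>lborel)"
        by (rule Bochner_Integration.integral_cong)
          (auto simp: \<psi>_def inner_vec_def sum_distrib_left sum_distrib_right mult_ac)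
      finally show ?thesis
        by (simp add: fourier_def)
    qed
    have "norm (G x) \<le> (\<integral>\<xi>. norm (- \<i> * complex_of_real (\<xi> \<bullet> b) * \<phi> \<xi>) \<partial>lborel)"
      unfolding Gx by (rule norm_fourier_le)
    also have "\<dots> \<le> (\<integral>\<xi>. norm b * (norm \<xi> * norm (\<phi> \<xi>)) \<partial>lborel)"
    proof (rule integral_mono')
      show "integrable lborel (\<lambda>\<xi>. norm b * (norm \<xi> * norm (\<phi> \<xi>)))"
        by (intro integrable_mult_right intI)
      show "norm (- \<i> * complex_of_real (\<xi> \<bullet> b) * \<phi> \<xi>) \<le> norm b * (norm \<xi> * norm (\<phi> \<xi>))" for \<xi>
        using mult_right_mono[OF Cauchy_Schwarz_ineq2[of \<xi> b] norm_ge_zero[of "\<phi> \<xi>"]]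
        by (simp add: norm_mult mult_ac)
    qed simp
    finally show ?thesis by (simp add: I_def)
  qed
  have "norm (\<integral>x. complex_of_real ((v x)\<^sup>2) * G x \<partial>lborel) \<le> (\<integral>x. (v x)\<^sup>2 * (norm b * I) \<partial>lborel)"
  proof (rule order_trans[OF integral_norm_bound integral_mono'])
    show "integrable lborel (\<lambda>x. (v x)\<^sup>2 * (norm b * I))"
      using v2 by simp
    show "norm (complex_of_real ((v x)\<^sup>2) * G x) \<le> (v x)\<^sup>2 * (norm b * I)" for x
      unfolding norm_mult norm_of_real using G[of x] by (simp add: mult_left_mono)
  qed (use I0 in simp)
  also have "\<dots> = (L2_norm v)\<^sup>2 * (norm b * I)"
    by (simp add: L2_norm_def)
  finally show ?thesis
    unfolding eq I_def .
qed

section \<open>Weak continuity at the initial time\<close>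

lemma besov_term_le_besov21_norm: "besov_term chi s T k \<le> besov21_norm chi s T"
proof -
  have "infsum (besov_term chi s T) {k} \<le> infsum (besov_term chi s T) UNIV"
    by (rule infsum_mono_neutral) (auto intro: nonneg_summable_on_complete)
  then show ?thesis
    by (simp add: besov21_norm_def)
qed

text \<open>As \<^const>\<open>distr_L2_norm\<close> is an infimum, some square integrable representative has norm below
any strict upper bound.\<close>

lemma distr_L2_norm_pairing:
  assumes "distr_L2_norm T < ennreal e" "\<psi> \<in> schwartz" "\<psi> \<in> borel_measurable borel"
    "integrable lborel (\<lambda>x. (norm (\<psi> x))\<^sup>2)"
  shows "norm (T \<psi>) \<le> e * L2_norm \<psi>"
proof -
  obtain g where g: "square_integrable g" "T \<psi> = distr_of g \<psi>" "ennreal (L2_norm g) < ennreal e"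
    using assms(1,2) unfolding distr_L2_norm_def INF_less_iff by blast
  have "norm (distr_of g \<psi>) \<le> L2_norm g * L2_norm \<psi>"
    unfolding distr_of_def L2_norm_def using g(1) assms(3,4)
    by (intro integral_Cauchy_Schwarz) (auto simp: square_integrable_def)
  also have "\<dots> \<le> e * L2_norm \<psi>"
    using g(3) L2_norm_nonneg[of g] by (intro mult_right_mono L2_norm_nonneg) (simp add: ennreal_less_iff)
  finally show ?thesis
    using g(2) by simp
qed

lemma lp_phi_smooth: "lp_cutoff chi \<Longrightarrow> smooth (\<lambda>\<xi>. complex_of_real (lp_phi chi (c *\<^sub>R \<xi>)))"
  unfolding lp_phi_def lp_cutoff_def scaleR_scaleR
  by (intro smooth_of_real smooth_diff smooth_scaled_argument) auto

lemma sum_telescope_int: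
  fixes c :: "int \<Rightarrow> 'a::ab_group_add"
  shows "(\<Sum>k\<in>{- int N..int N}. c (k + 1) - c k) = c (int N + 1) - c (- int N)"
proof (induction N)
  case (Suc N)
  have set: "{- int (Suc N)..int (Suc N)} = insert (- int N - 1) (insert (int N + 1) {- int N..int N})"
    by auto
  have ends: "- int (Suc N) = - int N - 1" "int (Suc N) + 1 = int N + 1 + 1" "- int N - 1 + 1 = - int N"
    by simp_all
  have insert: "(\<Sum>k\<in>insert (- int N - 1) (insert (int N + 1) {- int N..int N}). h k)
      = h (- int N - 1) + (h (int N + 1) + (\<Sum>k\<in>{- int N..int N}. h k))" for h :: "int \<Rightarrow> 'a"
    by (subst sum.insert, simp, simp, subst sum.insert) auto
  show ?case
    unfolding set insert ends(2,3) Suc unfolding ends(1) by simp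
qed simp

lemma lp_phi_telescope:
  "(\<Sum>k\<in>{- int N..int N}. lp_phi chi ((2 powi (- k)) *\<^sub>R \<xi>))
    = chi ((2 powi (- int (Suc N))) *\<^sub>R \<xi>) - chi ((2 powi (int N)) *\<^sub>R \<xi>)"
proof -
  define c where "c = (\<lambda>k. chi ((2 powi (- k)) *\<^sub>R \<xi>))"
  have "(1/2::real) * 2 powi (- k) = 2 powi (- (k + 1))" for k
    using power_int_diff[of "2::real" "- k" 1] by simp
  then have "lp_phi chi ((2 powi (- k)) *\<^sub>R \<xi>) = c (k + 1) - c k" for k
    by (simp only: lp_phi_def c_def scaleR_scaleR)
  then show ?thesis
    using sum_telescope_int[of c N] by (simp add: c_def add.commute)
qed

text \<open>Convergence in the Besov norm gives convergence of each Littlewood--Paley block in \<open>L\<^sup>2\<close>, and hence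
of the pairings with finitely many pieces of \<open>\<phi>\<close>. The rest of \<open>\<phi>\<close>, near frequency zero and near infinity,
is small in \<open>L\<^sup>2\<close>, and the uniform bound \<open>M\<close> controls the pairing with it for all times at once.\<close>

lemma weakly_continuous_at_0:
  fixes u :: "real \<Rightarrow> real^'n \<Rightarrow> real"
  assumes chi: "lp_cutoff chi"
    and sq: "\<And>t. 0 \<le> t \<Longrightarrow> square_integrable (u t)"
    and M: "\<And>t. 0 \<le> t \<Longrightarrow> L2_norm (u t) \<le> M"
    and cont: "continuous_in_besov21 chi s u"
    and \<phi>: "\<phi> \<in> test_functions"
  shows "((\<lambda>\<tau>. fourier_pairing (u \<tau>) \<phi>) \<longlongrightarrow> fourier_pairing (u 0) \<phi>) (at 0 within {0..})"
proof -
  let ?F = "at (0::real) within {0..}"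
  define D where "D = (\<lambda>\<tau> \<psi>. fourier_pairing (u \<tau>) \<psi> - fourier_pairing (u 0) \<psi>)"
  define p where "p = (\<lambda>k (\<xi>::real^'n). complex_of_real (lp_phi chi ((2 powi (- k)) *\<^sub>R \<xi>)) * \<phi> \<xi>)"
  have p: "p k \<in> test_functions" for k
    unfolding p_def by (intro test_functions_mult_smooth lp_phi_smooth chi \<phi>)
  have ev0: "eventually (\<lambda>\<tau>. 0 \<le> \<tau>) ?F"
    by (auto simp: eventually_at_filter)
  have F: "fourier \<phi> \<in> schwartz" "fourier \<phi> \<in> borel_measurable borel" "integrable lborel (\<lambda>x. (norm (fourier \<phi> x))\<^sup>2)"
    using fourier_schwartz fourier_square_integrable smooth_imp_measurable[OF fourier_smooth] \<phi> by auto
  have block: "((\<lambda>\<tau>. D \<tau> (p k)) \<longlongrightarrow> 0) ?F" for k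
  proof (rule tendstoI)
    fix e :: real assume e: "0 < e"
    define e' where "e' = e / (L2_norm (fourier \<phi>) + 1)"
    have e': "0 < e'" "e' * L2_norm (fourier \<phi>) < e"
      using e L2_norm_nonneg[of "fourier \<phi>"] by (auto simp: e'_def field_simps)
    define c where "c = 2 powr (real_of_int k * s)"
    have c: "0 < c" by (simp add: c_def)
    have "((\<lambda>\<tau>. besov21_norm chi s (distr_of (cfun (\<lambda>x. u \<tau> x - u 0 x)))) \<longlongrightarrow> 0) ?F"
      using cont by (simp add: continuous_in_besov21_def)
    then have "eventually (\<lambda>\<tau>. besov21_norm chi s (distr_of (cfun (\<lambda>x. u \<tau> x - u 0 x))) < ennreal (c * e')) ?F"
      using c e' by (intro order_tendstoD) auto
    then show "eventually (\<lambda>\<tau>. dist (D \<tau> (p k)) 0 < e) ?F"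
      using ev0
    proof eventually_elim
      case (elim \<tau>)
      let ?T = "distr_of (cfun (\<lambda>x. u \<tau> x - u 0 x))"
      have "ennreal c * distr_L2_norm (lp_block chi k ?T) < ennreal c * ennreal e'"
        using le_less_trans[OF besov_term_le_besov21_norm elim(1), of k] c e'
        by (simp add: besov_term_def c_def ennreal_mult'')
      then have "distr_L2_norm (lp_block chi k ?T) < ennreal e'"
        by (meson linorder_not_le mult_left_mono zero_le)
      then have "norm (lp_block chi k ?T (fourier \<phi>)) \<le> e' * L2_norm (fourier \<phi>)"
        by (rule distr_L2_norm_pairing) (use F in auto)
      also have "lp_block chi k ?T (fourier \<phi>) = D \<tau> (p k)"
        unfolding lp_block_def fourier_multiplier_fourier[OF \<phi>] D_def
        using fourier_pairing_diff[OF sq sq p, of \<tau> 0 k] elim(2)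
        by (simp add: fourier_pairing_def p_def)
      finally show ?case
        using e' by simp
    qed
  qed
  define tail where "tail = (\<lambda>N (\<xi>::real^'n). complex_of_real (1 - (chi ((2 powi (- int (Suc N))) *\<^sub>R \<xi>) - chi ((2 powi (int N)) *\<^sub>R \<xi>))) * \<phi> \<xi>)"
  have tail: "tail N \<in> test_functions" for N
    unfolding tail_def using chi
    by (intro test_functions_mult_smooth smooth_of_real smooth_diff smooth_const smooth_scaled_argument \<phi>)
      (auto simp: lp_cutoff_def)
  \<comment> \<open>The blocks telescope, so the remainder carries the cutoff at both ends of the frequency range.\<close>
  have split: "\<phi> = (\<lambda>\<xi>. (\<Sum>k\<in>{- int N..int N}. p k \<xi>) + tail N \<xi>)" for N
  proof
    fix \<xi>
    have "(\<Sum>k\<in>{- int N..int N}. p k \<xi>) = complex_of_real (\<Sum>k\<in>{- int N..int N}. lp_phi chi ((2 powi (- k)) *\<^sub>R \<xi>)) * \<phi> \<xi>"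
      by (simp add: p_def sum_distrib_right)
    then show "\<phi> \<xi> = (\<Sum>k\<in>{- int N..int N}. p k \<xi>) + tail N \<xi>"
      unfolding lp_phi_telescope tail_def by (simp add: algebra_simps)
  qed
  have D_split: "D \<tau> \<phi> = (\<Sum>k\<in>{- int N..int N}. D \<tau> (p k)) + D \<tau> (tail N)" if "0 \<le> \<tau>" for \<tau> N
  proof -
    have "fourier_pairing (u t) \<phi> = (\<Sum>k\<in>{- int N..int N}. fourier_pairing (u t) (p k)) + fourier_pairing (u t) (tail N)"
      if "0 \<le> t" for t
      by (subst split[of N], subst fourier_pairing_add[OF sq[OF that] test_functions_sum tail])
        (auto simp: p fourier_pairing_sum[OF sq[OF that]])
    from this[OF that] this[of 0] show ?thesis
      by (simp add: D_def sum_subtractf)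
  qed
  have D_bound: "norm (D \<tau> \<psi>) \<le> 2 * M * plancherel_const TYPE('n) * L2_norm \<psi>" if "0 \<le> \<tau>" and \<psi>: "\<psi> \<in> test_functions" for \<tau> \<psi>
  proof -
    have "norm (fourier_pairing (u t) \<psi>) \<le> M * (plancherel_const TYPE('n) * L2_norm \<psi>)" if t: "0 \<le> t" for t
      by (rule order_trans[OF fourier_pairing_bound[OF sq[OF t] \<psi>]])
        (intro mult_right_mono M t mult_nonneg_nonneg less_imp_le[OF plancherel_const_pos] L2_norm_nonneg)
    from this[OF \<open>0 \<le> \<tau>\<close>] this[of 0] show ?thesis
      unfolding D_def using norm_triangle_ineq4[of "fourier_pairing (u \<tau>) \<psi>" "fourier_pairing (u 0) \<psi>"] by simp
  qed
  have tail_lim: "(\<lambda>N. L2_norm (tail N)) \<longlonglongrightarrow> 0"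
  proof -
    have chi01: "0 \<le> chi x" "chi x \<le> 1" for x
      using chi unfolding lp_cutoff_def by (meson atLeastAtMost_iff rangeI subsetD)+
    have [measurable]: "\<phi> \<in> borel_measurable borel" "tail N \<in> borel_measurable borel" for N
      using \<phi> tail smooth_imp_measurable by blast+
    have "(\<lambda>N. \<integral>\<xi>. (norm (tail N \<xi>))\<^sup>2 \<partial>lborel) \<longlonglongrightarrow> (\<integral>\<xi>. 0 \<partial>(lborel :: (real^'n) measure))"
    proof (rule integral_dominated_convergence[where w = "\<lambda>\<xi>. 4 * (norm (\<phi> \<xi>))\<^sup>2"])
      show "integrable lborel (\<lambda>\<xi>. 4 * (norm (\<phi> \<xi>))\<^sup>2)"
        using test_functions_weighted_integrable[OF \<phi>, of "\<lambda>x. 4" 2] by simp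
      have "norm (tail N \<xi>) \<le> 2 * norm (\<phi> \<xi>)" for N \<xi>
        unfolding tail_def norm_mult norm_of_real
        using chi01[of "2 powi - int (Suc N) *\<^sub>R \<xi>"] chi01[of "2 powi int N *\<^sub>R \<xi>"]
        by (intro mult_right_mono) auto
      from power_mono[OF this, where n = 2] show "AE \<xi> in lborel. norm ((norm (tail N \<xi>))\<^sup>2) \<le> 4 * (norm (\<phi> \<xi>))\<^sup>2" for N
        by (simp add: power_mult_distrib)
      have "(\<lambda>N. (norm (tail N \<xi>))\<^sup>2) \<longlonglongrightarrow> 0" if "\<xi> \<noteq> 0" for \<xi>
      proof (rule tendsto_eventually)
        have "((\<lambda>N. inverse (2 ^ Suc N) * norm \<xi>) \<longlonglongrightarrow> 0 * norm \<xi>)"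
          by (intro tendsto_intros LIMSEQ_Suc LIMSEQ_inverse_realpow_zero) auto
        then have 1: "eventually (\<lambda>N. inverse (2 ^ Suc N) * norm \<xi> < 3/4) sequentially"
          by (rule order_tendstoD) simp
        obtain N\<^sub>0 where "4 / 3 / norm \<xi> < 2 ^ N\<^sub>0"
          using real_arch_pow[of 2 "4 / 3 / norm \<xi>"] by auto
        then have N\<^sub>0: "4 / 3 < 2 ^ N\<^sub>0 * norm \<xi>"
          using that by (simp add: divide_less_eq)
        have 2: "eventually (\<lambda>N. 4/3 \<le> 2 ^ N * norm \<xi>) sequentially"
        proof (rule eventually_sequentiallyI[of N\<^sub>0])
          fix N assume "N\<^sub>0 \<le> N"
          then have "(2::real) ^ N\<^sub>0 * norm \<xi> \<le> 2 ^ N * norm \<xi>"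
            by (intro mult_right_mono power_increasing) auto
          with N\<^sub>0 show "4/3 \<le> 2 ^ N * norm \<xi>"
            by linarith
        qed
        \<comment> \<open>For fixed \<open>\<xi> \<noteq> 0\<close> both cutoffs are eventually constant, and the remainder vanishes.\<close>
        from 1 2 show "eventually (\<lambda>N. (norm (tail N \<xi>))\<^sup>2 = 0) sequentially"
        proof eventually_elim
          case (elim N)
          have "chi ((2 powi (- int (Suc N))) *\<^sub>R \<xi>) = 1"
            using elim(1) chi by (auto simp: lp_cutoff_def power_int_minus simp del: power_Suc of_nat_Suc)
          moreover have "chi ((2 powi (int N)) *\<^sub>R \<xi>) = 0"
            using elim(2) chi by (auto simp: lp_cutoff_def)
          ultimately show ?case
            by (simp add: tail_def)
        qed
      qed
      moreover have "AE \<xi> in lborel. \<xi> \<noteq> (0 :: real^'n)"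
        by (rule AE_lborel_singleton)
      ultimately show "AE \<xi> in lborel. (\<lambda>N. (norm (tail N \<xi>))\<^sup>2) \<longlonglongrightarrow> 0"
        by auto
    qed measurable
    from tendsto_real_sqrt[OF this] show ?thesis
      by (simp add: L2_norm_def)
  qed
  have "((\<lambda>\<tau>. D \<tau> \<phi>) \<longlongrightarrow> 0) ?F"
  proof (rule tendstoI)
    fix e :: real assume e: "0 < e"
    have "(\<lambda>N. 2 * M * plancherel_const TYPE('n) * L2_norm (tail N)) \<longlonglongrightarrow> 2 * M * plancherel_const TYPE('n) * 0"
      by (intro tendsto_intros tail_lim)
    then have "eventually (\<lambda>N. 2 * M * plancherel_const TYPE('n) * L2_norm (tail N) < e / 2) sequentially"
      using e by (intro order_tendstoD) auto
    then obtain N where N: "2 * M * plancherel_const TYPE('n) * L2_norm (tail N) < e / 2"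
      by (auto simp: eventually_sequentially)
    have "((\<lambda>\<tau>. \<Sum>k\<in>{- int N..int N}. D \<tau> (p k)) \<longlongrightarrow> (\<Sum>k\<in>{- int N..int N}. 0)) ?F"
      by (intro tendsto_sum block)
    then have "eventually (\<lambda>\<tau>. dist (\<Sum>k\<in>{- int N..int N}. D \<tau> (p k)) 0 < e / 2) ?F"
      using e by (intro tendstoD) auto
    then show "eventually (\<lambda>\<tau>. dist (D \<tau> \<phi>) 0 < e) ?F"
      using ev0
    proof eventually_elim
      case (elim \<tau>)
      have "norm (D \<tau> \<phi>) \<le> norm (\<Sum>k\<in>{- int N..int N}. D \<tau> (p k)) + norm (D \<tau> (tail N))"
        unfolding D_split[OF elim(2), of N] by (rule norm_triangle_ineq)
      then show ?case
        using elim(1) N D_bound[OF elim(2) tail[of N]] by simp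
    qed
  qed
  then show ?thesis
    by (simp add: D_def LIM_zero_iff)
qed

section \<open>Duhamel's formula\<close>

lemma abs_exp_minus_linear_le:
  fixes x :: real assumes "\<bar>x\<bar> \<le> 1" shows "\<bar>exp x - 1 - x\<bar> \<le> x\<^sup>2"
proof -
  have "exp x \<le> 1 + x + x\<^sup>2"
  proof (cases "0 \<le> x")
    case True
    then show ?thesis using exp_bound[of x] assms by simp
  next
    case False
    have "exp x = inverse (exp (- x))"
      by (simp add: exp_minus)
    also have "\<dots> \<le> inverse (1 - x)"
      using False exp_ge_add_one_self[of "- x"] by (intro le_imp_inverse_le) auto
    also have "\<dots> \<le> 1 + x + x\<^sup>2"
    proof -
      have "1 \<le> (1 + x + x\<^sup>2) * (1 - x)"
      proof -
        have "(1 + x + x\<^sup>2) * (1 - x) = 1 + x\<^sup>2 * (- x)"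
          by (simp add: algebra_simps power2_eq_square)
        then show ?thesis using False by (simp add: mult_nonneg_nonpos)
      qed
      then show ?thesis using False by (simp add: field_simps)
    qed
    finally show ?thesis .
  qed
  then show ?thesis
    using exp_ge_add_one_self[of x] zero_le_power2[of x] by linarith
qed

text \<open>The test function is carried backwards along the linear flow: \<open>P s\<close> is \<open>exp (-(t - s) m) \<phi>\<close>, where
\<open>m\<close> is the dissipation. In the
derivative of \<open>Z s\<close>, the pairing of \<open>u(s)\<close> with \<open>P s\<close>, the motion of \<open>P\<close> cancels the linear part of the equation, and
only the nonlinear part remains. Its bound integrates to \<open>K ln (1 + t)\<close>.\<close>

lemma Duhamel_estimate:
  fixes u :: "real \<Rightarrow> real^'n \<Rightarrow> real" and N :: "real \<Rightarrow> (real^'n \<Rightarrow> complex) \<Rightarrow> complex"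
  assumes sq: "\<And>t. 0 \<le> t \<Longrightarrow> square_integrable (u t)"
    and M: "\<And>t. 0 \<le> t \<Longrightarrow> L2_norm (u t) \<le> M"
    and cont0: "\<And>\<phi>. \<phi> \<in> test_functions \<Longrightarrow>
      ((\<lambda>\<tau>. fourier_pairing (u \<tau>) \<phi>) \<longlongrightarrow> fourier_pairing (u 0) \<phi>) (at 0 within {0..})"
    and ode: "\<And>s \<phi>. 0 < s \<Longrightarrow> \<phi> \<in> test_functions \<Longrightarrow>
      ((\<lambda>\<tau>. fourier_pairing (u \<tau>) \<phi>) has_vector_derivative
        - fourier_pairing (u s) (\<lambda>\<xi>. complex_of_real (dissipation \<xi>) * \<phi> \<xi>) - N s \<phi>) (at s)"
    and N: "\<And>s \<phi>. 0 < s \<Longrightarrow> \<phi> \<in> test_functions \<Longrightarrow>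
      norm (N s \<phi>) \<le> K / (1 + s) * (\<integral>\<xi>. norm \<xi> * norm (\<phi> \<xi>) \<partial>lborel)"
    and K: "0 \<le> K" and t: "0 < t" and \<phi>: "\<phi> \<in> test_functions"
  shows "norm (fourier_pairing (u t) \<phi>
      - fourier_pairing (u 0) (\<lambda>\<xi>. complex_of_real (exp (- t * dissipation \<xi>)) * \<phi> \<xi>))
    \<le> K * ln (1 + t) * (\<integral>\<xi>. norm \<xi> * norm (\<phi> \<xi>) \<partial>lborel)"
proof -
  let ?Q = "plancherel_const TYPE('n)"
  define P where "P = (\<lambda>s (\<xi>::real^'n). complex_of_real (exp (- (t - s) * dissipation \<xi>)) * \<phi> \<xi>)"
  define mP where "mP = (\<lambda>s \<xi>. complex_of_real (dissipation \<xi>) * P s \<xi>)"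
  define \<rho> where "\<rho> = (\<lambda>s \<tau> \<xi>. complex_of_real (exp ((\<tau> - s) * dissipation \<xi>) - 1 - (\<tau> - s) * dissipation \<xi>) * P s \<xi>)"
  define Z where "Z = (\<lambda>s. fourier_pairing (u s) (P s))"
  have smooth_exp_diss: "smooth (\<lambda>\<xi>::real^'n. exp (c * dissipation \<xi>))" for c
    by (intro smooth_exp smooth_mult smooth_const smooth_dissipation)
  have P: "P s \<in> test_functions" for s
    unfolding P_def by (intro test_functions_mult_smooth smooth_of_real smooth_exp_diss \<phi>)
  have mP: "mP s \<in> test_functions" for s
    unfolding mP_def by (intro test_functions_mult_smooth smooth_of_real smooth_dissipation P)
  have \<rho>: "\<rho> s \<tau> \<in> test_functions" for s \<tau>
    unfolding \<rho>_def
    by (intro test_functions_mult_smooth smooth_of_real smooth_diff smooth_mult smooth_const smooth_dissipation smooth_exp_diss P)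
  have M0: "0 \<le> M"
    using order_trans[OF L2_norm_nonneg M[of 0]] by simp
  \<comment> \<open>Expansion of \<open>P \<tau>\<close> at \<open>s\<close>: since \<open>u\<close> is differentiable only against fixed test functions, the two sources of time dependence have to be separated.\<close>
  have expand: "Z \<tau> = fourier_pairing (u \<tau>) (P s) + (\<tau> - s) *\<^sub>R fourier_pairing (u \<tau>) (mP s) + fourier_pairing (u \<tau>) (\<rho> s \<tau>)"
    if \<tau>: "0 \<le> \<tau>" for s \<tau>
  proof -
    have eq: "P \<tau> = (\<lambda>\<xi>. (P s \<xi> + complex_of_real (\<tau> - s) * mP s \<xi>) + \<rho> s \<tau> \<xi>)"
    proof
      fix \<xi> :: "real^'n"
      have e: "exp (- (t - \<tau>) * dissipation \<xi>) = exp ((\<tau> - s) * dissipation \<xi>) * exp (- (t - s) * dissipation \<xi>)"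
        by (simp add: exp_add[symmetric] algebra_simps)
      show "P \<tau> \<xi> = (P s \<xi> + complex_of_real (\<tau> - s) * mP s \<xi>) + \<rho> s \<tau> \<xi>"
        unfolding \<rho>_def mP_def P_def e by (simp add: algebra_simps)
    qed
    show ?thesis
      unfolding Z_def eq
      by (simp add: fourier_pairing_add[OF sq[OF \<tau>]] test_functions_add test_functions_cmult P mP \<rho>
          fourier_pairing_cmult scaleR_conv_of_real)
  qed
  \<comment> \<open>The dissipation is at most one, so the second-order remainder is bounded uniformly in the frequency.\<close>
  have rem: "norm (fourier_pairing (u \<tau>) (\<rho> s \<tau>)) \<le> (M * (?Q * L2_norm (P s))) * (\<tau> - s)\<^sup>2"
    if \<tau>: "0 \<le> \<tau>" "\<bar>\<tau> - s\<bar> \<le> 1" for s \<tau>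
  proof -
    have "L2_norm (\<rho> s \<tau>) \<le> (\<tau> - s)\<^sup>2 * L2_norm (P s)"
    proof (rule L2_norm_le[OF \<rho> P])
      fix \<xi> :: "real^'n"
      have d: "\<bar>(\<tau> - s) * dissipation \<xi>\<bar> \<le> \<bar>\<tau> - s\<bar>"
        using dissipation_bounds[of \<xi>] by (simp add: abs_mult mult_left_le)
      have "\<bar>exp ((\<tau> - s) * dissipation \<xi>) - 1 - (\<tau> - s) * dissipation \<xi>\<bar> \<le> ((\<tau> - s) * dissipation \<xi>)\<^sup>2"
        by (rule abs_exp_minus_linear_le) (use d \<tau>(2) in linarith)
      also have "\<dots> \<le> (\<tau> - s)\<^sup>2"
        using d by (simp add: abs_le_square_iff)
      finally show "norm (\<rho> s \<tau> \<xi>) \<le> (\<tau> - s)\<^sup>2 * norm (P s \<xi>)"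
        unfolding \<rho>_def norm_mult norm_of_real by (rule mult_right_mono) simp
    qed simp
    then have "?Q * L2_norm (\<rho> s \<tau>) \<le> ?Q * ((\<tau> - s)\<^sup>2 * L2_norm (P s))"
      using plancherel_const_pos[where 'n = 'n] by simp
    then have "L2_norm (u \<tau>) * (?Q * L2_norm (\<rho> s \<tau>)) \<le> M * (?Q * ((\<tau> - s)\<^sup>2 * L2_norm (P s)))"
      using plancherel_const_pos[where 'n = 'n] M0 L2_norm_nonneg
      by (intro mult_mono M \<tau>) (auto intro: mult_nonneg_nonneg less_imp_le)
    then show ?thesis
      using fourier_pairing_bound[OF sq[OF \<tau>(1)] \<rho>, of s \<tau>] by (simp add: mult_ac)
  qed
  have deriv: "(Z has_vector_derivative - N s (P s)) (at s)" if s: "0 < s" for s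
  proof -
    define L where "L = M * (?Q * L2_norm (P s))"
    have rem_deriv: "((\<lambda>\<tau>. fourier_pairing (u \<tau>) (\<rho> s \<tau>)) has_vector_derivative 0) (at s)"
      unfolding has_vector_derivative_def
    proof (rule has_derivativeI_sandwich[where e = "min s 1" and H = "\<lambda>\<tau>. L * \<bar>\<tau> - s\<bar>"])
      have z: "fourier_pairing (u s) (\<rho> s s) = 0"
        using rem[of s s] s by simp
      show "norm (fourier_pairing (u \<tau>) (\<rho> s \<tau>) - fourier_pairing (u s) (\<rho> s s) - (\<tau> - s) *\<^sub>R 0) / norm (\<tau> - s) \<le> L * \<bar>\<tau> - s\<bar>"
        if "\<tau> \<noteq> s" "dist \<tau> s < min s 1" for \<tau>
      proof -
        have "norm (fourier_pairing (u \<tau>) (\<rho> s \<tau>)) \<le> L * (\<tau> - s)\<^sup>2"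
          unfolding L_def using that(2) by (intro rem) (auto simp: dist_real_def)
        then show ?thesis
          using that(1) unfolding z by (simp add: divide_le_eq power2_eq_square mult.assoc abs_mult_self_eq)
      qed
      have "((\<lambda>\<tau>. L * \<bar>\<tau> - s\<bar>) \<longlongrightarrow> L * \<bar>s - s\<bar>) (at s)"
        by (intro tendsto_intros)
      then show "((\<lambda>\<tau>. L * \<bar>\<tau> - s\<bar>) \<longlongrightarrow> 0) (at s)"
        by simp
    qed (use s in auto)
    have mid: "((\<lambda>\<tau>. (\<tau> - s) *\<^sub>R fourier_pairing (u \<tau>) (mP s)) has_vector_derivative fourier_pairing (u s) (mP s)) (at s)"
    proof -
      have "((\<lambda>\<tau>. \<tau> - s) has_field_derivative 1) (at s)"
        by (auto intro!: derivative_eq_intros)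
      from has_vector_derivative_scaleR[OF this ode[OF s mP]] show ?thesis
        by simp
    qed
    have "((\<lambda>\<tau>. fourier_pairing (u \<tau>) (P s) + (\<tau> - s) *\<^sub>R fourier_pairing (u \<tau>) (mP s) + fourier_pairing (u \<tau>) (\<rho> s \<tau>))
        has_vector_derivative (- fourier_pairing (u s) (mP s) - N s (P s)) + fourier_pairing (u s) (mP s) + 0) (at s)"
      using ode[OF s P, of s] by (intro has_vector_derivative_add mid rem_deriv) (simp add: mP_def)
    then have "((\<lambda>\<tau>. fourier_pairing (u \<tau>) (P s) + (\<tau> - s) *\<^sub>R fourier_pairing (u \<tau>) (mP s) + fourier_pairing (u \<tau>) (\<rho> s \<tau>))
        has_vector_derivative - N s (P s)) (at s)"
      by simp
    then show ?thesis
      by (rule has_vector_derivative_transform_within_open[where S = "{0<..}"]) (use s expand[of _ s] in auto)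
  qed
  have Z0: "(Z \<longlongrightarrow> Z 0) (at 0 within {0..})"
  proof -
    let ?F = "at (0::real) within {0..}"
    define L where "L = M * (?Q * L2_norm (P 0))"
    have id0: "((\<lambda>\<tau>::real. \<tau>) \<longlongrightarrow> 0) ?F"
      by (rule tendsto_ident_at)
    have ev: "eventually (\<lambda>\<tau>. 0 \<le> \<tau> \<and> \<tau> < 1) ?F"
      using order_tendstoD(2)[OF id0, of 1] by (auto simp: eventually_at_filter elim!: eventually_mono)
    have "((\<lambda>\<tau>. L * \<tau>\<^sup>2) \<longlongrightarrow> L * 0\<^sup>2) ?F"
      by (intro tendsto_intros id0)
    then have "((\<lambda>\<tau>. L * \<tau>\<^sup>2) \<longlongrightarrow> 0) ?F"
      by simp
    moreover have "eventually (\<lambda>\<tau>. norm (fourier_pairing (u \<tau>) (\<rho> 0 \<tau>)) \<le> L * \<tau>\<^sup>2) ?F"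
      using ev by eventually_elim (use rem[of _ 0] in \<open>simp add: L_def\<close>)
    ultimately have 3: "((\<lambda>\<tau>. fourier_pairing (u \<tau>) (\<rho> 0 \<tau>)) \<longlongrightarrow> 0) ?F"
      by (rule Lim_null_comparison[rotated])
    have "((\<lambda>\<tau>. fourier_pairing (u \<tau>) (P 0) + \<tau> *\<^sub>R fourier_pairing (u \<tau>) (mP 0) + fourier_pairing (u \<tau>) (\<rho> 0 \<tau>))
      \<longlongrightarrow> fourier_pairing (u 0) (P 0) + 0 *\<^sub>R fourier_pairing (u 0) (mP 0) + 0) ?F"
      by (intro tendsto_intros cont0 P mP 3 id0)
    then have lim: "((\<lambda>\<tau>. fourier_pairing (u \<tau>) (P 0) + \<tau> *\<^sub>R fourier_pairing (u \<tau>) (mP 0) + fourier_pairing (u \<tau>) (\<rho> 0 \<tau>))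
      \<longlongrightarrow> Z 0) ?F"
      by (simp add: Z_def)
    have "eventually (\<lambda>\<tau>. fourier_pairing (u \<tau>) (P 0) + \<tau> *\<^sub>R fourier_pairing (u \<tau>) (mP 0) + fourier_pairing (u \<tau>) (\<rho> 0 \<tau>) = Z \<tau>) ?F"
      using ev by eventually_elim (simp add: expand[of _ 0])
    then show ?thesis
      by (rule Lim_transform_eventually[OF lim])
  qed
  define I where "I = (\<integral>\<xi>. norm \<xi> * norm (\<phi> \<xi>) \<partial>lborel)"
  have int: "integrable lborel (\<lambda>\<xi>. norm \<xi> * norm (\<psi> \<xi>))" if "\<psi> \<in> test_functions" for \<psi> :: "real^'n \<Rightarrow> complex"
    using test_functions_weighted_integrable[OF that, of norm 1] by (simp add: continuous_intros)
  have bound: "norm (- N s (P s)) \<le> K * I / (1 + s)" if s: "0 < s" "s < t" for s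
  proof -
    have "(\<integral>\<xi>. norm \<xi> * norm (P s \<xi>) \<partial>lborel) \<le> I"
      unfolding I_def
    proof (rule integral_mono[OF int[OF P] int[OF \<phi>]])
      fix \<xi> :: "real^'n"
      have "exp (- (t - s) * dissipation \<xi>) \<le> 1"
        using s dissipation_bounds(1)[of \<xi>] by (simp add: mult_nonpos_nonneg)
      then have "exp (- (t - s) * dissipation \<xi>) * norm (\<phi> \<xi>) \<le> 1 * norm (\<phi> \<xi>)"
        by (rule mult_right_mono) simp
      then show "norm \<xi> * norm (P s \<xi>) \<le> norm \<xi> * norm (\<phi> \<xi>)"
        unfolding P_def norm_mult norm_of_real by (intro mult_left_mono) auto
    qed
    then have "K / (1 + s) * (\<integral>\<xi>. norm \<xi> * norm (P s \<xi>) \<partial>lborel) \<le> K / (1 + s) * I"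
      using K s by (intro mult_left_mono) auto
    then show ?thesis
      using N[OF s(1) P, of s] by simp
  qed
  have "norm (Z t - Z 0) \<le> K * I * ln (1 + t) - K * I * ln (1 + 0)"
  proof (rule differentiable_bound_general[OF t])
    show "continuous_on {0..t} Z"
    proof (rule continuous_on_eq_continuous_within[THEN iffD2], rule ballI)
      fix s assume s: "s \<in> {0..t}"
      show "continuous (at s within {0..t}) Z"
      proof (cases "s = 0")
        case True
        have "(Z \<longlongrightarrow> Z 0) (at 0 within {0..t})"
          by (rule tendsto_within_subset[OF Z0]) auto
        then show ?thesis
          using True by (simp add: continuous_within)
      next
        case False
        then have "isCont Z s"
          using deriv[of s] s has_vector_derivative_continuous by force
        then show ?thesis
          using continuous_at_imp_continuous_at_within by blast
      qed
    qed
    show "continuous_on {0..t} (\<lambda>s. K * I * ln (1 + s))"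
      by (intro continuous_intros) auto
    show "(Z has_vector_derivative - N s (P s)) (at s)" if "0 < s" "s < t" for s
      by (rule deriv) fact
    show "((\<lambda>s. K * I * ln (1 + s)) has_vector_derivative K * I / (1 + s)) (at s)" if "0 < s" "s < t" for s
      unfolding has_real_derivative_iff_has_vector_derivative[symmetric] using that
      by (auto intro!: derivative_eq_intros)
  qed (use bound in auto)
  moreover have "Z t = fourier_pairing (u t) \<phi>"
    by (simp add: Z_def P_def)
  moreover have "Z 0 = fourier_pairing (u 0) (\<lambda>\<xi>. complex_of_real (exp (- t * dissipation \<xi>)) * \<phi> \<xi>)"
    by (simp add: Z_def P_def)
  ultimately show ?thesis
    by (simp add: I_def mult_ac)
qed

section \<open>Lower bounds at low frequencies\<close>

lemma cutoff_test_function: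
  fixes chi :: "real^'n \<Rightarrow> real"
  assumes chi: "lp_cutoff chi" and r: "0 < r"
  shows "(\<lambda>\<xi>. complex_of_real (chi ((1 / r) *\<^sub>R \<xi>))) \<in> test_functions"
proof -
  have "chi ((1 / r) *\<^sub>R \<xi>) = 0" if "4 / 3 * r \<le> norm \<xi>" for \<xi>
  proof -
    have "(1 / r) *\<^sub>R \<xi> \<notin> ball 0 (4 / 3)"
      using that r by (simp add: field_simps)
    then show ?thesis using chi by (auto simp: lp_cutoff_def)
  qed
  then show ?thesis
    using chi unfolding test_functions_def lp_cutoff_def
    by (auto intro!: smooth_of_real smooth_scaled_argument exI[of _ "4 / 3 * r"])
qed

lemma mult_cnj_sgn: "z * cnj (sgn z) = complex_of_real (norm z)"
proof (cases "z = 0")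
  case False
  have "z * cnj (sgn z) = z * cnj z / complex_of_real (norm z)"
    by (simp add: sgn_div_norm scaleR_conv_of_real divide_inverse)
  also have "\<dots> = complex_of_real (norm z)"
    using False by (simp add: complex_norm_square[symmetric] power2_eq_square)
  finally show ?thesis .
qed simp

text \<open>Apply the estimate to test functions that approximate \<open>cnj (sgn g)\<close> times a cutoff \<open>\<kappa>\<close> at scale \<open>r\<close>.
The left-hand side tends to \<open>\<integral> |g| e \<kappa>\<close>, which is bounded below on the ball where \<open>\<kappa> = 1\<close>; the right-hand side
only depends on the bound 2 for the approximations and on the support of \<open>\<kappa>\<close>. The radii
\<open>3/4 r\<close> and \<open>4/3 r\<close> come from the Littlewood--Paley cutoff, which supplies \<open>\<kappa>\<close>.\<close>

lemma low_frequency_lower_bound: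
  fixes chi :: "real^'n \<Rightarrow> real" and g :: "real^'n \<Rightarrow> complex" and e :: "real^'n \<Rightarrow> real"
  assumes chi: "lp_cutoff chi"
    and g [measurable]: "g \<in> borel_measurable borel"
    and int: "\<And>\<phi>. \<phi> \<in> test_functions \<Longrightarrow> integrable lborel (\<lambda>\<xi>. g \<xi> * \<phi> \<xi>)"
    and \<eta>: "AE \<xi> in lborel. norm \<xi> \<le> r \<longrightarrow> \<eta> \<le> norm (g \<xi>)" "0 \<le> \<eta>"
    and e [measurable]: "e \<in> borel_measurable borel" and e01: "\<And>\<xi>. 0 \<le> e \<xi>" "\<And>\<xi>. e \<xi> \<le> 1"
    and c0: "\<And>\<xi>. norm \<xi> \<le> r \<Longrightarrow> c\<^sub>0 \<le> e \<xi>" "0 \<le> c\<^sub>0"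
    and r: "0 < r" and AB: "0 \<le> A" "0 \<le> B"
    and est: "\<And>\<phi>. \<phi> \<in> test_functions \<Longrightarrow>
      norm (\<integral>\<xi>. g \<xi> * (complex_of_real (e \<xi>) * \<phi> \<xi>) \<partial>lborel)
        \<le> A * L2_norm \<phi> + B * (\<integral>\<xi>. norm \<xi> * norm (\<phi> \<xi>) \<partial>lborel)"
  shows "\<eta> * c\<^sub>0 * measure lborel (ball (0::real^'n) (3 / 4 * r))
    \<le> A * (2 * sqrt (measure lborel (ball (0::real^'n) (4 / 3 * r))))
      + B * (8 / 3 * r * measure lborel (ball (0::real^'n) (4 / 3 * r)))"
proof -
  let ?R = "4 / 3 * r"
  define V where "V = measure lborel (ball (0::real^'n) ?R)"
  define \<kappa> where "\<kappa> = (\<lambda>\<xi>::real^'n. chi ((1 / r) *\<^sub>R \<xi>))"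
  have \<kappa>: "(\<lambda>\<xi>. complex_of_real (\<kappa> \<xi>)) \<in> test_functions"
    unfolding \<kappa>_def by (rule cutoff_test_function[OF chi r])
  have \<kappa>01: "0 \<le> \<kappa> \<xi>" "\<kappa> \<xi> \<le> 1" for \<xi>
    using chi unfolding \<kappa>_def lp_cutoff_def by (meson atLeastAtMost_iff rangeI subsetD)+
  have \<kappa>0: "\<kappa> \<xi> = 0" if "?R \<le> norm \<xi>" for \<xi>
  proof -
    have "(1 / r) *\<^sub>R \<xi> \<notin> ball 0 (4 / 3)"
      using that r by (simp add: field_simps)
    then show ?thesis using chi by (auto simp: lp_cutoff_def \<kappa>_def)
  qed
  have \<kappa>1: "\<kappa> \<xi> = 1" if "norm \<xi> < 3 / 4 * r" for \<xi>
  proof -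
    have "(1 / r) *\<^sub>R \<xi> \<in> ball 0 (3 / 4)"
      using that r by (simp add: field_simps)
    then show ?thesis using chi by (auto simp: lp_cutoff_def \<kappa>_def)
  qed
  define w where "w = (\<lambda>\<xi>. cnj (sgn (g \<xi>)))"
  have cnj: "cnj \<in> borel_measurable borel"
    by (intro borel_measurable_continuous_onI continuous_intros)
  have "(\<lambda>\<xi>. sgn (g \<xi>)) \<in> borel_measurable borel"
    unfolding sgn_div_norm by measurable
  from measurable_compose[OF this cnj] have w: "w \<in> borel_measurable borel" "norm (w \<xi>) \<le> 1" for \<xi>
    by (auto simp: w_def norm_sgn)
  \<comment> \<open>The factor \<open>w\<close> cancels the phase of \<open>g\<close>.\<close>
  obtain p where p: "\<And>n::nat. smooth (p n)" "\<And>n x. norm x \<le> ?R \<Longrightarrow> norm (p n x) \<le> 2"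
    "AE x in lborel. norm x \<le> ?R \<longrightarrow> (\<lambda>n. p n x) \<longlonglongrightarrow> w x"
    using smooth_approximation[OF w] by blast
  define \<phi> where "\<phi> = (\<lambda>n \<xi>. p n \<xi> * complex_of_real (\<kappa> \<xi>))"
  have \<phi>: "\<phi> n \<in> test_functions" for n
    unfolding \<phi>_def by (rule test_functions_mult_smooth[OF p(1) \<kappa>])
  have [measurable]: "\<phi> n \<in> borel_measurable borel" for n
    using \<phi> smooth_imp_measurable by blast
  have \<kappa>_measurable: "(\<lambda>\<xi>. complex_of_real (\<kappa> \<xi>)) \<in> borel_measurable borel"
    using \<kappa> smooth_imp_measurable by blast
  have \<phi>\<kappa>: "norm (\<phi> n \<xi>) \<le> 2 * \<kappa> \<xi>" for n \<xi>
  proof (cases "?R \<le> norm \<xi>")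
    case True
    then show ?thesis using \<kappa>0 by (simp add: \<phi>_def)
  next
    case False
    then show ?thesis
      using mult_right_mono[OF p(2)[of \<xi> n] \<kappa>01(1)[of \<xi>]] \<kappa>01(1)[of \<xi>]
      by (simp add: \<phi>_def norm_mult)
  qed
  have \<phi>2: "norm (\<phi> n \<xi>) \<le> 2 * indicator (ball 0 ?R) \<xi>" for n \<xi>
    using \<phi>\<kappa>[of n \<xi>] \<kappa>01(2)[of \<xi>] \<kappa>0[of \<xi>] by (auto simp: indicator_def not_less)
  have int_ind: "integrable lborel (indicator (ball (0::real^'n) \<rho>) :: real^'n \<Rightarrow> real)" for \<rho>
    using emeasure_bounded_finite[of "ball (0::real^'n) \<rho>"] by auto
  have ind: "(\<integral>\<xi>. indicator (ball (0::real^'n) \<rho>) \<xi> \<partial>lborel) = measure lborel (ball (0::real^'n) \<rho>)" for \<rho>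
    by simp
  have L2: "L2_norm (\<phi> n) \<le> 2 * sqrt V" for n
  proof -
    have "(\<integral>\<xi>. (norm (\<phi> n \<xi>))\<^sup>2 \<partial>lborel) \<le> (\<integral>\<xi>. 4 * indicator (ball (0::real^'n) ?R) \<xi> \<partial>lborel)"
    proof (rule integral_mono')
      show "integrable lborel (\<lambda>\<xi>::real^'n. 4 * indicator (ball 0 ?R) \<xi> :: real)"
        by (intro integrable_mult_right int_ind)
      show "(norm (\<phi> n \<xi>))\<^sup>2 \<le> 4 * indicator (ball 0 ?R) \<xi>" for \<xi>
        using power_mono[OF \<phi>2[of n \<xi>] norm_ge_zero, of 2] by (auto simp: indicator_def split: if_splits)
    qed simp
    also have "\<dots> = 4 * V"
      by (simp add: V_def)
    finally have "sqrt (\<integral>\<xi>. (norm (\<phi> n \<xi>))\<^sup>2 \<partial>lborel) \<le> sqrt (4 * V)"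
      by simp
    then show ?thesis
      by (simp add: L2_norm_def real_sqrt_mult)
  qed
  have I: "(\<integral>\<xi>. norm \<xi> * norm (\<phi> n \<xi>) \<partial>lborel) \<le> 8 / 3 * r * V" for n
  proof -
    have "(\<integral>\<xi>. norm \<xi> * norm (\<phi> n \<xi>) \<partial>lborel) \<le> (\<integral>\<xi>. (8 / 3 * r) * indicator (ball (0::real^'n) ?R) \<xi> \<partial>lborel)"
    proof (rule integral_mono')
      show "integrable lborel (\<lambda>\<xi>::real^'n. (8 / 3 * r) * indicator (ball 0 ?R) \<xi> :: real)"
        by (intro integrable_mult_right int_ind)
      fix \<xi> :: "real^'n"
      show "norm \<xi> * norm (\<phi> n \<xi>) \<le> (8 / 3 * r) * indicator (ball 0 ?R) \<xi>"
      proof (cases "norm \<xi> < ?R")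
        case True
        then have "norm \<xi> * norm (\<phi> n \<xi>) \<le> ?R * 2"
          using \<phi>2[of n \<xi>] r by (intro mult_mono) auto
        then show ?thesis using True by simp
      next
        case False
        then show ?thesis using \<phi>2[of n \<xi>] by simp
      qed
    qed (use r in simp)
    then show ?thesis
      by (simp add: V_def)
  qed
  let ?G = "\<lambda>\<xi>. norm (g \<xi>) * (e \<xi> * \<kappa> \<xi>)"
  have dom: "integrable lborel (\<lambda>\<xi>. 2 * norm (g \<xi> * complex_of_real (\<kappa> \<xi>)))"
    by (intro integrable_mult_right integrable_norm int \<kappa>)
  have lim: "(\<lambda>n. \<integral>\<xi>. g \<xi> * (complex_of_real (e \<xi>) * \<phi> n \<xi>) \<partial>lborel) \<longlonglongrightarrow> (\<integral>\<xi>. complex_of_real (?G \<xi>) \<partial>lborel)"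
  proof (rule integral_dominated_convergence[OF _ _ dom])
    show "(\<lambda>\<xi>. complex_of_real (?G \<xi>)) \<in> borel_measurable lborel"
      using \<kappa>_measurable by simp
    show "(\<lambda>\<xi>. g \<xi> * (complex_of_real (e \<xi>) * \<phi> n \<xi>)) \<in> borel_measurable lborel" for n
      by measurable
    have "norm (g \<xi> * (complex_of_real (e \<xi>) * \<phi> n \<xi>)) \<le> 2 * norm (g \<xi> * complex_of_real (\<kappa> \<xi>))" for n \<xi>
    proof -
      have "e \<xi> * norm (\<phi> n \<xi>) \<le> 1 * (2 * \<kappa> \<xi>)"
        using e01 \<phi>\<kappa> by (intro mult_mono) auto
      from mult_left_mono[OF this norm_ge_zero[of "g \<xi>"]] show ?thesis
        using e01(1)[of \<xi>] \<kappa>01(1)[of \<xi>] by (simp add: norm_mult mult_ac)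
    qed
    then show "AE \<xi> in lborel. norm (g \<xi> * (complex_of_real (e \<xi>) * \<phi> n \<xi>)) \<le> 2 * norm (g \<xi> * complex_of_real (\<kappa> \<xi>))" for n
      by simp
    show "AE \<xi> in lborel. (\<lambda>n. g \<xi> * (complex_of_real (e \<xi>) * \<phi> n \<xi>)) \<longlonglongrightarrow> complex_of_real (?G \<xi>)"
      using p(3)
    proof eventually_elim
      case (elim \<xi>)
      show ?case
      proof (cases "norm \<xi> \<le> ?R")
        case True
        with elim have "(\<lambda>n. g \<xi> * (complex_of_real (e \<xi>) * (p n \<xi> * complex_of_real (\<kappa> \<xi>))))
            \<longlonglongrightarrow> g \<xi> * (complex_of_real (e \<xi>) * (w \<xi> * complex_of_real (\<kappa> \<xi>)))"
          by (intro tendsto_intros) auto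
        moreover have "g \<xi> * (complex_of_real (e \<xi>) * (w \<xi> * complex_of_real (\<kappa> \<xi>))) = (g \<xi> * cnj (sgn (g \<xi>))) * complex_of_real (e \<xi> * \<kappa> \<xi>)"
          by (simp add: w_def)
        ultimately show ?thesis
          unfolding mult_cnj_sgn by (simp add: \<phi>_def)
      next
        case False
        then show ?thesis
          using \<kappa>0[of \<xi>] by (simp add: \<phi>_def)
      qed
    qed
  qed
  have G_nonneg: "0 \<le> ?G \<xi>" for \<xi>
    using e01(1)[of \<xi>] \<kappa>01(1)[of \<xi>] by simp
  have G_int: "integrable lborel ?G"
  proof (rule Bochner_Integration.integrable_bound[OF dom])
    have "(\<lambda>\<xi>. Re (complex_of_real (\<kappa> \<xi>))) \<in> borel_measurable borel"
      using \<kappa>_measurable by measurable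
    then have [measurable]: "\<kappa> \<in> borel_measurable borel"
      by simp
    show "?G \<in> borel_measurable lborel"
      by measurable
    have "norm (?G \<xi>) \<le> 2 * norm (g \<xi> * complex_of_real (\<kappa> \<xi>))" for \<xi>
    proof -
      have "e \<xi> * \<kappa> \<xi> \<le> 1 * \<kappa> \<xi>"
        using e01 \<kappa>01 by (intro mult_right_mono) auto
      then have "e \<xi> * \<kappa> \<xi> \<le> 2 * \<kappa> \<xi>"
        using \<kappa>01(1)[of \<xi>] by linarith
      from mult_left_mono[OF this norm_ge_zero[of "g \<xi>"]] show ?thesis
        using G_nonneg[of \<xi>] \<kappa>01(1)[of \<xi>] by (simp add: norm_mult mult_ac)
    qed
    then show "AE \<xi> in lborel. norm (?G \<xi>) \<le> norm (2 * norm (g \<xi> * complex_of_real (\<kappa> \<xi>)))"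
      by simp
  qed
  have "\<eta> * c\<^sub>0 * measure lborel (ball (0::real^'n) (3 / 4 * r)) = (\<integral>\<xi>. \<eta> * c\<^sub>0 * indicator (ball (0::real^'n) (3 / 4 * r)) \<xi> \<partial>lborel)"
    by simp
  also have "\<dots> \<le> (\<integral>\<xi>. ?G \<xi> \<partial>lborel)"
  proof (rule integral_mono_AE[OF _ G_int])
    show "integrable lborel (\<lambda>\<xi>. \<eta> * c\<^sub>0 * indicator (ball (0::real^'n) (3 / 4 * r)) \<xi> :: real)"
      by (intro integrable_mult_right int_ind)
    show "AE \<xi> in lborel. \<eta> * c\<^sub>0 * indicator (ball (0::real^'n) (3 / 4 * r)) \<xi> \<le> ?G \<xi>"
      using \<eta>(1)
    proof eventually_elim
      case (elim \<xi>)
      show ?case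
      proof (cases "norm \<xi> < 3 / 4 * r")
        case True
        then have "\<eta> * c\<^sub>0 \<le> norm (g \<xi>) * e \<xi>"
          using elim c0 \<eta>(2) r by (intro mult_mono) auto
        then show ?thesis using True \<kappa>1[OF True] by simp
      next
        case False
        then show ?thesis using G_nonneg[of \<xi>] by simp
      qed
    qed
  qed
  also have "\<dots> = norm (\<integral>\<xi>. complex_of_real (?G \<xi>) \<partial>lborel)"
    using G_nonneg by (subst integral_complex_of_real) (simp add: integral_nonneg_AE)
  also have "\<dots> \<le> A * (2 * sqrt V) + B * (8 / 3 * r * V)"
  proof (rule LIMSEQ_le_const2[OF tendsto_norm[OF lim]], intro exI allI impI)
    fix n
    have "A * L2_norm (\<phi> n) + B * (\<integral>\<xi>. norm \<xi> * norm (\<phi> n \<xi>) \<partial>lborel) \<le> A * (2 * sqrt V) + B * (8 / 3 * r * V)"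
      by (intro add_mono mult_left_mono L2 I AB)
    then show "norm (\<integral>\<xi>. g \<xi> * (complex_of_real (e \<xi>) * \<phi> n \<xi>) \<partial>lborel) \<le> A * (2 * sqrt V) + B * (8 / 3 * r * V)"
      using est[OF \<phi>[of n]] by linarith
  qed
  finally show ?thesis
    unfolding V_def .
qed

section \<open>Lower bound for the decay of the solution\<close>

lemma has_vector_derivative_fourier_pairing:
  fixes u :: "real \<Rightarrow> real^'n \<Rightarrow> real"
  assumes sol: "global_solution chi f u0 u" and f: "f = (\<lambda>r. r\<^sup>2 *\<^sub>R b)"
    and s: "0 < s" and sq: "square_integrable (u s)" and \<phi>: "\<phi> \<in> test_functions"
  shows "((\<lambda>\<tau>. fourier_pairing (u \<tau>) \<phi>) has_vector_derivative
      - fourier_pairing (u s) (\<lambda>\<xi>. complex_of_real (dissipation \<xi>) * \<phi> \<xi>)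
      - div_distr (\<lambda>x. (u s x)\<^sup>2 *\<^sub>R b) (fourier \<phi>)) (at s)"
proof -
  have "((\<lambda>\<tau>. distr_of (cfun (u \<tau>)) (fourier \<phi>)) has_vector_derivative
      laplacian_distr (P_op (distr_of (cfun (u s)))) (fourier \<phi>) - div_distr (\<lambda>x. f (u s x)) (fourier \<phi>)) (at s)"
    using sol s fourier_schwartz[OF \<phi>] by (simp add: global_solution_def)
  then show ?thesis
    unfolding laplacian_P_op_pairing[OF sq \<phi>] f by (simp add: fourier_pairing_def)
qed

text \<open>The dimension enters here: \<open>d \<ge> 2\<close> and the decay of order \<open>d/4\<close> bound the square of the norm by
\<open>C\<^sup>2 / (1 + s)\<close>, whose integral grows only logarithmically.\<close>

lemma solution_low_frequency_estimate:
  fixes chi :: "real^'n \<Rightarrow> real" and u :: "real \<Rightarrow> real^'n \<Rightarrow> real"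
  assumes d: "CARD('n) \<ge> 2" and chi: "lp_cutoff chi" and f: "f = (\<lambda>r. r\<^sup>2 *\<^sub>R b)"
    and sol: "global_solution chi f u0 u"
    and sq: "\<And>t. 0 \<le> t \<Longrightarrow> square_integrable (u t)"
    and decay: "\<And>t. 0 \<le> t \<Longrightarrow> L2_norm (u t) \<le> C * (1 + t) powr (- (CARD('n) / 4))"
    and g: "represents g (fourier_distr u0)"
    and t: "0 < t" and \<phi>: "\<phi> \<in> test_functions"
  shows "norm (\<integral>\<xi>. g \<xi> * (complex_of_real (exp (- t * dissipation \<xi>)) * \<phi> \<xi>) \<partial>lborel)
    \<le> (L2_norm (u t) * plancherel_const TYPE('n)) * L2_norm \<phi>
      + (C\<^sup>2 * norm b * ln (1 + t)) * (\<integral>\<xi>. norm \<xi> * norm (\<phi> \<xi>) \<partial>lborel)"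
proof -
  have C: "0 \<le> C"
    using decay[of 0] L2_norm_nonneg[of "u 0"] by simp
  have M: "L2_norm (u t) \<le> C" if "0 \<le> t" for t
  proof -
    have "(1 + t) powr (- (CARD('n) / 4)) \<le> (1 + t) powr 0"
      using that by (intro powr_mono) auto
    then have "C * (1 + t) powr (- (CARD('n) / 4)) \<le> C * 1"
      using C that by (intro mult_left_mono) auto
    then show ?thesis
      using decay[OF that] by simp
  qed
  have N: "norm (div_distr (\<lambda>x. (u s x)\<^sup>2 *\<^sub>R b) (fourier \<psi>))
      \<le> (C\<^sup>2 * norm b) / (1 + s) * (\<integral>\<xi>. norm \<xi> * norm (\<psi> \<xi>) \<partial>lborel)"
    if s: "0 < s" and \<psi>: "\<psi> \<in> test_functions" for s \<psi>
  proof -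
    have "(L2_norm (u s))\<^sup>2 \<le> (C * (1 + s) powr (- (CARD('n) / 4)))\<^sup>2"
      using s by (intro power_mono decay L2_norm_nonneg) auto
    also have "\<dots> = C\<^sup>2 * (1 + s) powr (- (CARD('n) / 2))"
      by (simp add: power_mult_distrib power2_eq_square powr_add[symmetric])
    also have "\<dots> \<le> C\<^sup>2 * (1 + s) powr (- 1)"
      using s d by (intro mult_left_mono powr_mono) auto
    also have "\<dots> = C\<^sup>2 / (1 + s)"
      using s by (simp add: powr_minus_divide)
    finally have "(L2_norm (u s))\<^sup>2 * (norm b * (\<integral>\<xi>. norm \<xi> * norm (\<psi> \<xi>) \<partial>lborel))
        \<le> C\<^sup>2 / (1 + s) * (norm b * (\<integral>\<xi>. norm \<xi> * norm (\<psi> \<xi>) \<partial>lborel))"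
      by (rule mult_right_mono) simp
    then show ?thesis
      using div_distr_quadratic_bound[OF sq[of s] \<psi>, of b] s by simp
  qed
  have cont: "((\<lambda>\<tau>. fourier_pairing (u \<tau>) \<psi>) \<longlongrightarrow> fourier_pairing (u 0) \<psi>) (at 0 within {0..})"
    if "\<psi> \<in> test_functions" for \<psi>
    using sol by (intro weakly_continuous_at_0[OF chi sq M _ that]) (auto simp: global_solution_def)
  let ?\<psi> = "\<lambda>\<xi>. complex_of_real (exp (- t * dissipation \<xi>)) * \<phi> \<xi>"
  have \<psi>: "?\<psi> \<in> test_functions"
    by (intro test_functions_mult_smooth smooth_of_real smooth_exp smooth_mult smooth_const smooth_dissipation \<phi>)
  have "norm (fourier_pairing (u t) \<phi> - fourier_pairing (u 0) ?\<psi>)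
      \<le> (C\<^sup>2 * norm b) * ln (1 + t) * (\<integral>\<xi>. norm \<xi> * norm (\<phi> \<xi>) \<partial>lborel)"
    by (rule Duhamel_estimate[OF sq M cont has_vector_derivative_fourier_pairing[OF sol f _ sq] N _ t \<phi>]) auto
  moreover have "fourier_pairing (u 0) ?\<psi> = (\<integral>\<xi>. g \<xi> * ?\<psi> \<xi> \<partial>lborel)"
  proof -
    have "fourier_pairing (u 0) ?\<psi> = u0 (fourier ?\<psi>)"
      using sol fourier_schwartz[OF \<psi>] by (simp add: global_solution_def represents_def fourier_pairing_def)
    also have "\<dots> = distr_of g ?\<psi>"
      using g test_functions_schwartz[OF \<psi>] by (simp add: represents_def fourier_distr_def)
    finally show ?thesis
      by (simp add: distr_of_def)
  qed
  moreover have "norm (fourier_pairing (u t) \<phi>) \<le> L2_norm (u t) * (plancherel_const TYPE('n) * L2_norm \<phi>)"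
    using t by (intro fourier_pairing_bound sq \<phi>) simp
  ultimately show ?thesis
    using norm_triangle_ineq2[of "fourier_pairing (u 0) ?\<psi>" "fourier_pairing (u t) \<phi>"]
    by (simp add: norm_minus_commute mult_ac)
qed

text \<open>Take \<open>r = 1 / \<surd>t\<close>. On the ball of radius \<open>r\<close> the linear flow loses at most the factor \<open>e\<close>, because
\<open>t |\<xi>|\<^sup>2 \<le> 1\<close>. After division by the volume, of order \<open>R = r\<^sup>d\<close>, the nonlinear contribution is of order
\<open>ln (1 + t) / \<surd>t\<close>.\<close>

lemma solution_L2_lower_bound:
  fixes chi :: "real^'n \<Rightarrow> real" and u :: "real \<Rightarrow> real^'n \<Rightarrow> real"
  assumes d: "CARD('n) \<ge> 2" and chi: "lp_cutoff chi" and f: "f = (\<lambda>r. r\<^sup>2 *\<^sub>R b)"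
    and sol: "global_solution chi f u0 u"
    and sq: "\<And>t. 0 \<le> t \<Longrightarrow> square_integrable (u t)"
    and decay: "\<And>t. 0 \<le> t \<Longrightarrow> L2_norm (u t) \<le> C * (1 + t) powr (- (CARD('n) / 4))"
    and g: "represents g (fourier_distr u0)"
    and \<eta>: "AE \<xi> in lborel. norm \<xi> \<le> \<Lambda> \<longrightarrow> \<eta> \<le> norm (g \<xi>)" "0 < \<eta>" "0 < \<Lambda>"
  shows "\<exists>c>0. \<exists>T>0. \<forall>t\<ge>T. c * (1 + t) powr (- (CARD('n) / 4)) \<le> L2_norm (u t)"
proof -
  define V where "V = unit_ball_vol (real CARD('n))"
  have V: "0 < V"
    by (simp add: V_def)
  define a where "a = \<eta> * exp (- 1) * (V * (3 / 4) ^ CARD('n))"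
  define b' where "b' = plancherel_const TYPE('n) * 2 * sqrt (V * (4 / 3) ^ CARD('n))"
  define c' where "c' = C\<^sup>2 * norm b * (8 / 3) * (V * (4 / 3) ^ CARD('n))"
  have a: "0 < a" and b': "0 < b'"
    using V \<eta>(2) plancherel_const_pos[where 'n = 'n] by (auto simp: a_def b'_def)
  have "((\<lambda>t::real. ln (1 + t) / sqrt t) \<longlongrightarrow> 0) at_top"
    by real_asymp
  from tendsto_mult_left[OF this, of c'] have "((\<lambda>t::real. c' * (ln (1 + t) / sqrt t)) \<longlongrightarrow> 0) at_top"
    by simp
  then have "eventually (\<lambda>t. c' * (ln (1 + t) / sqrt t) < a / 2) at_top"
    using a by (intro order_tendstoD) auto
  then obtain T\<^sub>0 where T\<^sub>0: "\<And>t. T\<^sub>0 \<le> t \<Longrightarrow> c' * (ln (1 + t) / sqrt t) < a / 2"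
    by (auto simp: eventually_at_top_linorder)
  define T where "T = max T\<^sub>0 (max 1 (1 / \<Lambda>\<^sup>2))"
  have main: "a / (2 * b') * (1 + t) powr (- (CARD('n) / 4)) \<le> L2_norm (u t)" if "T \<le> t" for t
  proof -
    have t: "T\<^sub>0 \<le> t" "1 \<le> t" "1 / \<Lambda>\<^sup>2 \<le> t" "0 < t"
      using that by (auto simp: T_def)
    define r where "r = 1 / sqrt t"
    have r: "0 < r"
      using t by (simp add: r_def)
    have "1 / \<Lambda> \<le> sqrt t"
      using t(3) \<eta>(3) by (intro real_le_rsqrt) (simp add: power_divide)
    then have r\<Lambda>: "r \<le> \<Lambda>"
      using \<eta>(3) t by (simp add: r_def field_simps)
    have ball: "measure lborel (ball (0::real^'n) (k * r)) = V * k ^ CARD('n) * r ^ CARD('n)" if "0 < k" for k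
      using content_ball[of "k * r" "0::real^'n"] that r by (simp add: V_def power_mult_distrib)
    have "\<eta> * exp (- 1) * measure lborel (ball (0::real^'n) (3 / 4 * r))
      \<le> (L2_norm (u t) * plancherel_const TYPE('n)) * (2 * sqrt (measure lborel (ball (0::real^'n) (4 / 3 * r))))
        + (C\<^sup>2 * norm b * ln (1 + t)) * (8 / 3 * r * measure lborel (ball (0::real^'n) (4 / 3 * r)))"
    proof (rule low_frequency_lower_bound[OF chi, where g = g and e = "\<lambda>\<xi>. exp (- t * dissipation \<xi>)"])
      show "g \<in> borel_measurable borel"
        using g by (simp add: represents_def tempered_function_def)
      show "integrable lborel (\<lambda>\<xi>. g \<xi> * \<phi> \<xi>)" if "\<phi> \<in> test_functions" for \<phi>
        using g test_functions_schwartz[OF that] by (simp add: represents_def tempered_function_def)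
      show "AE \<xi> in lborel. norm \<xi> \<le> r \<longrightarrow> \<eta> \<le> norm (g \<xi>)"
        using \<eta>(1) r\<Lambda> by (auto elim!: eventually_mono)
      show "(\<lambda>\<xi>::real^'n. exp (- t * dissipation \<xi>)) \<in> borel_measurable borel"
        by (intro smooth_imp_measurable smooth_exp smooth_mult smooth_const smooth_dissipation)
      show "exp (- t * dissipation \<xi>) \<le> 1" for \<xi> :: "real^'n"
        using t dissipation_bounds(1)[of \<xi>] by simp
      show "exp (- 1) \<le> exp (- t * dissipation \<xi>)" if "norm \<xi> \<le> r" for \<xi> :: "real^'n"
      proof -
        have "t * dissipation \<xi> \<le> t * r\<^sup>2"
          using t that dissipation_bounds(3)[of \<xi>] power_mono[OF that norm_ge_zero, of 2]
          by (intro mult_left_mono) auto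
        also have "\<dots> = 1"
          using t by (simp add: r_def power_divide)
        finally show ?thesis by simp
      qed
      show "norm (\<integral>\<xi>. g \<xi> * (complex_of_real (exp (- t * dissipation \<xi>)) * \<phi> \<xi>) \<partial>lborel)
          \<le> L2_norm (u t) * plancherel_const TYPE('n) * L2_norm \<phi>
            + C\<^sup>2 * norm b * ln (1 + t) * (\<integral>\<xi>. norm \<xi> * norm (\<phi> \<xi>) \<partial>lborel)"
        if "\<phi> \<in> test_functions" for \<phi>
        by (rule solution_low_frequency_estimate[OF d chi f sol sq decay g t(4) that])
    qed (use \<eta>(2) r t L2_norm_nonneg plancherel_const_pos[where 'n = 'n] in \<open>auto intro: mult_nonneg_nonneg less_imp_le\<close>)
    moreover define R where "R = r ^ CARD('n)"
    moreover have "measure lborel (ball (0::real^'n) (3 / 4 * r)) = V * (3 / 4) ^ CARD('n) * R"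
      "measure lborel (ball (0::real^'n) (4 / 3 * r)) = V * (4 / 3) ^ CARD('n) * R"
      unfolding R_def by (rule ball, simp)+
    ultimately have "a * R \<le> L2_norm (u t) * b' * sqrt R + c' * (ln (1 + t) / sqrt t) * R"
      by (simp add: a_def b'_def c'_def r_def real_sqrt_mult mult_ac)
    moreover have "c' * (ln (1 + t) / sqrt t) * R \<le> a / 2 * R"
      using T\<^sub>0[OF t(1)] r by (intro mult_right_mono) (auto simp: R_def)
    ultimately have "a / 2 * R \<le> L2_norm (u t) * b' * sqrt R"
      by linarith
    moreover have R: "0 < R"
      using r by (simp add: R_def)
    moreover have "R = sqrt R * sqrt R"
      using R by simp
    ultimately have "(a / 2 * sqrt R) * sqrt R \<le> (L2_norm (u t) * b') * sqrt R"
      by (metis mult.assoc)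
    then have "a / 2 * sqrt R \<le> L2_norm (u t) * b'"
      using R by (simp only: mult_le_cancel_right_pos real_sqrt_gt_0_iff)
    then have "a / (2 * b') * sqrt R \<le> L2_norm (u t)"
      using b' by (simp add: field_simps)
    moreover have "sqrt R = t powr (- (CARD('n) / 4))"
    proof -
      have "r = t powr (- (1 / 2))"
        using t by (simp add: r_def powr_minus_divide powr_half_sqrt)
      then have "R = t powr (- (CARD('n) / 2))"
        using t by (simp add: R_def powr_realpow[symmetric] powr_powr)
      then show ?thesis
        using t by (simp add: powr_half_sqrt[symmetric] powr_powr)
    qed
    moreover have "(1 + t) powr (- (CARD('n) / 4)) \<le> t powr (- (CARD('n) / 4))"
      using t by (intro powr_mono2') auto
    ultimately show ?thesis
      using a b' mult_left_mono[of "(1 + t) powr (- (CARD('n) / 4))" "t powr (- (CARD('n) / 4))" "a / (2 * b')"]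
      by simp
  qed
  show ?thesis
    using main a b' by (intro exI[of _ "a / (2 * b')"] conjI exI[of _ T]) (auto simp: T_def)
qed

theorem lemma5p4:
  fixes chi :: "real^'n \<Rightarrow> real" and b :: "real^'n" and f :: "real \<Rightarrow> real^'n"
  assumes "CARD('n) \<ge> 2"
    and "lp_cutoff chi"
    and "b \<noteq> 0"
    and "f = (\<lambda>r. r\<^sup>2 *\<^sub>R b)"
  shows "\<exists>\<alpha>>0.
    ((\<exists>\<beta>. smallness_constant chi f \<beta>) \<longrightarrow> smallness_constant chi f \<alpha>) \<and>
    (\<forall>(u0 :: 'n distr) (u :: real \<Rightarrow> real^'n \<Rightarrow> real) (C :: real) (\<eta> :: real) (\<Lambda>\<^sub>2 :: real).
      u0 \<in> besov21 chi (CARD('n) / 2 - 1) \<inter> besov21 chi (CARD('n) / 2 + 1) \<inter> besov2inf chi (- (CARD('n) / 2)) \<longrightarrow>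
      small_data chi \<alpha> u0 \<longrightarrow>
      global_solution chi f u0 u \<longrightarrow>
      (\<forall>t\<ge>0. square_integrable (u t) \<and> L2_norm (u t) \<le> C * (1 + t) powr (- (CARD('n) / 4))) \<longrightarrow>
      \<eta> > 0 \<longrightarrow> \<Lambda>\<^sub>2 > 0 \<longrightarrow>
      (\<exists>g. represents g (fourier_distr u0) \<and> (AE \<xi> in lborel. norm \<xi> \<le> \<Lambda>\<^sub>2 \<longrightarrow> norm (g \<xi>) \<ge> \<eta>)) \<longrightarrow>
      (\<exists>c\<^sub>\<eta>>0. \<exists>T\<^sub>\<eta>>0. \<forall>t\<ge>T\<^sub>\<eta>. L2_norm (u t) \<ge> c\<^sub>\<eta> * (1 + t) powr (- (CARD('n) / 4))) \<and>
      (\<lambda>t. L2_norm (u t)) \<in> \<Theta>[at_top](\<lambda>t. (1 + t) powr (- (CARD('n) / 4))))"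
proof -
  \<comment> \<open>If there is no smallness constant at all, 1 is a default value.\<close>
  define \<alpha> where "\<alpha> = (if \<exists>\<beta>. smallness_constant chi f \<beta> then SOME \<beta>. smallness_constant chi f \<beta> else 1)"
  have \<alpha>: "(\<exists>\<beta>. smallness_constant chi f \<beta>) \<longrightarrow> smallness_constant chi f \<alpha>"
    by (auto simp: \<alpha>_def intro: someI)
  have "\<alpha> > 0"
  proof (cases "\<exists>\<beta>. smallness_constant chi f \<beta>")
    case True
    with \<alpha> show ?thesis by (simp add: smallness_constant_def)
  next
    case False
    then show ?thesis by (simp add: \<alpha>_def)
  qed
  moreover have "(\<exists>c>0. \<exists>T>0. \<forall>t\<ge>T. L2_norm (u t) \<ge> c * (1 + t) powr (- (CARD('n) / 4))) \<and>
      (\<lambda>t. L2_norm (u t)) \<in> \<Theta>[at_top](\<lambda>t. (1 + t) powr (- (CARD('n) / 4)))"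
    if sol: "global_solution chi f u0 u"
      and decay: "\<forall>t\<ge>0. square_integrable (u t) \<and> L2_norm (u t) \<le> C * (1 + t) powr (- (CARD('n) / 4))"
      and pos: "\<eta> > 0" "\<Lambda>\<^sub>2 > 0"
      and g: "represents g (fourier_distr u0)" "AE \<xi> in lborel. norm \<xi> \<le> \<Lambda>\<^sub>2 \<longrightarrow> norm (g \<xi>) \<ge> \<eta>"
    for u0 :: "'n distr" and u C \<eta> \<Lambda>\<^sub>2 g
  proof
    show lower: "\<exists>c>0. \<exists>T>0. \<forall>t\<ge>T. L2_norm (u t) \<ge> c * (1 + t) powr (- (CARD('n) / 4))"
      using decay by (intro solution_L2_lower_bound[OF assms(1,2,4) sol _ _ g pos]) auto
    then obtain c T where cT: "0 < c" "\<And>t. T \<le> t \<Longrightarrow> c * (1 + t) powr (- (CARD('n) / 4)) \<le> L2_norm (u t)"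
      by blast
    show "(\<lambda>t. L2_norm (u t)) \<in> \<Theta>[at_top](\<lambda>t. (1 + t) powr (- (CARD('n) / 4)))"
    proof (rule bigthetaI)
      show "(\<lambda>t. L2_norm (u t)) \<in> O(\<lambda>t. (1 + t) powr (- (CARD('n) / 4)))"
      proof (rule bigoI[of _ C])
        show "eventually (\<lambda>t. norm (L2_norm (u t)) \<le> C * norm ((1 + t) powr (- (CARD('n) / 4)))) at_top"
          using eventually_ge_at_top[of 0] by eventually_elim (use decay in \<open>simp add: L2_norm_nonneg\<close>)
      qed
      show "(\<lambda>t. L2_norm (u t)) \<in> \<Omega>(\<lambda>t. (1 + t) powr (- (CARD('n) / 4)))"
      proof (rule landau_omega.bigI[OF cT(1)])
        show "eventually (\<lambda>t. c * norm ((1 + t) powr (- (CARD('n) / 4))) \<le> norm (L2_norm (u t))) at_top"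
          using eventually_ge_at_top[of T] by eventually_elim (use cT(2) in \<open>simp add: L2_norm_nonneg\<close>)
      qed
    qed
  qed
  ultimately show ?thesis
    using \<alpha> by blast
qed

end
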